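(* Let $k$ be a positive integer, with all notation as in the context. (2) Assume $r_1>0$. Let $(p_1,\dots,p_{r_1})\in\mathcal S_1\times\cdots\times\mathcal S_{r_1}$, let $\epsilon>0$ be real and $A$ a positive integer with $$A>\frac{\log([F:\mathbb Q])+\log(r_1)-\log(d_1)-\log(\epsilon)}{\log(p_{\min})}.$$ Then $f_1(k)<\epsilon$ whenever $k$ is a multiple of $\mathrm{lcm}(p_1^A,\dots,p_{r_1}^A)$. (3) Assume $r_2+r_3>0$. Then $f_2(k)<1$ whenever $k$ is a prime number $\ge c$.
   Context: $F$ is a number field, $O_F$ its ring of integers, $P(T)\in O_F[T]$ monic separable with $P(0)\ne0$, $P(1)\ne0$, $L_1$ its splitting field over $F$. Distinct roots: $t_1,\dots,t_{r_1}$ roots of unity; $t_{r_1+1},\dots,t_{r_1+r_2}$ units of $O_{L_1}$ not roots of unity; $t_{r_1+r_2+1},\dots,t_r$ non-units of $O_{L_1}$; $r=r_1+r_2+r_3$. For $j\le r_1$, $t_j=e^{2i\pi m_j/n_j}$, $\gcd(m_j,n_j)=1$, $1\le m_j<n_j$; $\mathcal S_j$ = set of prime factors of $n_j$; $p_{\min}=\min(\mathcal S_1\cup\cdots\cup\mathcal S_{r_1})$. $d_1=|\bigcup_{j=1}^r\mathrm{Gal}(L_1/F(t_j))|/|\mathrm{Gal}(L_1/F)|$. For $k\ge1$, $L_k$ is the splitting field of $P(T^k)$ over $F$; for each $j$ fix a $k$-th root $\sqrt[k]{t_j}$, with $\sqrt[k]{t_j}=e^{2i\pi m_j/(kn_j)}$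 for $j\le r_1$. For subfields $M$ of $L_k$ containing $F$, $\mathrm{Gal}(L_k/M)$ is the subgroup fixing $M$. Let $D_k=|\bigcup_{j=1}^r\mathrm{Gal}(L_k/F(t_j))|$. Define $f_1(k)=|\bigcup_{j=1}^{r_1}\bigcup_{l=0}^{k-1}\mathrm{Gal}(L_k/F(e^{2i\pi l/k}\sqrt[k]{t_j}))|/D_k$ if $r_1>0$ (and $0$ if $r_1=0$), and $f_2(k)=|\bigcup_{j=r_1+1}^{r}\bigcup_{l=0}^{k-1}\mathrm{Gal}(L_k/F(e^{2i\pi l/k}\sqrt[k]{t_j}))|/D_k$ if $r_2+r_3>0$ (and $0$ otherwise). The constant $c$: fix $k_0\ge1$ such that for every prime $p\ge k_0$, $\mathbb Q(e^{2i\pi/p})$ and $L_1$ are linearly disjoint over $\mathbb Q$; if $r_2>0$, fix fundamental units $u_1,\dots,u_v$ of $O_{L_1}$, write $t_j=\zeta_ju_1^{a_{j,1}}\cdots u_v^{a_{j,v}}$ ($\zeta_j$ a root of unity) for unit roots, $a_j=\gcd_l|a_{j,l}|$, $a_0=\mathrm{lcm}_j a_j$; if $r_3>0$, for each non-unit root pick a nonzero prime $\mathcal P_j$ of $O_{L_1}$ with $v_{\mathcal P_j}(t_j)\ge1$, $v_0=\mathrm{lcm}_j v_{\mathcal P_j}(t_j)$. Then $c=\max(r_2+r_3+1,k_0,\mathrm{lcm}(a_0,v_0)+1)$ if $r_2,r_3>0$; $c=\max(r_3+1,v_0+1)$ if $r_2=0$; $c=\max(r_2+1,k_0,a_0+1)$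 if $r_3=0$. *)

theory Defs
  imports
    "HOL-Algebra.Algebra"
    "HOL-Algebra.Algebraic_Closure_Type"
    "HOL-Computational_Algebra.Computational_Algebra"
begin

text \<open>All fields are subfields of the complex numbers, given by their carrier sets.\<close>

abbreviation CC :: "complex ring" where
  "CC \<equiv> ring_of_type_algebra"

definition number_field :: "complex set \<Rightarrow> bool" where
  "number_field F \<longleftrightarrow> subfield F CC \<and> ring.finite_dimension CC \<rat> F"

definition abs_degree :: "complex set \<Rightarrow> nat" where
  "abs_degree F = ring.dim CC \<rat> F"

definition ring_of_integers :: "complex set \<Rightarrow> complex ring" where
  "ring_of_integers K = CC\<lparr>carrier := {x \<in> K. algebraic_int x}\<rparr>"

definition adjoin :: "complex set \<Rightarrow> complex set \<Rightarrow> complex set" where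
  "adjoin F S = generate_field CC (F \<union> S)"

definition splitting_field :: "complex set \<Rightarrow> complex poly \<Rightarrow> complex set" where
  "splitting_field F p = adjoin F {z. poly p z = 0}"

text \<open>Automorphisms are made extensional outside \<open>L\<close>, so that each one is counted once.\<close>

definition Gal :: "complex set \<Rightarrow> complex set \<Rightarrow> (complex \<Rightarrow> complex) set" where
  "Gal L M = {\<sigma> \<in> ring_iso (CC\<lparr>carrier := L\<rparr>) (CC\<lparr>carrier := L\<rparr>).
     \<sigma> \<in> extensional L \<and> (\<forall>x\<in>M. \<sigma> x = x)}"

definition root_of_unity :: "complex \<Rightarrow> bool" where
  "root_of_unity z \<longleftrightarrow> (\<exists>N>0. z ^ N = 1)"

text \<open>Linear disjointness over \<open>\<rat>\<close>: every finite family in \<open>K\<close> that is linearly independent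
  over \<open>\<rat>\<close> stays linearly independent over \<open>L\<close>.\<close>

definition linearly_disjoint :: "complex set \<Rightarrow> complex set \<Rightarrow> bool" where
  "linearly_disjoint K L \<longleftrightarrow>
     (\<forall>xs. set xs \<subseteq> K \<longrightarrow> ring.independent CC \<rat> xs \<longrightarrow> ring.independent CC L xs)"

text \<open>\<open>u 1, \<dots>, u v\<close> form a basis of the unit group of the ring of integers of \<open>L\<close> modulo
  torsion.\<close>

definition fundamental_units :: "complex set \<Rightarrow> nat \<Rightarrow> (nat \<Rightarrow> complex) \<Rightarrow> bool" where
  "fundamental_units L v u \<longleftrightarrow>
     (\<forall>l\<in>{1..v}. u l \<in> Units (ring_of_integers L)) \<and>
     (\<forall>x\<in>Units (ring_of_integers L). \<exists>!(\<zeta>, e). \<zeta> \<in> L \<and> root_of_unity \<zeta> \<and>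
        e \<in> extensional {1..v} \<and> x = \<zeta> * (\<Prod>l\<in>{1..v}. u l powi (e l :: int)))"

text \<open>The exponent of the prime ideal \<open>Q\<close> in the factorisation of the principal ideal of \<open>x\<close>
  (for \<open>x \<noteq> 0\<close>).\<close>

definition ideal_val :: "complex ring \<Rightarrow> complex set \<Rightarrow> complex \<Rightarrow> nat" where
  "ideal_val R Q x = (GREATEST e::nat.
     (Q [^]\<^bsub>ideals_set R\<^esub> e) divides\<^bsub>ideals_set R\<^esub> (PIdl\<^bsub>R\<^esub> x))"

definition Lk :: "complex set \<Rightarrow> complex poly \<Rightarrow> nat \<Rightarrow> complex set" where
  "Lk F P k = splitting_field F (pcompose P (monom 1 k))"

definition d1 :: "complex set \<Rightarrow> complex poly \<Rightarrow> nat \<Rightarrow> (nat \<Rightarrow> complex) \<Rightarrow> real" where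
  "d1 F P r t =
     real (card (\<Union>j\<in>{1..r}. Gal (splitting_field F P) (adjoin F {t j})))
       / real (card (Gal (splitting_field F P) F))"

definition Dk :: "complex set \<Rightarrow> complex poly \<Rightarrow> nat \<Rightarrow> (nat \<Rightarrow> complex) \<Rightarrow> nat \<Rightarrow> nat" where
  "Dk F P r t k = card (\<Union>j\<in>{1..r}. Gal (Lk F P k) (adjoin F {t j}))"

text \<open>\<open>s k j\<close> is the chosen \<open>k\<close>-th root of \<open>t j\<close>.\<close>

definition f1 :: "complex set \<Rightarrow> complex poly \<Rightarrow> nat \<Rightarrow> nat \<Rightarrow> (nat \<Rightarrow> complex) \<Rightarrow>
    (nat \<Rightarrow> nat \<Rightarrow> complex) \<Rightarrow> nat \<Rightarrow> real" where
  "f1 F P r1 r t s k = (if r1 > 0 then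
     real (card (\<Union>j\<in>{1..r1}. \<Union>l\<in>{0..<k}.
         Gal (Lk F P k) (adjoin F {cis (2 * pi * real l / real k) * s k j})))
       / real (Dk F P r t k) else 0)"

definition f2 :: "complex set \<Rightarrow> complex poly \<Rightarrow> nat \<Rightarrow> nat \<Rightarrow> (nat \<Rightarrow> complex) \<Rightarrow>
    (nat \<Rightarrow> nat \<Rightarrow> complex) \<Rightarrow> nat \<Rightarrow> real" where
  "f2 F P r1 r t s k = (if r > r1 then
     real (card (\<Union>j\<in>{r1+1..r}. \<Union>l\<in>{0..<k}.
         Gal (Lk F P k) (adjoin F {cis (2 * pi * real l / real k) * s k j})))
       / real (Dk F P r t k) else 0)"

definition p_min :: "nat \<Rightarrow> (nat \<Rightarrow> nat) \<Rightarrow> nat" where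
  "p_min r1 n = Min (\<Union>j\<in>{1..r1}. prime_factors (n j))"

text \<open>\<open>a j l\<close> is the exponent of the \<open>l\<close>-th fundamental unit in the unit root \<open>t j\<close>;
  the lcm runs over the unit roots that are not roots of unity.\<close>

definition a_zero :: "nat \<Rightarrow> nat \<Rightarrow> nat \<Rightarrow> (nat \<Rightarrow> nat \<Rightarrow> int) \<Rightarrow> nat" where
  "a_zero r1 r2 v a = (LCM j\<in>{r1+1..r1+r2}. GCD l\<in>{1..v}. nat \<bar>a j l\<bar>)"

definition v_zero :: "complex ring \<Rightarrow> nat \<Rightarrow> nat \<Rightarrow> nat \<Rightarrow> (nat \<Rightarrow> complex set) \<Rightarrow>
    (nat \<Rightarrow> complex) \<Rightarrow> nat" where
  "v_zero R r1 r2 r3 Q t = (LCM j\<in>{r1+r2+1..r1+r2+r3}. ideal_val R (Q j) (t j))"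

definition c_const :: "nat \<Rightarrow> nat \<Rightarrow> nat \<Rightarrow> nat \<Rightarrow> nat \<Rightarrow> nat" where
  "c_const r2 r3 k0 a0 v0 =
     (if r2 = 0 then max (r3 + 1) (v0 + 1)
      else if r3 = 0 then Max {r2 + 1, k0, a0 + 1}
      else Max {r2 + r3 + 1, k0, lcm a0 v0 + 1})"

end

theory Submission
  imports Defs "Jordan_Normal_Form.Char_Poly"
begin

text \<open>
  Write \<open>G\<close> for the group of \<open>L\<^sub>k\<close> over \<open>F\<close>. Restriction to \<open>L\<^sub>1\<close> is onto with fibres of equal size, so
  \<open>D\<^sub>k = d\<^sub>1 |G|\<close>.

  If \<open>p\<^sub>j\<close> divides \<open>n\<^sub>j\<close> and \<open>p\<^sub>j ^ A\<close> divides \<open>k\<close>, then every \<open>k\<close>-th root of the root of unity \<open>t\<^sub>j\<close> has order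
  divisible by \<open>p\<^sub>j ^ (A + 1)\<close>. An automorphism fixing one of them therefore fixes a primitive
  \<open>p\<^sub>j ^ (A + 1)\<close>-th root of unity, which has degree at least \<open>p\<^sub>j ^ A / [F : \<rat>]\<close> over \<open>F\<close>; such automorphisms
  make up a proportion of at most \<open>[F : \<rat>] / p\<^sub>j ^ A\<close> of \<open>G\<close>, and summing over \<open>j\<close> gives the bound on \<open>f\<^sub>1\<close>.

  For the bound on \<open>f\<^sub>2\<close> let \<open>k\<close> be prime. By the choice of \<open>c\<close> the remaining \<open>t\<^sub>j\<close> are not \<open>k\<close>-th powers in
  \<open>L\<^sub>1\<close>: otherwise \<open>k\<close> would divide all exponents of the fundamental units, respectively the
  valuation at \<open>\<P>\<^sub>j\<close> would be at least \<open>k\<close>. The constant term of a minimal polynomial of degree below \<open>k\<close> shows that they do not become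
  \<open>k\<close>-th powers in \<open>L\<^sub>1(e ^ (2 i \<pi> / k))\<close> either, so each fixed radical cuts out a subgroup of index \<open>k\<close> in the
  Galois group over this field. As \<open>k > r\<^sub>2 + r\<^sub>3\<close>, these subgroups do not cover it.
\<close>

section \<open>Algebraic integers\<close>

text \<open>Inequalities suffice throughout. For \<open>f1\<close>, neither a stabilizer nor a
  cyclotomic degree is computed exactly: the first p^A powers of a primitive p^(A+1)-th root of
  unity are independent over the rationals, and a rational spanning set of \<open>F\<close> of size
  at most [F : Q] turns this into a degree bound over \<open>F\<close>. The condition on
  \<open>A\<close> is the logarithm of [F : Q] r_1 < p_min^A d_1 \<epsilon>. For \<open>f2\<close>
  the obstacle is the valuation. \<open>ideal_val\<close> is a greatest exponent in the monoid of
  ideals of O, so it must be shown that the exponents are bounded and that y in Q makes Q a divisor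
  of (y). Both follow from the invertibility of Q, which is drawn from the finiteness of O/mO by
  pigeonhole on powers: one number \<gamma> outside O with \<gamma> Q inside O and 1 in Q + \<gamma>
  Q serves both purposes. The strict bound then needs one automorphism counted by \<open>Dk\<close>
  that fixes no radical. It is sought over L_1(e^(2 i \<pi> / k)), where the k radicals of one t_j
  are either all fixed or all moved.\<close>

lemma algebraic_int_of_integer_matrix:
  fixes v :: "'i \<Rightarrow> complex" and c :: "'i \<Rightarrow> 'i \<Rightarrow> int"
  assumes I: "finite I" "i0 \<in> I" "v i0 \<noteq> 0"
    and c: "\<And>i. i \<in> I \<Longrightarrow> z * v i = (\<Sum>j\<in>I. of_int (c i j) * v j)"
  shows "algebraic_int z"
proof -
  define n where "n = card I"
  obtain f where f: "bij_betw f {0..<n} I"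
    unfolding n_def using ex_bij_betw_nat_finite[OF I(1)] by blast
  define A where "A = mat n n (\<lambda>(i, j). c (f i) (f j))"
  define B :: "complex mat" where "B = map_mat of_int A"
  define w where "w = vec n (\<lambda>i. v (f i))"
  have A: "A \<in> carrier_mat n n" and B: "B \<in> carrier_mat n n" and w: "w \<in> carrier_vec n"
    by (auto simp: A_def B_def w_def)
  obtain l where l: "l < n" "f l = i0"
    using f I(2) unfolding bij_betw_def by (metis atLeastLessThan_iff imageE)
  have "w $ l \<noteq> 0"
    using l I(3) by (simp add: w_def)
  hence w0: "w \<noteq> 0\<^sub>v n"
    using l by auto
  have "B *\<^sub>v w = z \<cdot>\<^sub>v w"
  proof (rule eq_vecI)
    fix i assume "i < dim_vec (z \<cdot>\<^sub>v w)"
    hence i: "i < n" by (simp add: w_def)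
    hence fi: "f i \<in> I"
      using f by (auto simp: bij_betw_def)
    have "(B *\<^sub>v w) $ i = (\<Sum>j = 0..<n. of_int (c (f i) (f j)) * v (f j))"
      using i by (simp add: B_def A_def w_def scalar_prod_def)
    also have "\<dots> = (\<Sum>j\<in>I. of_int (c (f i) j) * v j)"
      by (rule sum.reindex_bij_betw[OF f])
    finally show "(B *\<^sub>v w) $ i = (z \<cdot>\<^sub>v w) $ i"
      using c[OF fi] i by (simp add: w_def)
  qed (simp add: B_def A_def w_def)
  \<comment> \<open>The family \<open>v\<close>, listed along \<open>f\<close>, is an eigenvector of
    an integer matrix, nonzero because of its entry at \<open>i0\<close>. So \<open>z\<close> is a
    root of a monic integer characteristic polynomial.\<close>
  hence "eigenvalue B z"
    unfolding eigenvalue_def eigenvector_def using B w w0 by auto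
  hence "poly (char_poly B) z = 0"
    using eigenvalue_root_char_poly[OF B] by simp
  moreover have "char_poly B = map_poly of_int (char_poly A)"
    unfolding B_def by (rule of_int_hom.char_poly_hom[OF A])
  moreover have "lead_coeff (char_poly A) = 1"
    using degree_monic_char_poly[OF A] by simp
  ultimately show ?thesis
    unfolding algebraic_int_altdef_ipoly by (intro exI[of _ "char_poly A"]) simp
qed

section \<open>Finitely generated groups of complex numbers as a test for integrality\<close>

definition int_span :: "('i \<Rightarrow> complex) \<Rightarrow> 'i set \<Rightarrow> complex set" where
  "int_span v I = {(\<Sum>i\<in>I. of_int (c i) * v i) | c :: 'i \<Rightarrow> int. True}"

lemma int_span_add: "x \<in> int_span v I \<Longrightarrow> y \<in> int_span v I \<Longrightarrow> x + y \<in> int_span v I"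
proof -
  assume "x \<in> int_span v I" "y \<in> int_span v I"
  then obtain c d where "x = (\<Sum>i\<in>I. of_int (c i) * v i)" "y = (\<Sum>i\<in>I. of_int (d i) * v i)"
    by (auto simp: int_span_def)
  hence "x + y = (\<Sum>i\<in>I. of_int (c i + d i) * v i)"
    by (simp add: sum.distrib algebra_simps)
  thus ?thesis unfolding int_span_def
    by (intro CollectI exI[of _ "\<lambda>i. c i + d i"]) simp
qed

lemma int_span_scale: "x \<in> int_span v I \<Longrightarrow> of_int m * x \<in> int_span v I"
proof -
  assume "x \<in> int_span v I"
  then obtain c where "x = (\<Sum>i\<in>I. of_int (c i) * v i)"
    by (auto simp: int_span_def)
  hence "of_int m * x = (\<Sum>i\<in>I. of_int (m * c i) * v i)"
    by (simp add: sum_distrib_left algebra_simps)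
  thus ?thesis unfolding int_span_def
    by (intro CollectI exI[of _ "\<lambda>i. m * c i"]) simp
qed

lemma int_span_sum: "(\<And>j. j \<in> J \<Longrightarrow> g j \<in> int_span v I) \<Longrightarrow> sum g J \<in> int_span v I"
proof (induction J rule: infinite_finite_induct)
  case (insert x F)
  thus ?case by (simp add: int_span_add)
qed (auto simp: int_span_def intro!: exI[of _ "\<lambda>_. 0"])

lemma int_span_base:
  assumes "finite I" "i \<in> I"
  shows "v i \<in> int_span v I"
proof -
  have "(\<Sum>j\<in>I. of_int (if j = i then 1 else 0) * v j) = (\<Sum>j\<in>I. if j = i then v j else 0)"
    by (intro sum.cong) auto
  also have "\<dots> = v i"
    using assms by simp
  finally show ?thesis
    unfolding int_span_def by (intro CollectI exI[of _ "\<lambda>j. if j = i then 1 else 0"]) simp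
qed

lemma int_span_mult_closed:
  assumes "\<And>i. i \<in> I \<Longrightarrow> x * v i \<in> int_span v I" and "m \<in> int_span v I"
  shows "x * m \<in> int_span v I"
proof -
  from assms(2) obtain c where "m = (\<Sum>i\<in>I. of_int (c i) * v i)"
    by (auto simp: int_span_def)
  hence "x * m = (\<Sum>i\<in>I. of_int (c i) * (x * v i))"
    by (simp add: sum_distrib_left algebra_simps)
  thus ?thesis using assms(1) by (auto intro!: int_span_sum int_span_scale)
qed

lemma algebraic_int_of_int_span:
  assumes I: "finite I" "i0 \<in> I" "v i0 \<noteq> 0" and z: "\<And>i. i \<in> I \<Longrightarrow> z * v i \<in> int_span v I"
  shows "algebraic_int z"
proof -
  have "\<exists>c. z * v i = (\<Sum>j\<in>I. of_int (c j) * v j)" if "i \<in> I" for i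
    using z[OF that] by (auto simp: int_span_def)
  then obtain c :: "'a \<Rightarrow> 'a \<Rightarrow> int" where "\<And>i. i \<in> I \<Longrightarrow> z * v i = (\<Sum>j\<in>I. of_int (c i j) * v j)"
    by metis
  thus ?thesis using algebraic_int_of_integer_matrix[where v = v and I = I, OF I] by blast
qed

lemma algebraic_int_power_reduce:
  assumes "algebraic_int (x :: complex)"
  obtains a and c :: "nat \<Rightarrow> int" where "a > 0" "x ^ a = (\<Sum>i<a. of_int (c i) * x ^ i)"
proof -
  obtain p where p: "poly (map_poly of_int p) x = 0" "lead_coeff p = 1"
    using assms by (auto simp: algebraic_int_altdef_ipoly)
  have d: "degree p > 0"
  proof (rule ccontr)
    assume "\<not> degree p > 0"
    then obtain b where "p = [:b:]" by (auto elim: degree_eq_zeroE)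
    thus False using p by (auto simp: map_poly_pCons)
  qed
  have "0 = (\<Sum>i\<le>degree p. of_int (coeff p i) * x ^ i)"
    using p(1) by (simp add: poly_altdef degree_map_poly coeff_map_poly)
  also have "{..degree p} = insert (degree p) {..<degree p}" by auto
  also have "(\<Sum>i\<in>insert (degree p) {..<degree p}. of_int (coeff p i) * x ^ i) =
      x ^ degree p + (\<Sum>i<degree p. of_int (coeff p i) * x ^ i)"
    using p(2) by simp
  finally have "x ^ degree p = (\<Sum>i<degree p. of_int (- coeff p i) * x ^ i)"
    by (simp add: sum_negf eq_neg_iff_add_eq_0)
  thus ?thesis by (rule that[OF d])
qed

text \<open>Here and below the generators are a set indexed by itself, so coincidences among the
  products \<open>w * c ^ i\<close> do no harm.\<close>

lemma int_span_mult_power: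
  assumes "m \<in> int_span (\<lambda>w. w) W" "finite W" "i < a"
  shows "m * c ^ i \<in> int_span (\<lambda>w. w) ((\<lambda>(w, i). w * c ^ i) ` (W \<times> {..<a}))"
proof -
  obtain d :: "complex \<Rightarrow> int" where "m = (\<Sum>w\<in>W. of_int (d w) * w)"
    using assms(1) by (auto simp: int_span_def)
  hence "m * c ^ i = (\<Sum>w\<in>W. of_int (d w) * (w * c ^ i))"
    by (simp add: sum_distrib_right mult.assoc)
  moreover have "w * c ^ i \<in> int_span (\<lambda>w. w) ((\<lambda>(w, i). w * c ^ i) ` (W \<times> {..<a}))" if "w \<in> W" for w
    by (rule int_span_base) (use that assms in \<open>auto intro!: image_eqI[of _ _ "(w, i)"]\<close>)
  ultimately show ?thesis by (auto intro!: int_span_sum int_span_scale)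
qed

text \<open>A new element \<open>c\<close> replaces \<open>W\<close> by its products with the powers
  of \<open>c\<close> below the degree of a monic relation; that relation brings the top power back
  into the span. The condition \<open>1 \<in> W\<close> provides the nonzero entry for the
  eigenvector argument.\<close>

lemma algebraic_int_stable_module:
  assumes "finite C" "\<And>c. c \<in> C \<Longrightarrow> algebraic_int (c :: complex)"
  shows "\<exists>W. finite W \<and> 1 \<in> W \<and> (\<forall>c\<in>C. \<forall>w\<in>W. c * w \<in> int_span (\<lambda>w. w) W)"
  using assms
proof (induction C rule: finite_induct)
  case empty
  thus ?case by (intro exI[of _ "{1}"]) auto
next
  case (insert c C)
  then obtain W where W: "finite W" "1 \<in> W" "\<forall>c\<in>C. \<forall>w\<in>W. c * w \<in> int_span (\<lambda>w. w) W" by auto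
  obtain a and e :: "nat \<Rightarrow> int" where a: "a > 0" "c ^ a = (\<Sum>i<a. of_int (e i) * c ^ i)"
    using algebraic_int_power_reduce[of c] insert.prems by blast
  define V where "V = (\<lambda>(w, i). w * c ^ i) ` (W \<times> {..<a})"
  have base: "w * c ^ i \<in> int_span (\<lambda>w. w) V" if "w \<in> W" "i < a" for w i
    using int_span_mult_power[OF int_span_base[OF W(1) that(1), of "\<lambda>w. w"] W(1) that(2)]
    by (simp add: V_def)
  have "c' * x \<in> int_span (\<lambda>w. w) V" if c': "c' \<in> insert c C" and x: "x \<in> V" for c' x
  proof -
    obtain w i where wi: "x = w * c ^ i" "w \<in> W" "i < a" using x by (auto simp: V_def)
    consider "c' \<in> C" | "c' = c" "Suc i < a" | "c' = c" "Suc i = a" using c' wi(3) by force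
    thus ?thesis
    proof cases
      case 1
      hence "c' * w * c ^ i \<in> int_span (\<lambda>w. w) V"
        unfolding V_def using W(1,3) wi(2,3) by (intro int_span_mult_power) auto
      thus ?thesis by (simp add: wi(1) mult.assoc)
    next
      case 2
      thus ?thesis using base[OF wi(2), of "Suc i"] by (simp add: wi(1) mult_ac)
    next
      case 3
      hence "c' * x = w * c ^ a" by (auto simp: wi(1))
      also have "\<dots> = (\<Sum>i<a. of_int (e i) * (w * c ^ i))"
        by (simp only: a(2) sum_distrib_left mult.left_commute)
      finally show ?thesis using base[OF wi(2)] by (auto intro!: int_span_sum int_span_scale)
    qed
  qed
  moreover have "finite V" "1 \<in> V"
    using W a(1) by (auto simp: V_def intro!: image_eqI[of _ _ "(1, 0)"])
  ultimately show ?case by (intro exI[of _ V]) auto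
qed

text \<open>A module stable under both numbers is stable under their sum and their product.\<close>

lemma algebraic_int_add_mult:
  assumes "algebraic_int (x :: complex)" "algebraic_int y"
  shows "algebraic_int (x + y) \<and> algebraic_int (x * y)"
proof -
  obtain W where W: "finite W" "1 \<in> W" "\<forall>c\<in>{x, y}. \<forall>w\<in>W. c * w \<in> int_span (\<lambda>w. w) W"
    using algebraic_int_stable_module[of "{x, y}"] assms by auto
  have "(x + y) * w \<in> int_span (\<lambda>w. w) W" "(x * y) * w \<in> int_span (\<lambda>w. w) W" if "w \<in> W" for w
    using int_span_add[of "x * w" "\<lambda>w. w" W "y * w"] int_span_mult_closed[of W x "\<lambda>w. w" "y * w"] W(3) that
    by (simp_all add: algebra_simps)
  thus ?thesis using algebraic_int_of_int_span[where v = "\<lambda>w. w", OF W(1,2)] by auto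
qed

text \<open>The powers of \<open>x\<close> below the degree, multiplied into a module stable under
  all coefficients, span a module stable under \<open>x\<close>. It serves for the roots of
  \<open>P\<close>, whose coefficients are integers of \<open>F\<close>.\<close>

lemma algebraic_int_monic_root:
  fixes p :: "complex poly"
  assumes p: "lead_coeff p = 1" "\<And>i. algebraic_int (coeff p i)" "poly p x = 0"
  shows "algebraic_int x"
proof -
  define d where "d = degree p"
  have d: "d > 0"
  proof (rule ccontr)
    assume "\<not> d > 0"
    then obtain b where "p = [:b:]" by (auto simp: d_def elim: degree_eq_zeroE)
    thus False using p by auto
  qed
  have "0 = (\<Sum>i\<le>d. coeff p i * x ^ i)"
    using p(3) by (simp add: poly_altdef d_def)
  also have "{..d} = insert d {..<d}" by auto
  also have "(\<Sum>i\<in>insert d {..<d}. coeff p i * x ^ i) = x ^ d + (\<Sum>i<d. coeff p i * x ^ i)"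
    using p(1) by (simp add: d_def)
  finally have xd: "x ^ d = (\<Sum>i<d. of_int (-1) * (coeff p i * x ^ i))"
    by (simp add: sum_negf eq_neg_iff_add_eq_0)
  obtain W where W: "finite W" "1 \<in> W" "\<forall>c\<in>coeff p ` {..<d}. \<forall>w\<in>W. c * w \<in> int_span (\<lambda>w. w) W"
    using algebraic_int_stable_module[of "coeff p ` {..<d}"] p(2) by auto
  define V where "V = (\<lambda>(w, i). w * x ^ i) ` (W \<times> {..<d})"
  have "x * u \<in> int_span (\<lambda>w. w) V" if u: "u \<in> V" for u
  proof -
    obtain w i where wi: "u = w * x ^ i" "w \<in> W" "i < d" using u by (auto simp: V_def)
    show ?thesis
    proof (cases "Suc i < d")
      case True
      have "w * x ^ Suc i \<in> int_span (\<lambda>w. w) V"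
        unfolding V_def using int_span_base[OF W(1) wi(2), of "\<lambda>w. w"] W(1) True
        by (intro int_span_mult_power) auto
      thus ?thesis by (simp add: wi(1) mult_ac)
    next
      case False
      hence "Suc i = d" using wi(3) by simp
      hence "x * u = w * x ^ d" by (auto simp: wi(1))
      also have "\<dots> = (\<Sum>i<d. of_int (-1) * (coeff p i * w * x ^ i))"
        unfolding xd sum_distrib_left by (intro sum.cong) auto
      also have "\<dots> \<in> int_span (\<lambda>w. w) V"
      proof (intro int_span_sum int_span_scale)
        fix i assume "i \<in> {..<d}"
        thus "coeff p i * w * x ^ i \<in> int_span (\<lambda>w. w) V"
          unfolding V_def using W(1,3) wi(2) by (intro int_span_mult_power) auto
      qed
      finally show ?thesis .
    qed
  qed
  moreover have "finite V" "1 \<in> V"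
    using W d by (auto simp: V_def intro!: image_eqI[of _ _ "(1, 0)"])
  ultimately show ?thesis using algebraic_int_of_int_span[where v = "\<lambda>w. w", of V 1 x] by simp
qed

lemma algebraic_int_add: "algebraic_int (x :: complex) \<Longrightarrow> algebraic_int y \<Longrightarrow> algebraic_int (x + y)"
  and algebraic_int_mult: "algebraic_int (x :: complex) \<Longrightarrow> algebraic_int y \<Longrightarrow> algebraic_int (x * y)"
  using algebraic_int_add_mult by blast+

lemma algebraic_int_diff: "algebraic_int (x :: complex) \<Longrightarrow> algebraic_int y \<Longrightarrow> algebraic_int (x - y)"
  using algebraic_int_add[of x "- y"] by simp

lemma algebraic_int_power: "algebraic_int (x :: complex) \<Longrightarrow> algebraic_int (x ^ n)"
  by (induction n) (auto intro: algebraic_int_mult int_imp_algebraic_int)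

lemma algebraic_int_sum: "(\<And>i. i \<in> I \<Longrightarrow> algebraic_int (f i :: complex)) \<Longrightarrow> algebraic_int (sum f I)"
  by (induction I rule: infinite_finite_induct) (auto intro: algebraic_int_add)

lemma algebraic_int_prod: "(\<And>i. i \<in> I \<Longrightarrow> algebraic_int (f i :: complex)) \<Longrightarrow> algebraic_int (prod f I)"
  by (induction I rule: infinite_finite_induct) (auto intro: algebraic_int_mult int_imp_algebraic_int)

lemma algebraic_int_of_int: "algebraic_int (of_int m :: complex)"
  by (rule int_imp_algebraic_int) auto

lemmas algebraic_int_closed =
  algebraic_int_add algebraic_int_mult algebraic_int_diff algebraic_int_power
  algebraic_int_sum algebraic_int_prod algebraic_int_of_int

lemma algebraic_int_nth_root:
  assumes "algebraic_int ((x :: complex) ^ n)" "n > 0"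
  shows "algebraic_int x"
  by (rule algebraic_int_root[OF assms(1), where p = "monom 1 n"])
     (use assms(2) in \<open>auto simp: poly_monom degree_monom_eq\<close>)

lemma algebraic_int_1: "algebraic_int (1 :: complex)"
  by (rule int_imp_algebraic_int) auto

lemma algebraic_int_root_of_unity: "root_of_unity z \<Longrightarrow> algebraic_int z"
  unfolding root_of_unity_def by (metis algebraic_int_1 algebraic_int_nth_root)

section \<open>Subfields of the complex numbers\<close>

text \<open>Since \<open>inverse 0 = 0\<close>, closure under inverses needs no case
  distinction.\<close>

locale cfield =
  fixes K :: "complex set"
  assumes one_closed [simp, intro]: "1 \<in> K"
    and diff_closed [intro]: "x \<in> K \<Longrightarrow> y \<in> K \<Longrightarrow> x - y \<in> K"
    and mult_closed [intro]: "x \<in> K \<Longrightarrow> y \<in> K \<Longrightarrow> x * y \<in> K"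
    and inverse_closed [intro]: "x \<in> K \<Longrightarrow> inverse x \<in> K"
begin

lemma zero_closed [simp, intro]: "0 \<in> K"
  using diff_closed[of 1 1] by simp

lemma uminus_closed [intro]: "x \<in> K \<Longrightarrow> - x \<in> K"
  using diff_closed[of 0 x] by simp

lemma add_closed [intro]: "x \<in> K \<Longrightarrow> y \<in> K \<Longrightarrow> x + y \<in> K"
  using diff_closed[of x "- y"] by auto

lemma divide_closed [intro]: "x \<in> K \<Longrightarrow> y \<in> K \<Longrightarrow> x / y \<in> K"
  by (auto simp: divide_inverse)

lemma power_closed [intro]: "x \<in> K \<Longrightarrow> x ^ n \<in> K"
  by (induction n) auto

lemma sum_closed [intro]: "(\<And>i. i \<in> I \<Longrightarrow> f i \<in> K) \<Longrightarrow> sum f I \<in> K"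
  by (induction I rule: infinite_finite_induct) auto

lemma prod_closed [intro]: "(\<And>i. i \<in> I \<Longrightarrow> f i \<in> K) \<Longrightarrow> prod f I \<in> K"
  by (induction I rule: infinite_finite_induct) auto

lemma of_nat_closed [simp, intro]: "of_nat n \<in> K"
  by (induction n) auto

lemma of_int_closed [simp, intro]: "of_int n \<in> K"
  by (cases n) (auto simp: uminus_closed)

lemma powi_closed [intro]: "x \<in> K \<Longrightarrow> x powi n \<in> K"
  by (auto simp: power_int_def)

end

section \<open>The complex numbers as a ring structure, and adjunction of elements\<close>

lemma CC_simps [simp]:
  "carrier CC = UNIV" "x \<otimes>\<^bsub>CC\<^esub> y = x * y" "\<one>\<^bsub>CC\<^esub> = 1" "\<zero>\<^bsub>CC\<^esub> = 0" "x \<oplus>\<^bsub>CC\<^esub> y = x + y"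
  by (auto simp: ring_of_type_algebra_def)

lemma CC_field: "field CC" and CC_cring: "cring CC"
  by (rule field_from_type_algebra cring_from_type_algebra)+

interpretation CC: cring CC
  by (rule CC_cring)

lemma CC_a_inv [simp]: "a_inv CC x = - x"
  using CC.minus_equality[of "- x" x] by simp

lemma CC_m_inv [simp]: "x \<noteq> 0 \<Longrightarrow> m_inv CC x = inverse x"
  using CC.inv_unique'[of x "inverse x"] by simp

lemma subfield_CC_iff: "subfield K CC \<longleftrightarrow> cfield K"
proof
  assume K: "subfield K CC"
  note sub = subfieldE(1)[OF K]
  show "cfield K"
  proof
    show "1 \<in> K" using subringE(3)[OF sub] by simp
    show "x * y \<in> K" if "x \<in> K" "y \<in> K" for x y
      using subringE(6)[OF sub that] by simp
    show "x - y \<in> K" if "x \<in> K" "y \<in> K" for x y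
      using subringE(7)[OF sub that(1) subringE(5)[OF sub that(2)]] by simp
    show "inverse x \<in> K" if "x \<in> K" for x
      using ring.subfield_m_inv(1)[OF CC.ring_axioms K, of x] that by (cases "x = 0") auto
  qed
next
  assume "cfield K"
  then interpret cfield K .
  have "subring K CC"
    by (rule CC.subringI) auto
  thus "subfield K CC"
    by (rule field.subfieldI'[OF CC_field]) auto
qed

lemma cfield_adjoin: "cfield (adjoin F S)"
  unfolding adjoin_def subfield_CC_iff[symmetric] by (rule field.generate_field_is_subfield[OF CC_field]) simp

lemma adjoin_base: "F \<subseteq> adjoin F S" and adjoin_gens: "S \<subseteq> adjoin F S"
  unfolding adjoin_def by (auto intro: generate_field.incl)

lemma adjoin_least: "cfield K \<Longrightarrow> F \<subseteq> K \<Longrightarrow> S \<subseteq> K \<Longrightarrow> adjoin F S \<subseteq> K"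
  unfolding adjoin_def subfield_CC_iff[symmetric]
  by (rule field.generate_field_min_subfield1[OF CC_field]) auto

lemma adjoin_insert: "adjoin F (insert x S) = adjoin (adjoin F S) {x}"
proof (rule antisym)
  show "adjoin F (insert x S) \<subseteq> adjoin (adjoin F S) {x}"
    using adjoin_base[of F S] adjoin_gens[of S F] adjoin_base[of "adjoin F S" "{x}"]
      adjoin_gens[of "{x}" "adjoin F S"]
    by (intro adjoin_least cfield_adjoin) auto
  show "adjoin (adjoin F S) {x} \<subseteq> adjoin F (insert x S)"
    using adjoin_base[of F "insert x S"] adjoin_gens[of "insert x S" F]
    by (intro adjoin_least cfield_adjoin) auto
qed

lemma adjoin_empty: "cfield F \<Longrightarrow> adjoin F {} = F"
  using adjoin_base adjoin_least[of F F "{}"] by auto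

section \<open>Polynomials over a subfield\<close>

definition polys_over :: "complex set \<Rightarrow> complex poly set" where
  "polys_over K = {p. \<forall>i. coeff p i \<in> K}"

lemma polys_overD: "p \<in> polys_over K \<Longrightarrow> coeff p i \<in> K"
  by (simp add: polys_over_def)

lemma polys_over_mono: "K \<subseteq> E \<Longrightarrow> polys_over K \<subseteq> polys_over E"
  by (auto simp: polys_over_def)

context cfield
begin

lemma polys_over_zero [simp, intro]: "0 \<in> polys_over K"
  by (simp add: polys_over_def)

lemma polys_over_one [simp, intro]: "1 \<in> polys_over K"
  by (simp add: polys_over_def)

lemma polys_over_diff [intro]: "p \<in> polys_over K \<Longrightarrow> q \<in> polys_over K \<Longrightarrow> p - q \<in> polys_over K"
  by (auto simp: polys_over_def)

lemma polys_over_add [intro]: "p \<in> polys_over K \<Longrightarrow> q \<in> polys_over K \<Longrightarrow> p + q \<in> polys_over K"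
  by (auto simp: polys_over_def)

lemma polys_over_mult [intro]: "p \<in> polys_over K \<Longrightarrow> q \<in> polys_over K \<Longrightarrow> p * q \<in> polys_over K"
  by (auto simp: polys_over_def coeff_mult)

lemma polys_over_smult [intro]: "c \<in> K \<Longrightarrow> p \<in> polys_over K \<Longrightarrow> smult c p \<in> polys_over K"
  by (auto simp: polys_over_def)

lemma polys_over_monom [intro]: "c \<in> K \<Longrightarrow> monom c n \<in> polys_over K"
  by (auto simp: polys_over_def)

lemma polys_over_pCons [intro]: "c \<in> K \<Longrightarrow> p \<in> polys_over K \<Longrightarrow> pCons c p \<in> polys_over K"
  by (auto simp: polys_over_def coeff_pCons split: nat.splits)

lemma polys_over_pderiv [intro]: "p \<in> polys_over K \<Longrightarrow> pderiv p \<in> polys_over K"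
  by (auto simp: polys_over_def coeff_pderiv mult_closed simp flip: of_nat_Suc)

lemma poly_closed [intro]: "p \<in> polys_over K \<Longrightarrow> x \<in> K \<Longrightarrow> poly p x \<in> K"
  by (auto simp: polys_over_def poly_altdef)

text \<open>Long division by a monic divisor never leaves \<open>K\<close>. The induction runs over
  a bound from which on the coefficients of \<open>f\<close> vanish, so the zero polynomial is no
  exception.\<close>

lemma polys_over_division:
  assumes g: "g \<in> polys_over K" "lead_coeff g = 1" and f: "f \<in> polys_over K"
  obtains q h where "q \<in> polys_over K" "h \<in> polys_over K" "f = q * g + h"
    "h = 0 \<or> degree h < degree g"
proof -
  have "\<exists>q h. q \<in> polys_over K \<and> h \<in> polys_over K \<and> f = q * g + h \<and> (h = 0 \<or> degree h < degree g)"
    if "f \<in> polys_over K" "\<forall>i\<ge>n. coeff f i = 0" for n f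
    using that
  proof (induction n arbitrary: f)
    case 0
    hence "f = 0" by (simp add: poly_eq_iff)
    thus ?case by (intro exI[of _ 0]) auto
  next
    case (Suc n)
    show ?case
    proof (cases "n < degree g")
      case True
      have "degree f \<le> n"
        using Suc.prems by (intro degree_le) auto
      thus ?thesis using True Suc.prems by (intro exI[of _ 0] exI[of _ f]) auto
    next
      case False
      define d where "d = n - degree g"
      \<comment> \<open>\<open>u * g\<close> agrees with \<open>f\<close> at the top index
        \<open>n\<close>, so subtracting it lowers the bound by one.\<close>
      define u where "u = monom (coeff f n) d"
      have u: "u \<in> polys_over K"
        using Suc.prems by (auto simp: u_def polys_overD)
      have "coeff (f - u * g) i = 0" if "i \<ge> n" for i
      proof (cases "i = n")
        case True
        have "coeff (u * g) n = coeff f n * coeff g (degree g)"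
          using False by (simp add: u_def d_def coeff_monom_mult)
        thus ?thesis using True g by simp
      next
        case i: False
        hence "coeff g (i - d) = 0"
          using that False by (intro coeff_eq_0) (auto simp: d_def)
        thus ?thesis using i that Suc.prems by (simp add: u_def coeff_monom_mult)
      qed
      then obtain q h where "q \<in> polys_over K" "h \<in> polys_over K" "f - u * g = q * g + h"
        "h = 0 \<or> degree h < degree g"
        using Suc.IH[of "f - u * g"] Suc.prems(1) u g(1) by blast
      thus ?thesis using u
        by (intro exI[of _ "u + q"] exI[of _ h]) (auto simp: algebra_simps)
    qed
  qed
  from this[OF f, of "Suc (degree f)"] obtain q h where "q \<in> polys_over K" "h \<in> polys_over K"
    "f = q * g + h" "h = 0 \<or> degree h < degree g"
    by (auto simp: coeff_eq_0)
  thus ?thesis by (rule that)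
qed

end

subsection \<open>Minimal polynomials\<close>

definition algebraic_over :: "complex set \<Rightarrow> complex \<Rightarrow> bool" where
  "algebraic_over K x \<longleftrightarrow> (\<exists>p\<in>polys_over K. p \<noteq> 0 \<and> poly p x = 0)"

definition is_minpoly :: "complex set \<Rightarrow> complex \<Rightarrow> complex poly \<Rightarrow> bool" where
  "is_minpoly K x m \<longleftrightarrow> m \<in> polys_over K \<and> lead_coeff m = 1 \<and> poly m x = 0 \<and>
     (\<forall>p\<in>polys_over K. p \<noteq> 0 \<longrightarrow> poly p x = 0 \<longrightarrow> degree m \<le> degree p)"

lemma is_minpolyD:
  assumes "is_minpoly K x m"
  shows "m \<in> polys_over K" "lead_coeff m = 1" "poly m x = 0" "m \<noteq> 0" "degree m > 0"
    and "\<And>p. p \<in> polys_over K \<Longrightarrow> p \<noteq> 0 \<Longrightarrow> poly p x = 0 \<Longrightarrow> degree m \<le> degree p"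
proof -
  show 1: "m \<in> polys_over K" "lead_coeff m = 1" "poly m x = 0"
    "\<And>p. p \<in> polys_over K \<Longrightarrow> p \<noteq> 0 \<Longrightarrow> poly p x = 0 \<Longrightarrow> degree m \<le> degree p"
    using assms by (auto simp: is_minpoly_def)
  show "m \<noteq> 0" using 1 by auto
  show "degree m > 0"
  proof (rule ccontr)
    assume "\<not> degree m > 0"
    then obtain b where "m = [:b:]" by (auto elim: degree_eq_zeroE)
    thus False using 1 by auto
  qed
qed

lemma algebraic_over_mono: "K \<subseteq> E \<Longrightarrow> algebraic_over K x \<Longrightarrow> algebraic_over E x"
  using polys_over_mono[of K E] by (auto simp: algebraic_over_def)

context cfield
begin

lemma minpoly_exists:
  assumes "algebraic_over K x"
  obtains m where "is_minpoly K x m"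
proof -
  define P where "P = (\<lambda>p. p \<in> polys_over K \<and> p \<noteq> 0 \<and> poly p x = 0)"
  obtain p0 where "P p0" using assms by (auto simp: P_def algebraic_over_def)
  then obtain p where p: "P p" and min: "\<And>q. P q \<Longrightarrow> degree p \<le> degree q"
    using ex_has_least_nat[of P p0 degree] by blast
  define m where "m = smult (inverse (lead_coeff p)) p"
  have "lead_coeff p \<noteq> 0" "lead_coeff p \<in> K" using p by (auto simp: P_def polys_overD)
  hence "is_minpoly K x m"
    using p min by (auto simp: is_minpoly_def m_def P_def)
  thus ?thesis by (rule that)
qed

lemma minpoly_dvd:
  assumes m: "is_minpoly K x m" and p: "p \<in> polys_over K" "poly p x = 0"
  obtains q where "q \<in> polys_over K" "p = q * m"
proof -
  note m' = is_minpolyD[OF m]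
  obtain q h where qh: "q \<in> polys_over K" "h \<in> polys_over K" "p = q * m + h"
    "h = 0 \<or> degree h < degree m"
    using polys_over_division[OF m'(1,2) p(1)] .
  have "poly h x = 0" using p(2) m'(3) qh(3) by simp
  hence "h = 0" using qh m'(6)[of h] by force
  thus ?thesis using qh by (intro that[of q]) auto
qed

text \<open>Let \<open>n\<close> be minimal for \<open>y\<close> and \<open>m = q * n\<close>. The
  cofactor \<open>q\<close> is too small in degree to vanish at \<open>x\<close>, so
  \<open>n\<close> does, and the degrees of \<open>m\<close> and \<open>n\<close> agree.\<close>

lemma minpoly_other_root:
  assumes m: "is_minpoly K x m" and y: "poly m y = 0"
  shows "is_minpoly K y m"
proof -
  note m' = is_minpolyD[OF m]
  have "algebraic_over K y"
    using m' y by (auto simp: algebraic_over_def)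
  then obtain n where n: "is_minpoly K y n" by (rule minpoly_exists)
  note n' = is_minpolyD[OF n]
  obtain q where q: "q \<in> polys_over K" "m = q * n"
    using minpoly_dvd[OF n m'(1) y] .
  have "q \<noteq> 0" using q m' by auto
  have deg: "degree m = degree q + degree n"
    using q n' \<open>q \<noteq> 0\<close> by (simp add: degree_mult_eq)
  have "poly q x \<noteq> 0"
  proof
    assume "poly q x = 0"
    hence "degree m \<le> degree q" using m'(6)[OF q(1) \<open>q \<noteq> 0\<close>] by simp
    thus False using deg n' by simp
  qed
  hence "poly n x = 0" using m'(3) q by simp
  hence "degree m \<le> degree n" using m'(6) n' by simp
  thus ?thesis using m' n' y by (auto simp: is_minpoly_def intro: order_trans)
qed

text \<open>A double root would be a root of the derivative, which is nonzero of smaller degree,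
  although \<open>m\<close> is minimal for each of its roots.\<close>

lemma minpoly_rsquarefree:
  assumes m: "is_minpoly K x m"
  shows "rsquarefree m"
  unfolding rsquarefree_roots
proof (intro allI notI)
  fix a assume a: "poly m a = 0 \<and> poly (pderiv m) a = 0"
  note m' = is_minpolyD[OF minpoly_other_root[OF m conjunct1[OF a]]]
  have "pderiv m \<noteq> 0" using m' by (simp add: pderiv_eq_0_iff)
  hence "degree m \<le> degree (pderiv m)" using m'(6)[of "pderiv m"] m'(1) a by auto
  thus False using m'(5) by (simp add: degree_pderiv)
qed

lemma minpoly_card_roots:
  assumes m: "is_minpoly K x m"
  shows "card {z. poly m z = 0} = degree m"
    and "m = (\<Prod>z | poly m z = 0. [:- z, 1:])"
proof -
  show *: "m = (\<Prod>z | poly m z = 0. [:- z, 1:])"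
    using complex_poly_decompose_rsquarefree[OF minpoly_rsquarefree[OF m]] is_minpolyD[OF m] by simp
  show "card {z. poly m z = 0} = degree m"
    by (subst (2) *, subst degree_prod_eq_sum_degree) auto
qed

text \<open>A Euclidean step \<open>m = q * p1 + h\<close>, with \<open>p1\<close> the monic
  multiple of \<open>p\<close>, gives h(x) = - q(x) p1(x) at \<open>x\<close>, so an inverse of h(x)
  yields one of p(x).\<close>

lemma minpoly_eval_inverse:
  assumes m: "is_minpoly K x m" and p: "p \<in> polys_over K" "p \<noteq> 0" "degree p < degree m"
  shows "\<exists>q\<in>polys_over K. poly q x * poly p x = 1"
  using p
proof (induction "degree p" arbitrary: p rule: less_induct)
  case less
  note m' = is_minpolyD[OF m]
  define c where "c = lead_coeff p"
  have c: "c \<in> K" "c \<noteq> 0" using less.prems by (auto simp: c_def polys_overD)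
  define p1 where "p1 = smult (inverse c) p"
  have p1: "p1 \<in> polys_over K" "lead_coeff p1 = 1" "degree p1 = degree p"
    using c less.prems by (auto simp: p1_def) (auto simp: c_def)
  show ?case
  proof (cases "degree p = 0")
    case True
    then obtain b where b: "p = [:b:]" by (auto elim: degree_eq_zeroE)
    hence "b \<in> K" "b \<noteq> 0" using less.prems polys_overD[of p K 0] by auto
    thus ?thesis using b by (intro bexI[of _ "[:inverse b:]"]) auto
  next
    case False
    obtain q h where qh: "q \<in> polys_over K" "h \<in> polys_over K" "m = q * p1 + h"
      "h = 0 \<or> degree h < degree p1"
      using polys_over_division[OF p1(1,2) m'(1)] .
    \<comment> \<open>Otherwise \<open>m\<close> would be a product of two factors of smaller
      degree, one of which vanishes at \<open>x\<close>.\<close>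
    have "h \<noteq> 0"
    proof
      assume "h = 0"
      hence m_eq: "m = q * p1" using qh by simp
      hence "q \<noteq> 0" "p1 \<noteq> 0" using m' by auto
      hence deg: "degree m = degree q + degree p1" by (simp add: m_eq degree_mult_eq)
      have "poly q x = 0 \<or> poly p1 x = 0" using m'(3) m_eq by simp
      thus False
        using m'(6)[OF qh(1) \<open>q \<noteq> 0\<close>] m'(6)[OF p1(1) \<open>p1 \<noteq> 0\<close>] deg p1 less.prems False by auto
    qed
    hence dh: "degree h < degree p" using qh p1 by auto
    obtain g where g: "g \<in> polys_over K" "poly g x * poly h x = 1"
      using less.hyps[OF dh qh(2) \<open>h \<noteq> 0\<close>] dh less.prems by auto
    have "poly h x = - (poly q x * (inverse c * poly p x))"
      using m'(3) qh(3) by (simp add: p1_def eq_neg_iff_add_eq_0 algebra_simps)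
    hence "poly (smult (- inverse c) (g * q)) x * poly p x = 1"
      using g(2) by (simp add: algebra_simps)
    thus ?thesis using g qh c by blast
  qed
qed

lemma adjoin_minpoly:
  assumes m: "is_minpoly K x m"
  shows "adjoin K {x} = {poly p x | p. p \<in> polys_over K \<and> (p = 0 \<or> degree p < degree m)}"
    (is "_ = ?E")
proof (rule antisym)
  note m' = is_minpolyD[OF m]
  have red: "poly p x \<in> ?E" if p: "p \<in> polys_over K" for p
  proof -
    obtain q h where "q \<in> polys_over K" "h \<in> polys_over K" "p = q * m + h"
      "h = 0 \<or> degree h < degree m"
      using polys_over_division[OF m'(1,2) p] .
    moreover from this have "poly p x = poly h x" using m'(3) by simp
    ultimately show ?thesis by blast
  qed
  have "cfield ?E"
  proof
    show "1 \<in> ?E" using red[of 1] by simp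
    fix a b assume "a \<in> ?E" "b \<in> ?E"
    then obtain p q where pq: "a = poly p x" "b = poly q x" "p \<in> polys_over K" "q \<in> polys_over K"
      "p = 0 \<or> degree p < degree m" by blast
    show "a - b \<in> ?E" using red[of "p - q"] pq by auto
    show "a * b \<in> ?E" using red[of "p * q"] pq by auto
    show "inverse a \<in> ?E"
    proof (cases "p = 0")
      case True
      thus ?thesis using red[of 0] pq by simp
    next
      case False
      then obtain g where g: "g \<in> polys_over K" "poly g x * poly p x = 1"
        using minpoly_eval_inverse[OF m] pq by blast
      hence "inverse a = poly g x" using pq by (metis inverse_unique mult.commute)
      thus ?thesis using red g by simp
    qed
  qed
  moreover have "K \<subseteq> ?E"
  proof
    fix a assume "a \<in> K"
    thus "a \<in> ?E" using red[of "[:a:]"] by auto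
  qed
  moreover have "x \<in> ?E" using red[of "[:0, 1:]"] by auto
  ultimately show "adjoin K {x} \<subseteq> ?E" by (intro adjoin_least) auto
  interpret E: cfield "adjoin K {x}" by (rule cfield_adjoin)
  have "poly p x \<in> adjoin K {x}" if "p \<in> polys_over K" for p
    using that polys_over_mono[OF adjoin_base[of K "{x}"]] adjoin_gens[of "{x}" K] by auto
  thus "?E \<subseteq> adjoin K {x}" by auto
qed

end

section \<open>Embeddings\<close>

definition field_emb :: "complex set \<Rightarrow> (complex \<Rightarrow> complex) \<Rightarrow> bool" where
  "field_emb K \<sigma> \<longleftrightarrow> \<sigma> 1 = 1 \<and> (\<forall>x\<in>K. \<forall>y\<in>K. \<sigma> (x + y) = \<sigma> x + \<sigma> y \<and> \<sigma> (x * y) = \<sigma> x * \<sigma> y)"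

lemma field_emb_id: "field_emb K (\<lambda>x. x)"
  by (simp add: field_emb_def)

lemma field_emb_mono: "field_emb K \<sigma> \<Longrightarrow> E \<subseteq> K \<Longrightarrow> field_emb E \<sigma>"
  by (auto simp: field_emb_def)

context cfield
begin

lemma field_emb_cong: "field_emb K \<sigma> \<Longrightarrow> (\<And>x. x \<in> K \<Longrightarrow> \<tau> x = \<sigma> x) \<Longrightarrow> field_emb K \<tau>"
  by (auto simp: field_emb_def add_closed mult_closed)

context
  fixes \<sigma> assumes emb: "field_emb K \<sigma>"
begin

lemma emb_one: "\<sigma> 1 = 1"
  and emb_add: "x \<in> K \<Longrightarrow> y \<in> K \<Longrightarrow> \<sigma> (x + y) = \<sigma> x + \<sigma> y"
  and emb_mult: "x \<in> K \<Longrightarrow> y \<in> K \<Longrightarrow> \<sigma> (x * y) = \<sigma> x * \<sigma> y"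
  using emb by (auto simp: field_emb_def)

lemma emb_zero: "\<sigma> 0 = 0"
  using emb_add[of 0 0] by simp

lemma emb_uminus: "x \<in> K \<Longrightarrow> \<sigma> (- x) = - \<sigma> x"
  using emb_add[of x "- x"] emb_zero by (simp add: uminus_closed eq_neg_iff_add_eq_0 add.commute)

lemma emb_diff: "x \<in> K \<Longrightarrow> y \<in> K \<Longrightarrow> \<sigma> (x - y) = \<sigma> x - \<sigma> y"
  using emb_add[of x "- y"] emb_uminus[of y] by (simp add: uminus_closed)

lemma emb_inverse: "x \<in> K \<Longrightarrow> \<sigma> (inverse x) = inverse (\<sigma> x)"
proof (cases "x = 0")
  case False
  assume "x \<in> K"
  hence "\<sigma> x * \<sigma> (inverse x) = 1"
    using emb_mult[of x "inverse x"] emb_one False by (simp add: inverse_closed)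
  thus ?thesis by (simp add: inverse_unique)
qed (simp add: emb_zero)

lemma emb_inj: "inj_on \<sigma> K"
proof (rule inj_onI)
  fix x y assume xy: "x \<in> K" "y \<in> K" "\<sigma> x = \<sigma> y"
  show "x = y"
  proof (rule ccontr)
    assume "x \<noteq> y"
    hence "\<sigma> ((x - y) * inverse (x - y)) = 1" by (simp add: emb_one)
    moreover have "\<sigma> ((x - y) * inverse (x - y)) = 0"
      using xy by (subst emb_mult) (auto simp: emb_diff)
    ultimately show False by simp
  qed
qed

lemma emb_power: "x \<in> K \<Longrightarrow> \<sigma> (x ^ n) = \<sigma> x ^ n"
  by (induction n) (simp_all add: emb_one emb_mult power_closed)

lemma emb_sum: "(\<And>i. i \<in> I \<Longrightarrow> f i \<in> K) \<Longrightarrow> \<sigma> (sum f I) = (\<Sum>i\<in>I. \<sigma> (f i))"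
  by (induction I rule: infinite_finite_induct) (simp_all add: emb_zero emb_add sum_closed)

lemma coeff_map_emb: "coeff (map_poly \<sigma> p) i = \<sigma> (coeff p i)"
  by (simp add: coeff_map_poly emb_zero)

lemma map_emb_add:
  "p \<in> polys_over K \<Longrightarrow> q \<in> polys_over K \<Longrightarrow> map_poly \<sigma> (p + q) = map_poly \<sigma> p + map_poly \<sigma> q"
  by (simp add: poly_eq_iff coeff_map_emb emb_add polys_overD)

lemma map_emb_diff:
  "p \<in> polys_over K \<Longrightarrow> q \<in> polys_over K \<Longrightarrow> map_poly \<sigma> (p - q) = map_poly \<sigma> p - map_poly \<sigma> q"
  by (simp add: poly_eq_iff coeff_map_emb emb_diff polys_overD)

lemma map_emb_mult:
  "p \<in> polys_over K \<Longrightarrow> q \<in> polys_over K \<Longrightarrow> map_poly \<sigma> (p * q) = map_poly \<sigma> p * map_poly \<sigma> q"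
  by (simp add: poly_eq_iff coeff_map_emb coeff_mult emb_sum emb_mult polys_overD mult_closed)

lemma emb_poly:
  assumes "p \<in> polys_over K" "x \<in> K"
  shows "\<sigma> (poly p x) = poly (map_poly \<sigma> p) (\<sigma> x)"
proof -
  have "\<sigma> (poly p x) = (\<Sum>i\<le>degree p. \<sigma> (coeff p i) * \<sigma> x ^ i)"
    using assms unfolding poly_altdef
    by (subst emb_sum) (auto simp: emb_mult emb_power polys_overD power_closed)
  also have "\<dots> = (\<Sum>i\<le>degree p. coeff (map_poly \<sigma> p) i * \<sigma> x ^ i)"
    by (simp add: coeff_map_emb)
  also have "\<dots> = poly (map_poly \<sigma> p) (\<sigma> x)"
    unfolding poly_altdef
    by (rule sum.mono_neutral_right) (auto simp: coeff_eq_0 intro: order_trans[OF degree_map_poly_le])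
  finally show ?thesis .
qed

lemma map_emb_fixed:
  assumes "\<And>i. \<sigma> (coeff p i) = coeff p i"
  shows "map_poly \<sigma> p = p"
  by (simp add: poly_eq_iff coeff_map_emb assms)

lemma extend_embedding_simple:
  assumes m: "is_minpoly K x m" and y: "poly (map_poly \<sigma> m) y = 0"
  obtains \<tau> where "field_emb (adjoin K {x}) \<tau>" "\<And>a. a \<in> K \<Longrightarrow> \<tau> a = \<sigma> a" "\<tau> x = y"
proof -
  note m' = is_minpolyD[OF m]
  \<comment> \<open>The choice of representative does not matter: two of them differ by a multiple
    of \<open>m\<close>, whose image under \<open>\<sigma>\<close> vanishes at
    \<open>y\<close>.\<close>
  define \<tau> where "\<tau> = (\<lambda>z. poly (map_poly \<sigma> (SOME p. p \<in> polys_over K \<and> poly p x = z)) y)"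
  have \<tau>: "\<tau> (poly p x) = poly (map_poly \<sigma> p) y" if p: "p \<in> polys_over K" for p
  proof -
    define q where "q = (SOME q. q \<in> polys_over K \<and> poly q x = poly p x)"
    have q: "q \<in> polys_over K \<and> poly q x = poly p x"
      unfolding q_def by (rule someI[of _ p]) (use p in auto)
    obtain g where g: "g \<in> polys_over K" "q - p = g * m"
      using minpoly_dvd[OF m, of "q - p"] p q by auto
    have "map_poly \<sigma> q - map_poly \<sigma> p = map_poly \<sigma> g * map_poly \<sigma> m"
      using p q g m'(1) by (simp flip: map_emb_diff map_emb_mult)
    hence "poly (map_poly \<sigma> q) y - poly (map_poly \<sigma> p) y = 0"
      using y by (simp flip: poly_diff)
    thus ?thesis by (simp add: \<tau>_def q_def)
  qed
  have "field_emb (adjoin K {x}) \<tau>"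
    unfolding field_emb_def
  proof (intro conjI ballI)
    show "\<tau> 1 = 1" using \<tau>[of 1] by (simp add: emb_one)
    fix a b assume "a \<in> adjoin K {x}" "b \<in> adjoin K {x}"
    then obtain p q where pq: "a = poly p x" "b = poly q x" "p \<in> polys_over K" "q \<in> polys_over K"
      unfolding adjoin_minpoly[OF m] by blast
    show "\<tau> (a + b) = \<tau> a + \<tau> b"
      using \<tau>[of "p + q"] \<tau>[of p] \<tau>[of q] pq by (simp add: map_emb_add polys_over_add)
    show "\<tau> (a * b) = \<tau> a * \<tau> b"
      using \<tau>[of "p * q"] \<tau>[of p] \<tau>[of q] pq by (simp add: map_emb_mult polys_over_mult)
  qed
  moreover have "\<tau> a = \<sigma> a" if "a \<in> K" for a
    using \<tau>[of "[:a:]"] that by (cases "a = 0") (auto simp: map_poly_pCons emb_zero polys_over_pCons)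
  moreover have "\<tau> x = y"
    using \<tau>[of "[:0, 1:]"] by (simp add: map_poly_pCons emb_zero emb_one polys_over_pCons)
  ultimately show ?thesis by (rule that)
qed

end
end

lemma poly_root_exists:
  assumes "degree (p :: complex poly) > 0"
  shows "\<exists>z. poly p z = 0"
  using fundamental_theorem_of_algebra[of p] assms by (simp add: constant_degree)

text \<open>The generators are adjoined one at a time; the image of each minimal polynomial stays
  nonconstant and has a root because the complex numbers are algebraically closed.\<close>

lemma extend_embedding:
  assumes "cfield K" "field_emb K \<sigma>" "finite S" "\<And>x. x \<in> S \<Longrightarrow> algebraic_over K x"
  obtains \<tau> where "field_emb (adjoin K S) \<tau>" "\<And>a. a \<in> K \<Longrightarrow> \<tau> a = \<sigma> a"
proof -
  have "\<exists>\<tau>. field_emb (adjoin K S) \<tau> \<and> (\<forall>a\<in>K. \<tau> a = \<sigma> a)"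
    using assms(3,4)
  proof (induction S rule: finite_induct)
    case empty
    thus ?case using assms(1,2) by (auto simp: adjoin_empty)
  next
    case (insert x S)
    then obtain \<tau> where \<tau>: "field_emb (adjoin K S) \<tau>" "\<forall>a\<in>K. \<tau> a = \<sigma> a" by auto
    interpret E: cfield "adjoin K S" by (rule cfield_adjoin)
    have "algebraic_over (adjoin K S) x"
      using insert.prems by (auto intro: algebraic_over_mono[OF adjoin_base])
    then obtain m where m: "is_minpoly (adjoin K S) x m" by (rule E.minpoly_exists)
    note m' = is_minpolyD[OF m]
    have "coeff (map_poly \<tau> m) (degree m) \<noteq> 0"
      using m'(2) by (simp add: E.coeff_map_emb[OF \<tau>(1)] E.emb_one[OF \<tau>(1)])
    hence "degree (map_poly \<tau> m) > 0"
      using m'(5) le_degree[of "map_poly \<tau> m" "degree m"] by linarith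
    then obtain y where "poly (map_poly \<tau> m) y = 0" using poly_root_exists by blast
    then obtain \<tau>' where "field_emb (adjoin (adjoin K S) {x}) \<tau>'"
      "\<And>a. a \<in> adjoin K S \<Longrightarrow> \<tau>' a = \<tau> a"
      using E.extend_embedding_simple[OF \<tau>(1) m] by blast
    thus ?case using \<tau> adjoin_base[of K S] unfolding adjoin_insert[of K x S]
      by (intro exI[of _ \<tau>']) auto
  qed
  then obtain \<tau> where "field_emb (adjoin K S) \<tau>" "\<And>a. a \<in> K \<Longrightarrow> \<tau> a = \<sigma> a" by blast
  thus ?thesis by (rule that)
qed

section \<open>Galois groups of splitting fields\<close>

lemma Gal_iff:
  "\<sigma> \<in> Gal L M \<longleftrightarrow>
     field_emb L \<sigma> \<and> inj_on \<sigma> L \<and> \<sigma> ` L = L \<and> \<sigma> \<in> extensional L \<and> (\<forall>x\<in>M. \<sigma> x = x)"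
  by (auto simp: Gal_def ring_iso_def Ring.ring_hom_def field_emb_def bij_betw_def Pi_def)

lemma Gal_antimono: "M \<subseteq> N \<Longrightarrow> Gal L N \<subseteq> Gal L M"
  by (auto simp: Gal_def)

lemma GalD:
  assumes "\<sigma> \<in> Gal L M"
  shows "field_emb L \<sigma>" "inj_on \<sigma> L" "\<sigma> ` L = L" "\<sigma> \<in> extensional L"
    "\<And>x. x \<in> M \<Longrightarrow> \<sigma> x = x" "\<And>x. x \<in> L \<Longrightarrow> \<sigma> x \<in> L"
  using assms by (auto simp: Gal_iff)

lemma (in cfield) Gal_compose:
  assumes "\<sigma> \<in> Gal K M" "\<tau> \<in> Gal K M" "M \<subseteq> K"
  shows "compose K \<sigma> \<tau> \<in> Gal K M"
proof -
  note s = GalD[OF assms(1)] and t = GalD[OF assms(2)]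
  have "field_emb K (compose K \<sigma> \<tau>)"
    using t(6)
    by (auto simp: field_emb_def compose_def emb_one[OF s(1)] emb_one[OF t(1)] add_closed mult_closed
        emb_add[OF t(1)] emb_mult[OF t(1)] emb_add[OF s(1)] emb_mult[OF s(1)])
  moreover have "inj_on (compose K \<sigma> \<tau>) K"
    using s(2) t(2,6) by (auto simp: inj_on_def compose_def)
  moreover have "compose K \<sigma> \<tau> ` K = K"
    using s(3) t(3) by (auto simp: compose_def image_iff) (metis imageE)
  ultimately show ?thesis
    using s(5) t(5) assms(3) by (auto simp: Gal_iff compose_def)
qed

lemma (in cfield) Gal_inverse:
  assumes "\<sigma> \<in> Gal K M" "M \<subseteq> K"
  shows "restrict (inv_into K \<sigma>) K \<in> Gal K M"
proof -
  note s = GalD[OF assms(1)]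
  let ?i = "inv_into K \<sigma>"
  have i: "?i x \<in> K" "\<sigma> (?i x) = x" if "x \<in> K" for x
    using that s(3) by (auto intro: inv_into_into f_inv_into_f)
  have i': "?i (\<sigma> x) = x" if "x \<in> K" for x
    using that s(2) by (auto intro: inv_into_f_f)
  have one: "?i 1 = 1" using i'[of 1] by (simp add: emb_one[OF s(1)])
  have "?i (x + y) = ?i x + ?i y \<and> ?i (x * y) = ?i x * ?i y" if "x \<in> K" "y \<in> K" for x y
    using i'[of "?i x + ?i y"] i'[of "?i x * ?i y"] i[OF that(1)] i[OF that(2)]
    by (simp add: emb_add[OF s(1)] emb_mult[OF s(1)] add_closed mult_closed)
  hence "field_emb K (restrict ?i K)"
    by (simp add: field_emb_def add_closed mult_closed one)
  moreover have "inj_on (restrict ?i K) K"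
    by (rule inj_on_inverseI[where g = \<sigma>]) (simp add: i)
  moreover have "restrict ?i K ` K = K"
    using i i' s(6) by (auto simp: image_iff) metis
  moreover have "?i x = x" if "x \<in> M" for x
    using i'[of x] s(5)[OF that] that assms(2) by auto
  ultimately show ?thesis using assms(2) by (auto simp: Gal_iff)
qed

locale splitting = cfield F for F +
  fixes p :: "complex poly" and L :: "complex set"
  assumes p: "p \<in> polys_over F" "p \<noteq> 0" and L: "L = splitting_field F p"
begin

abbreviation "S \<equiv> {z. poly p z = 0}"

sublocale L: cfield L
  unfolding L splitting_field_def by (rule cfield_adjoin)

lemma base: "F \<subseteq> L" and roots: "S \<subseteq> L"
  unfolding L splitting_field_def by (rule adjoin_base adjoin_gens)+

lemma finite_roots: "finite S"
  using p(2) by (rule poly_roots_finite)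

lemma L_least: "cfield K \<Longrightarrow> F \<subseteq> K \<Longrightarrow> S \<subseteq> K \<Longrightarrow> L \<subseteq> K"
  unfolding L splitting_field_def by (rule adjoin_least)

lemma roots_image:
  assumes s: "field_emb L \<sigma>" and fixes_F: "\<And>x. x \<in> F \<Longrightarrow> \<sigma> x = x"
  shows "\<sigma> ` S = S"
proof (rule endo_inj_surj[OF finite_roots])
  show "\<sigma> ` S \<subseteq> S"
  proof clarify
    fix z assume z: "poly p z = 0"
    have "map_poly \<sigma> p = p"
      using p(1) fixes_F by (intro L.map_emb_fixed[OF s]) (auto simp: polys_overD)
    moreover have "p \<in> polys_over L" "z \<in> L"
      using p(1) polys_over_mono[OF base] roots z by auto
    ultimately have "poly p (\<sigma> z) = \<sigma> (poly p z)"
      using L.emb_poly[OF s, of p z] by simp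
    thus "poly p (\<sigma> z) = 0" using z by (simp add: L.emb_zero[OF s])
  qed
  show "inj_on \<sigma> S" using L.emb_inj[OF s] roots by (rule inj_on_subset)
qed

text \<open>The elements of \<open>L\<close> whose image stays in \<open>L\<close> form a field
  containing \<open>F\<close> and the roots, and the image of \<open>L\<close> is another one;
  minimality of \<open>L\<close> gives the two inclusions.\<close>

lemma emb_image:
  assumes s: "field_emb L \<sigma>" and fixes_F: "\<And>x. x \<in> F \<Longrightarrow> \<sigma> x = x"
  shows "\<sigma> ` L = L"
proof (rule antisym)
  note S = roots_image[OF assms]
  have "cfield {x \<in> L. \<sigma> x \<in> L}"
    by standard (auto simp: L.emb_one[OF s] L.emb_diff[OF s] L.emb_mult[OF s] L.emb_inverse[OF s])
  moreover have "F \<subseteq> {x \<in> L. \<sigma> x \<in> L}"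
    using base fixes_F by auto
  moreover have "S \<subseteq> {x \<in> L. \<sigma> x \<in> L}"
    using roots S by blast
  ultimately show "\<sigma> ` L \<subseteq> L"
    using L_least by blast
  have "cfield (\<sigma> ` L)"
  proof
    show "1 \<in> \<sigma> ` L" using L.emb_one[OF s] by (metis L.one_closed imageI)
    fix a b assume "a \<in> \<sigma> ` L" "b \<in> \<sigma> ` L"
    then obtain x y where xy: "x \<in> L" "y \<in> L" "a = \<sigma> x" "b = \<sigma> y" by blast
    show "a - b \<in> \<sigma> ` L" "a * b \<in> \<sigma> ` L" "inverse a \<in> \<sigma> ` L"
      using xy L.emb_diff[OF s, of x y] L.emb_mult[OF s, of x y] L.emb_inverse[OF s, of x]
      by (metis L.diff_closed L.mult_closed L.inverse_closed imageI)+
  qed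
  moreover have "F \<subseteq> \<sigma> ` L" using base fixes_F by (metis image_iff subset_iff)
  moreover have "S \<subseteq> \<sigma> ` L" using S roots by blast
  ultimately show "L \<subseteq> \<sigma> ` L" by (rule L_least)
qed

lemma restrict_in_Gal:
  assumes s: "field_emb L \<sigma>" and M: "F \<subseteq> M" "M \<subseteq> L" and fixes_M: "\<And>x. x \<in> M \<Longrightarrow> \<sigma> x = x"
  shows "restrict \<sigma> L \<in> Gal L M"
proof -
  have "field_emb L (restrict \<sigma> L)"
    by (rule L.field_emb_cong[OF s]) simp
  moreover have "\<sigma> ` L = L" using emb_image[OF s] M fixes_M by auto
  moreover have "inj_on (restrict \<sigma> L) L" using L.emb_inj[OF s] by simp
  ultimately show ?thesis using M fixes_M by (auto simp: Gal_iff)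
qed

lemma id_in_Gal: "F \<subseteq> M \<Longrightarrow> M \<subseteq> L \<Longrightarrow> restrict (\<lambda>x. x) L \<in> Gal L M"
  by (rule restrict_in_Gal[OF field_emb_id]) auto

text \<open>An automorphism is determined by its permutation of the roots, since the elements on
  which two automorphisms agree form a field.\<close>

lemma Gal_finite:
  assumes "F \<subseteq> M"
  shows "finite (Gal L M)"
proof (rule finite_imageD)
  have "(\<lambda>\<sigma>. restrict \<sigma> S) ` Gal L M \<subseteq> (\<Pi>\<^sub>E z\<in>S. S)"
  proof clarify
    fix \<sigma> assume "\<sigma> \<in> Gal L M"
    hence "\<sigma> ` S = S" using assms by (intro roots_image) (auto dest: GalD)
    thus "restrict \<sigma> S \<in> (\<Pi>\<^sub>E z\<in>S. S)" by (auto simp: image_subset_iff)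
  qed
  thus "finite ((\<lambda>\<sigma>. restrict \<sigma> S) ` Gal L M)"
    by (rule finite_subset) (use finite_roots in \<open>auto intro: finite_PiE\<close>)
  show "inj_on (\<lambda>\<sigma>. restrict \<sigma> S) (Gal L M)"
  proof (rule inj_onI)
    fix \<sigma> \<tau> assume st: "\<sigma> \<in> Gal L M" "\<tau> \<in> Gal L M" "restrict \<sigma> S = restrict \<tau> S"
    note s = GalD[OF st(1)] and t = GalD[OF st(2)]
    have "cfield {x \<in> L. \<sigma> x = \<tau> x}"
      by standard (auto simp: L.emb_one[OF s(1)] L.emb_one[OF t(1)] L.emb_diff[OF s(1)]
          L.emb_diff[OF t(1)] L.emb_mult[OF s(1)] L.emb_mult[OF t(1)] L.emb_inverse[OF s(1)]
          L.emb_inverse[OF t(1)])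
    moreover have "F \<subseteq> {x \<in> L. \<sigma> x = \<tau> x}"
      using base assms s(5) t(5) by fastforce
    moreover have "\<sigma> z = \<tau> z" if "z \<in> S" for z
      using st(3) that by (metis restrict_apply')
    hence "S \<subseteq> {x \<in> L. \<sigma> x = \<tau> x}"
      using roots by auto
    ultimately have "L \<subseteq> {x \<in> L. \<sigma> x = \<tau> x}" by (rule L_least)
    thus "\<sigma> = \<tau>" using s(4) t(4) by (intro extensionalityI) auto
  qed
qed

lemma extend_to_Gal:
  assumes M: "cfield M" "F \<subseteq> M" "M \<subseteq> L" and s: "field_emb M \<sigma>" "\<And>x. x \<in> F \<Longrightarrow> \<sigma> x = x"
  obtains \<tau> where "\<tau> \<in> Gal L F" "\<And>x. x \<in> M \<Longrightarrow> \<tau> x = \<sigma> x"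
proof -
  have alg: "algebraic_over M z" if "z \<in> S" for z
    using that p polys_over_mono[OF M(2)] by (auto simp: algebraic_over_def)
  have "adjoin M S = L"
  proof (rule antisym)
    show "adjoin M S \<subseteq> L" using M(3) roots by (intro adjoin_least L.cfield_axioms)
    show "L \<subseteq> adjoin M S"
      using adjoin_base[of M S] adjoin_gens[of S M] M(2) by (intro L_least cfield_adjoin) auto
  qed
  then obtain \<tau> where t: "field_emb L \<tau>" "\<And>a. a \<in> M \<Longrightarrow> \<tau> a = \<sigma> a"
    using extend_embedding[OF M(1) s(1) finite_roots alg] by metis
  show ?thesis
  proof (rule that)
    show "restrict \<tau> L \<in> Gal L F"
      using t M(2) s(2) base by (intro restrict_in_Gal) auto
    show "restrict \<tau> L x = \<sigma> x" if "x \<in> M" for x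
      using that t M(3) by auto
  qed
qed

lemma Gal_transitive:
  assumes M: "cfield M" "F \<subseteq> M" "M \<subseteq> L" and y: "y \<in> L" and m: "is_minpoly M y m"
    and z: "poly m z = 0"
  obtains \<tau> where "\<tau> \<in> Gal L M" "\<tau> y = z"
proof -
  interpret M: cfield M by fact
  have "map_poly (\<lambda>x. x) m = m" by (simp add: poly_eq_iff coeff_map_poly)
  then obtain \<sigma> where s: "field_emb (adjoin M {y}) \<sigma>" "\<And>a. a \<in> M \<Longrightarrow> \<sigma> a = a" "\<sigma> y = z"
    using M.extend_embedding_simple[OF field_emb_id m, of z] z by metis
  have sub: "F \<subseteq> adjoin M {y}" "adjoin M {y} \<subseteq> L"
    using adjoin_base[of M "{y}"] adjoin_least[OF L.cfield_axioms M(3), of "{y}"] M y by auto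
  obtain \<tau> where t: "\<tau> \<in> Gal L F" "\<And>x. x \<in> adjoin M {y} \<Longrightarrow> \<tau> x = \<sigma> x"
    using extend_to_Gal[OF cfield_adjoin sub s(1)] s(2) M(2) by (metis subsetD)
  have "\<tau> x = x" if "x \<in> M" for x using that t(2)[of x] s(2)[of x] adjoin_base[of M "{y}"] by auto
  hence "\<tau> \<in> Gal L M" using t(1) by (auto simp: Gal_iff)
  moreover have "\<tau> y = z" using t(2)[of y] s(3) adjoin_gens[of "{y}" M] by auto
  ultimately show ?thesis by (rule that)
qed

text \<open>One half of orbit-stabilizer: with some \<open>g z\<close> moving \<open>y\<close> to
  \<open>z\<close> for each conjugate \<open>z\<close>, the products of the \<open>g z\<close> with
  the stabilizing elements are all distinct.\<close>

lemma degree_mult_stabilizer_le: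
  assumes M: "cfield M" "F \<subseteq> M" "M \<subseteq> L" and y: "y \<in> L" and m: "is_minpoly M y m"
  shows "degree m * card {\<tau> \<in> Gal L M. \<tau> y = y} \<le> card (Gal L M)"
proof -
  let ?R = "{z. poly m z = 0}" and ?T = "{\<tau> \<in> Gal L M. \<tau> y = y}"
  interpret M: cfield M by fact
  have "\<exists>\<tau>. \<tau> \<in> Gal L M \<and> \<tau> y = z" if "z \<in> ?R" for z
    using Gal_transitive[OF M y m, of z] that by blast
  then obtain g where g: "\<And>z. z \<in> ?R \<Longrightarrow> g z \<in> Gal L M \<and> g z y = z" by metis
  have fin: "finite (Gal L M)" by (rule Gal_finite[OF M(2)])
  have "card (?R \<times> ?T) \<le> card (Gal L M)"
  proof (rule card_inj_on_le[OF _ _ fin])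
    show "(\<lambda>(z, \<tau>). compose L (g z) \<tau>) ` (?R \<times> ?T) \<subseteq> Gal L M"
      using g M(3) by (auto intro!: L.Gal_compose)
    show "inj_on (\<lambda>(z, \<tau>). compose L (g z) \<tau>) (?R \<times> ?T)"
    proof (rule inj_onI, clarify)
      fix z \<tau> z' \<tau>'
      assume h: "poly m z = 0" "poly m z' = 0" "\<tau> \<in> Gal L M" "\<tau>' \<in> Gal L M" "\<tau> y = y" "\<tau>' y = y"
        "compose L (g z) \<tau> = compose L (g z') \<tau>'"
      from fun_cong[OF h(7), of y] have "g z y = g z' y"
        using h(5,6) y by (simp add: compose_eq)
      hence zz: "z = z'" using g h(1,2) by simp
      have "\<tau> x = \<tau>' x" if "x \<in> L" for x
      proof -
        have "g z (\<tau> x) = g z (\<tau>' x)"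
          using fun_cong[OF h(7), of x] that zz by (simp add: compose_eq)
        thus ?thesis
          using g[of z] h(1) GalD(2)[of "g z" L M] GalD(6)[OF h(3) that] GalD(6)[OF h(4) that]
          by (auto dest: inj_onD)
      qed
      hence "\<tau> = \<tau>'" using GalD(4)[OF h(3)] GalD(4)[OF h(4)] by (intro extensionalityI) auto
      thus "z = z' \<and> \<tau> = \<tau>'" using zz by simp
    qed
  qed
  thus ?thesis by (simp add: card_cartesian_product M.minpoly_card_roots(1)[OF m])
qed

end

text \<open>Cross-multiplied comparison of proportions. Each fibre of restriction is a coset of
  \<open>Gal L L1\<close>: \<open>h\<close> maps \<open>A1 \<times> Gal L L1\<close> injectively
  into the preimage of \<open>A1\<close>, and \<open>Gal L1 F \<times> Gal L L1\<close> onto the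
  whole group.\<close>

lemma restriction_ratio_le:
  assumes "splitting F p L" "splitting F q L1" "L1 \<subseteq> L" and A1: "A1 \<subseteq> Gal L1 F"
  shows "card A1 * card (Gal L F) \<le> card {\<sigma> \<in> Gal L F. restrict \<sigma> L1 \<in> A1} * card (Gal L1 F)"
proof -
  interpret L: splitting F p L by fact
  interpret L1: splitting F q L1 by fact
  let ?A = "{\<sigma> \<in> Gal L F. restrict \<sigma> L1 \<in> A1}" and ?N = "Gal L L1"
  have F1: "F \<subseteq> L1" by (rule L1.base)
  have fin: "finite (Gal L F)" "finite ?N" "finite (Gal L1 F)"
    by (auto intro!: L.Gal_finite L1.Gal_finite F1)
  have N: "\<tau> \<in> Gal L F" if "\<tau> \<in> ?N" for \<tau>
    using that Gal_antimono[OF F1] by blast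
  have res: "restrict \<sigma> L1 \<in> Gal L1 F" if "\<sigma> \<in> Gal L F" for \<sigma>
    using GalD[OF that] assms(3) F1
    by (intro L1.restrict_in_Gal) (auto intro: field_emb_mono)
  have "\<exists>\<sigma>. \<sigma> \<in> Gal L F \<and> (\<forall>x\<in>L1. \<sigma> x = \<rho> x)" if "\<rho> \<in> Gal L1 F" for \<rho>
    using L.extend_to_Gal[OF L1.L.cfield_axioms F1 assms(3), of \<rho>] GalD[OF that] by metis
  then obtain g where g: "\<And>\<rho>. \<rho> \<in> Gal L1 F \<Longrightarrow> g \<rho> \<in> Gal L F \<and> (\<forall>x\<in>L1. g \<rho> x = \<rho> x)" by metis
  define h where "h = (\<lambda>(\<rho>, \<tau>). compose L (g \<rho>) \<tau>)"
  have h_in: "h (\<rho>, \<tau>) \<in> Gal L F" if "\<rho> \<in> Gal L1 F" "\<tau> \<in> ?N" for \<rho> \<tau>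
    using g[OF that(1)] N[OF that(2)] L.base by (auto simp: h_def intro: L.L.Gal_compose)
  have h_res: "restrict (h (\<rho>, \<tau>)) L1 = \<rho>" if "\<rho> \<in> Gal L1 F" "\<tau> \<in> ?N" for \<rho> \<tau>
  proof (rule extensionalityI[of _ L1])
    fix x assume x: "x \<in> L1"
    thus "restrict (h (\<rho>, \<tau>)) L1 x = \<rho> x"
      using g[OF that(1)] GalD(5)[OF that(2) x] assms(3) by (auto simp: h_def compose_eq)
  qed (use GalD(4)[OF that(1)] in auto)
  have "card (A1 \<times> ?N) \<le> card ?A"
  proof (rule card_inj_on_le)
    show "inj_on h (A1 \<times> ?N)"
    proof (rule inj_onI, clarify)
      fix \<rho> \<tau> \<rho>' \<tau>' assume a: "\<rho> \<in> A1" "\<tau> \<in> ?N" "\<rho>' \<in> A1" "\<tau>' \<in> ?N" "h (\<rho>, \<tau>) = h (\<rho>', \<tau>')"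
      have r: "\<rho> \<in> Gal L1 F" "\<rho>' \<in> Gal L1 F" using a A1 by auto
      have rr: "\<rho> = \<rho>'" using h_res[OF r(1) a(2)] h_res[OF r(2) a(4)] a(5) by simp
      have "\<tau> x = \<tau>' x" if "x \<in> L" for x
      proof -
        have "g \<rho> (\<tau> x) = g \<rho> (\<tau>' x)"
          using fun_cong[OF a(5), of x] that rr by (simp add: h_def compose_eq)
        thus ?thesis
          using g[OF r(1)] GalD(2)[of "g \<rho>" L F] GalD(6)[OF a(2) that] GalD(6)[OF a(4) that]
          by (auto dest: inj_onD)
      qed
      hence "\<tau> = \<tau>'" using GalD(4)[OF a(2)] GalD(4)[OF a(4)] by (intro extensionalityI) auto
      thus "\<rho> = \<rho>' \<and> \<tau> = \<tau>'" using rr by simp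
    qed
    show "h ` (A1 \<times> ?N) \<subseteq> ?A" using h_in h_res A1 by auto
  qed (use fin in auto)
  hence 1: "card A1 * card ?N \<le> card ?A" by (simp add: card_cartesian_product)
  have "Gal L F \<subseteq> h ` (Gal L1 F \<times> ?N)"
  proof
    fix \<sigma> assume s: "\<sigma> \<in> Gal L F"
    define \<rho> where "\<rho> = restrict \<sigma> L1"
    have r: "\<rho> \<in> Gal L1 F" using res[OF s] by (simp add: \<rho>_def)
    note gr = conjunct1[OF g[OF r]]
    \<comment> \<open>Undoing the chosen lift \<open>g \<rho>\<close> after \<open>\<sigma>\<close>
      leaves an automorphism trivial on \<open>L1\<close>.\<close>
    define i where "i = restrict (inv_into L (g \<rho>)) L"
    define \<tau> where "\<tau> = compose L i \<sigma>"
    have "i \<in> Gal L F" unfolding i_def using gr L.base by (rule L.L.Gal_inverse)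
    hence t: "\<tau> \<in> Gal L F" unfolding \<tau>_def using s L.base by (rule L.L.Gal_compose)
    have "\<tau> x = x" if "x \<in> L1" for x
    proof -
      have "\<sigma> x = g \<rho> x" using g[OF r] that by (auto simp: \<rho>_def)
      moreover have "x \<in> L" using that assms(3) by auto
      ultimately show ?thesis using GalD(2,6)[OF gr]
        by (auto simp: \<tau>_def compose_eq i_def inv_into_f_f)
    qed
    hence tN: "\<tau> \<in> ?N" using t by (auto simp: Gal_iff)
    have "\<sigma> = h (\<rho>, \<tau>)"
    proof (rule extensionalityI[of _ L])
      fix x assume x: "x \<in> L"
      hence "\<sigma> x \<in> L" using GalD(6)[OF s] by simp
      thus "\<sigma> x = h (\<rho>, \<tau>) x" using x GalD(3)[OF gr]
        by (simp add: h_def \<tau>_def compose_eq i_def f_inv_into_f)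
    qed (use GalD(4)[OF s] in \<open>auto simp: h_def\<close>)
    thus "\<sigma> \<in> h ` (Gal L1 F \<times> ?N)" using r tN by blast
  qed
  hence "card (Gal L F) \<le> card (Gal L1 F \<times> ?N)"
    using fin by (intro surj_card_le) auto
  hence "card A1 * card (Gal L F) \<le> card A1 * card ?N * card (Gal L1 F)"
    by (simp add: card_cartesian_product mult_ac)
  also have "\<dots> \<le> card ?A * card (Gal L1 F)" using 1 by simp
  finally show ?thesis .
qed

section \<open>Rational spans and degrees of cyclotomic extensions\<close>

interpretation ratvs: vector_space "\<lambda>(q :: rat) (z :: complex). of_rat q * z"
  by unfold_locales (auto simp: algebra_simps of_rat_add of_rat_mult)

lemma cfield_Rats: "cfield \<rat>"
  by standard auto

lemma ratvs_span_mult: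
  assumes "a \<in> ratvs.span B"
  shows "a * w \<in> ratvs.span ((\<lambda>b. b * w) ` B)"
  using assms
proof (induction rule: ratvs.span_induct_alt)
  case base
  thus ?case by (simp add: ratvs.span_zero)
next
  case (step c x y)
  have "of_rat c * (x * w) \<in> ratvs.span ((\<lambda>b. b * w) ` B)"
    using step by (intro ratvs.span_scale ratvs.span_base) auto
  hence "of_rat c * (x * w) + y * w \<in> ratvs.span ((\<lambda>b. b * w) ` B)"
    using step by (intro ratvs.span_add)
  thus ?case by (simp add: algebra_simps)
qed

lemma (in cfield) adjoin_rat_span:
  assumes B: "K \<subseteq> ratvs.span B" and m: "is_minpoly K x m"
  shows "adjoin K {x} \<subseteq> ratvs.span ((\<lambda>(b, j). b * x ^ j) ` (B \<times> {..<degree m}))"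
proof
  let ?B = "(\<lambda>(b, j). b * x ^ j) ` (B \<times> {..<degree m})"
  fix z assume "z \<in> adjoin K {x}"
  then obtain q where q: "z = poly q x" "q \<in> polys_over K" "q = 0 \<or> degree q < degree m"
    unfolding adjoin_minpoly[OF m] by auto
  have "coeff q i * x ^ i \<in> ratvs.span ?B" if i: "i \<le> degree q" for i
  proof (cases "q = 0")
    case False
    have "coeff q i * x ^ i \<in> ratvs.span ((\<lambda>b. b * x ^ i) ` B)"
      using B polys_overD[OF q(2)] by (intro ratvs_span_mult) auto
    moreover have "(\<lambda>b. b * x ^ i) ` B \<subseteq> ?B"
      using i q(3) False by (auto simp: image_iff)
    ultimately show ?thesis using ratvs.span_mono by blast
  qed (simp add: ratvs.span_zero)
  thus "z \<in> ratvs.span ?B"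
    unfolding q(1) poly_altdef by (intro ratvs.span_sum) auto
qed

text \<open>Bridge from the inductively defined dimension, built from line extensions, to spans in
  \<open>ratvs\<close>. Each line extension contributes one spanning vector.\<close>

lemma dimension_rat_span:
  assumes "ring.dimension CC n \<rat> E"
  shows "\<exists>B. finite B \<and> card B \<le> n \<and> E \<subseteq> ratvs.span B"
  using assms
proof (induction n "\<rat> :: complex set" E rule: ring.dimension.induct[OF CC.ring_axioms, consumes 1])
  case 1
  thus ?case by (intro exI[of _ "{}"]) auto
next
  case (2 v E n)
  then obtain B where B: "finite B" "card B \<le> n" "E \<subseteq> ratvs.span B" by auto
  have "ring.line_extension CC \<rat> v E \<subseteq> ratvs.span (insert v B)"
  proof
    fix x assume "x \<in> ring.line_extension CC \<rat> v E"
    then obtain k e where ke: "k \<in> \<rat>" "e \<in> E" "x = k * v + e"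
      by (auto simp: ring.line_extension_def[OF CC.ring_axioms] set_add_def set_mult_def r_coset_def)
    obtain r where "k = of_rat r" using ke(1) by (rule Rats_cases)
    moreover have "e \<in> ratvs.span (insert v B)"
      using ke(2) B(3) ratvs.span_mono[of B "insert v B"] by auto
    ultimately show "x \<in> ratvs.span (insert v B)"
      unfolding ke(3) by (auto intro: ratvs.span_add ratvs.span_scale ratvs.span_base)
  qed
  thus ?case using B card_insert_le_m1[of "Suc n" B v]
    by (intro exI[of _ "insert v B"]) (auto simp: card_insert_if)
qed

lemma number_field_rat_span:
  assumes "number_field F"
  obtains B where "finite B" "card B \<le> abs_degree F" "F \<subseteq> ratvs.span B"
proof -
  have "subfield \<rat> CC" by (simp add: subfield_CC_iff cfield_Rats)
  hence "ring.dimension CC (abs_degree F) \<rat> F"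
    using ring.finite_dimensionE[OF CC.ring_axioms, of \<rat> F] assms
    by (simp add: number_field_def abs_degree_def over_def)
  from dimension_rat_span[OF this] show ?thesis using that by auto
qed

lemma common_denominator:
  assumes "finite I"
  shows "\<exists>d>0. \<forall>i\<in>I. \<exists>k. of_int d * (c i :: rat) = of_int k"
  using assms
proof (induction I rule: finite_induct)
  case (insert i I)
  then obtain d where d: "d > 0" "\<forall>i\<in>I. \<exists>k. of_int d * c i = of_int k" by auto
  obtain a b where ab: "b > 0" "c i = of_int a / of_int b"
    by (metis Rat_cases Fract_of_int_quotient)
  have "\<exists>k. of_int (d * b) * c j = of_int k" if j: "j \<in> I" for j
  proof -
    obtain k where "of_int d * c j = of_int k" using d j by auto
    hence "of_int (d * b) * c j = of_int (k * b)" by (simp add: algebra_simps)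
    thus ?thesis by blast
  qed
  moreover have "\<exists>k. of_int (d * b) * c i = of_int k"
    using ab by (intro exI[of _ "d * a"]) simp
  ultimately show ?case using d ab by (intro exI[of _ "d * b"]) (auto simp del: of_int_mult)
qed (auto intro: exI[of _ 1])

lemma ratio_one_minus_power:
  assumes "algebraic_int (z :: complex)" "z \<noteq> 1"
  shows "algebraic_int ((1 - z ^ j) / (1 - z))"
proof -
  have "(1 - z ^ j) / (1 - z) = (\<Sum>i<j. z ^ i)"
    using assms(2) by (simp add: sum_gp_strict)
  thus ?thesis using assms(1) by (auto intro: algebraic_int_closed)
qed

section \<open>Roots of unity of prime power order\<close>

locale prime_power_cyclotomic =
  fixes p A :: nat
  assumes p: "Factorial_Ring.prime p"
begin

definition "N = p ^ A"
definition "q = p ^ Suc A"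
text \<open>These are the primitive \<open>q\<close>-th roots of unity, because \<open>q\<close> is
  a power of the prime \<open>p\<close>.\<close>

definition "R = {z :: complex. z ^ q = 1 \<and> z ^ N \<noteq> 1}"

lemma q_eq: "q = N * p" and N_pos: "N > 0" and q_pos: "q > 0" and p_ge_2: "p \<ge> 2"
  using prime_ge_2_nat[OF p] by (auto simp: q_def N_def)

text \<open>The \<open>q\<close>-th cyclotomic polynomial, the quotient of X^q - 1 by X^N -
  1.\<close>

definition "\<Phi> = (\<Sum>i<p. monom (1 :: complex) (N * i))"

lemma poly_\<Phi>: "poly \<Phi> z = (\<Sum>i<p. (z ^ N) ^ i)"
  by (simp add: \<Phi>_def poly_sum poly_monom power_mult)

lemma \<Phi>_mult: "\<Phi> * (monom 1 N - 1) = monom 1 q - 1"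
proof -
  have "poly (\<Phi> * (monom 1 N - 1)) z = poly (monom 1 q - 1) z" for z
  proof -
    have "poly (monom 1 q - 1) z = (z ^ N) ^ p - 1"
      by (simp add: poly_monom q_eq power_mult)
    also have "\<dots> = poly (\<Phi> * (monom 1 N - 1)) z"
      by (simp add: power_diff_1_eq poly_\<Phi> poly_monom mult.commute[of _ "z ^ N - 1"])
    finally show ?thesis ..
  qed
  thus ?thesis by (simp add: poly_eq_poly_eq_iff[symmetric] fun_eq_iff)
qed

lemma R_eq: "R = {z. poly \<Phi> z = 0}"
proof -
  have "z \<in> R \<longleftrightarrow> poly \<Phi> z = 0" for z
  proof (cases "z ^ N = 1")
    case True
    thus ?thesis using p_ge_2 by (simp add: R_def poly_\<Phi>)
  next
    case False
    have "poly \<Phi> z * (z ^ N - 1) = z ^ q - 1"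
      using arg_cong[OF \<Phi>_mult, of "\<lambda>f. poly f z"] by (simp add: poly_monom)
    thus ?thesis using False by (auto simp: R_def)
  qed
  thus ?thesis by blast
qed

lemma degree_X_minus_1: "n > 0 \<Longrightarrow> degree (monom 1 n - 1 :: complex poly) = n"
  and lead_X_minus_1: "n > 0 \<Longrightarrow> lead_coeff (monom 1 n - 1 :: complex poly) = 1"
proof -
  assume n: "n > 0"
  have "degree (monom 1 n - 1 :: complex poly) \<le> n"
    by (rule degree_diff_le) (auto simp: degree_monom_le)
  moreover have "coeff (monom 1 n - 1 :: complex poly) n = 1" using n by simp
  ultimately show d: "degree (monom 1 n - 1 :: complex poly) = n"
    by (metis le_antisym le_degree zero_neq_one)
  show "lead_coeff (monom 1 n - 1 :: complex poly) = 1" using n unfolding d by simp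
qed

lemma degree_\<Phi>: "degree \<Phi> = q - N" and lead_\<Phi>: "lead_coeff \<Phi> = 1" and \<Phi>_nonzero: "\<Phi> \<noteq> 0"
proof -
  have nz: "monom 1 q - 1 \<noteq> (0 :: complex poly)" "monom 1 N - 1 \<noteq> (0 :: complex poly)"
    using degree_X_minus_1[OF q_pos] degree_X_minus_1[OF N_pos] q_pos N_pos by auto
  show nz': "\<Phi> \<noteq> 0" using \<Phi>_mult nz by auto
  have "degree \<Phi> + N = q"
    using arg_cong[OF \<Phi>_mult, of degree] nz nz' q_pos N_pos
    by (simp add: degree_mult_eq degree_X_minus_1)
  thus "degree \<Phi> = q - N" by simp
  show "lead_coeff \<Phi> = 1"
    using arg_cong[OF \<Phi>_mult, of lead_coeff] lead_X_minus_1[OF q_pos] lead_X_minus_1[OF N_pos]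
    by (simp only: lead_coeff_mult mult_1_right)
qed

lemma rsquarefree_\<Phi>: "rsquarefree \<Phi>"
  unfolding rsquarefree_roots
proof (intro allI notI)
  fix a assume a: "poly \<Phi> a = 0 \<and> poly (pderiv \<Phi>) a = 0"
  have "poly (pderiv (monom 1 q - 1)) a = 0"
    unfolding \<Phi>_mult[symmetric] using a by (simp add: pderiv_mult)
  hence "of_nat q * a ^ (q - 1) = 0"
    by (simp add: pderiv_diff pderiv_monom poly_monom)
  hence "a = 0" using q_pos by simp
  hence "a \<notin> R" using q_pos by (simp add: R_def power_0_left)
  thus False using a R_eq by simp
qed

lemma \<Phi>_prod: "\<Phi> = (\<Prod>z\<in>R. [:- z, 1:])"
  using complex_poly_decompose_rsquarefree[OF rsquarefree_\<Phi>] lead_\<Phi> by (simp add: R_eq)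

text \<open>The exact count is \<open>N * (p - 1)\<close>, which is as small as \<open>N\<close> for
  p = 2.\<close>

lemma card_R: "N \<le> card R"
proof -
  have "card R = degree \<Phi>"
    by (subst \<Phi>_prod, subst degree_prod_eq_sum_degree) auto
  moreover have "N * 2 \<le> q" using p_ge_2 by (simp add: q_eq)
  ultimately show ?thesis by (simp add: degree_\<Phi>)
qed

text \<open>Both sides are the value of \<open>\<Phi>\<close> at 1, computed from the sum and from
  the linear factors.\<close>

lemma p_eq_prod: "of_nat p = (\<Prod>z\<in>R. 1 - z)"
proof -
  have "of_nat p = poly \<Phi> 1" by (simp add: poly_\<Phi>)
  also have "\<dots> = (\<Prod>z\<in>R. 1 - z)" by (subst \<Phi>_prod) (simp add: poly_prod)
  finally show ?thesis .
qed

lemma R_power_generates: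
  assumes z: "z \<in> R" and w: "w ^ q = 1"
  obtains j where "w = z ^ j"
proof -
  define \<zeta> where "\<zeta> = (\<lambda>k. cis (2 * pi * real k / real q))"
  have bij: "bij_betw \<zeta> {..<q} {z. z ^ q = 1}"
    unfolding \<zeta>_def by (rule bij_betw_roots_unity[OF q_pos])
  have pow: "\<zeta> k = \<zeta> 1 ^ k" for k
    by (simp add: \<zeta>_def DeMoivre mult_ac)
  have \<zeta>1: "\<zeta> 1 ^ q = 1" using q_pos by (simp add: \<zeta>_def DeMoivre)
  have gen: "\<exists>a. u = \<zeta> 1 ^ a" if "u ^ q = 1" for u
  proof -
    have "u \<in> \<zeta> ` {..<q}" using bij that by (simp add: bij_betw_def)
    then obtain k where "u = \<zeta> k" by blast
    thus ?thesis using pow[of k] by blast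
  qed
  obtain a where a: "z = \<zeta> 1 ^ a" using gen[of z] z by (auto simp: R_def)
  obtain b where b: "w = \<zeta> 1 ^ b" using gen[OF w] by auto
  have "\<not> p dvd a"
  proof
    assume "p dvd a"
    then obtain c where "a = p * c" by blast
    hence "z ^ N = (\<zeta> 1 ^ q) ^ c"
      by (simp add: a q_eq mult_ac flip: power_mult)
    thus False using z \<zeta>1 by (simp add: R_def)
  qed
  \<comment> \<open>An inverse of the exponent modulo \<open>q\<close> recovers the standard
    generator as a power of \<open>z\<close>.\<close>
  hence "coprime a q"
    using prime_imp_coprime[OF p, of a] by (auto simp: q_def coprime_commute)
  moreover have "a \<noteq> 0" using \<open>\<not> p dvd a\<close> by (metis dvd_0_right)
  ultimately obtain x y where xy: "a * x = q * y + 1"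
    using bezout_nat[of a q] by auto
  have "z ^ x = \<zeta> 1"
    using \<zeta>1 by (simp add: a xy power_add power_mult flip: power_mult[of _ a])
  hence "w = z ^ (x * b)" by (simp add: b power_mult)
  thus ?thesis by (rule that)
qed

text \<open>As \<open>w\<close> is a power of \<open>z\<close>, the ratio is a geometric sum. By
  symmetry all the numbers \<open>1 - z\<close> are associates.\<close>

lemma ratio_algebraic_int:
  assumes "z \<in> R" "w \<in> R"
  shows "algebraic_int ((1 - w) / (1 - z))"
proof -
  obtain j where "w = z ^ j" using R_power_generates[OF assms(1), of w] assms(2) by (auto simp: R_def)
  moreover have "z \<noteq> 1" using assms(1) by (auto simp: R_def)
  moreover have "algebraic_int z"
    using assms(1) q_pos by (intro algebraic_int_root_of_unity) (auto simp: R_def root_of_unity_def)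
  ultimately show ?thesis using ratio_one_minus_power by simp
qed

text \<open>The uniformizer \<open>1 - \<zeta>\<close> plays the role of an Eisenstein argument: a primitive integral
  relation among the powers of \<open>1 - \<zeta>\<close> would make \<open>1 - \<zeta>\<close>, and hence \<open>p\<close>, a unit.\<close>

lemma cyclotomic_int_relation:
  assumes \<zeta>: "\<zeta> \<in> R" and h: "poly (map_poly of_int h) \<zeta> = 0" "degree h < N"
  shows "h = 0"
proof (rule ccontr)
  assume "h \<noteq> 0"
  define \<pi> where "\<pi> = 1 - \<zeta>"
  have \<pi>0: "\<pi> \<noteq> 0" using \<zeta> by (auto simp: \<pi>_def R_def)
  have \<pi>_int: "algebraic_int \<pi>"
    using \<zeta> q_pos unfolding \<pi>_def
    by (intro algebraic_int_diff algebraic_int_1 algebraic_int_root_of_unity)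
       (auto simp: R_def root_of_unity_def)
  \<comment> \<open>\<open>p\<close> is a product of \<open>card R\<close> associates of
    \<open>\<pi>\<close>, and \<open>card R\<close> is at least \<open>N\<close>.\<close>
  have p_div: "algebraic_int (of_nat p / \<pi> ^ e)" if "e \<le> N" for e
  proof -
    have "of_nat p / \<pi> ^ e = (\<Prod>z\<in>R. (1 - z) / \<pi>) * \<pi> ^ (card R - e)"
      using that card_R \<pi>0 by (simp add: p_eq_prod prod_dividef power_diff)
    thus ?thesis using ratio_algebraic_int[OF \<zeta>] \<pi>_int unfolding \<pi>_def
      by (auto intro!: algebraic_int_mult algebraic_int_prod algebraic_int_power)
  qed
  \<comment> \<open>Substituting 1 - X turns the relation for \<open>\<zeta>\<close> into one of the
    same degree for \<open>\<pi>\<close>.\<close>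
  define g where "g = pcompose h [:1, -1:]"
  have "g \<noteq> 0" using \<open>h \<noteq> 0\<close> by (auto simp: g_def pcompose_eq_0_iff)
  have gd: "degree g < N" using h(2) by (simp add: g_def degree_pcompose)
  define g' where "g' = primitive_part g"
  have g: "g = smult (content g) g'" by (simp add: g'_def)
  have cg: "content g \<noteq> 0" using \<open>g \<noteq> 0\<close> by simp
  have g'd: "degree g' < N" using gd by (simp add: g'_def)
  have "poly (map_poly of_int g) \<pi> = poly (map_poly of_int h) \<zeta>"
    by (simp add: g_def of_int_hom.map_poly_pcompose poly_pcompose \<pi>_def)
  hence g'\<pi>: "poly (map_poly of_int g') \<pi> = 0"
    using h(1) cg by (subst (asm) g) (simp add: hom_distribs)
  have "\<exists>i. \<not> int p dvd coeff g' i"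
  proof (rule ccontr)
    assume "\<not> ?thesis"
    hence "int p dvd content g'"
      by (simp add: const_poly_dvd_iff flip: const_poly_dvd_iff_dvd_content)
    moreover have "content g' = 1" unfolding g'_def by (rule content_primitive_part[OF \<open>g \<noteq> 0\<close>])
    ultimately show False using p_ge_2 by simp
  qed
  define i0 where "i0 = (LEAST i. \<not> int p dvd coeff g' i)"
  have i0: "\<not> int p dvd coeff g' i0"
    unfolding i0_def using \<open>\<exists>i. _ i\<close> by (rule LeastI_ex)
  have below: "int p dvd coeff g' i" if "i < i0" for i
    using not_less_Least[OF that[unfolded i0_def]] by simp
  have i0_le: "i0 \<le> degree g'"
  proof (rule ccontr)
    assume "\<not> ?thesis"
    hence "coeff g' i0 = 0" by (intro coeff_eq_0) simp
    thus False using i0 by simp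
  qed
  define c where "c = (\<lambda>i. complex_of_int (coeff g' i))"
  have "0 = (\<Sum>i\<le>degree g'. c i * \<pi> ^ i)"
    using g'\<pi> by (simp add: poly_altdef degree_map_poly coeff_map_poly c_def)
  also have "\<dots> = c i0 * \<pi> ^ i0 + (\<Sum>i\<in>{..degree g'} - {i0}. c i * \<pi> ^ i)"
    using i0_le by (intro sum.remove) auto
  finally have "c i0 * \<pi> ^ i0 = - (\<Sum>i\<in>{..degree g'} - {i0}. c i * \<pi> ^ i)"
    by (simp add: eq_neg_iff_add_eq_0)
  \<comment> \<open>After this division the terms on the right are integral: below \<open>i0\<close>
    the coefficient carries a factor \<open>p\<close>, which absorbs the denominator, and above
    \<open>i0\<close> the power of \<open>\<pi>\<close> does.\<close>
  hence "c i0 * \<pi> ^ i0 / \<pi> ^ Suc i0 = - (\<Sum>i\<in>{..degree g'} - {i0}. c i * \<pi> ^ i / \<pi> ^ Suc i0)"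
    by (simp add: sum_divide_distrib)
  hence eq: "c i0 / \<pi> = - (\<Sum>i\<in>{..degree g'} - {i0}. c i * \<pi> ^ i / \<pi> ^ Suc i0)"
    using \<pi>0 by simp
  have "algebraic_int (c i * \<pi> ^ i / \<pi> ^ Suc i0)" if i: "i \<in> {..degree g'} - {i0}" for i
  proof (cases "i < i0")
    case True
    then obtain k where "coeff g' i = int p * k" using below by blast
    hence "c i * \<pi> ^ i / \<pi> ^ Suc i0 = of_int k * \<pi> ^ i * (of_nat p / \<pi> ^ Suc i0)"
      by (simp add: c_def)
    moreover have "Suc i0 \<le> N" using i0_le g'd by simp
    ultimately show ?thesis
      by (simp only:) (intro algebraic_int_mult algebraic_int_of_int algebraic_int_power \<pi>_int p_div)
  next
    case False
    hence "i \<ge> Suc i0" using i by auto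
    hence "c i * \<pi> ^ i / \<pi> ^ Suc i0 = c i * \<pi> ^ (i - Suc i0)"
      using \<pi>0 by (simp add: power_diff del: power_Suc)
    thus ?thesis using \<pi>_int by (auto simp: c_def intro: algebraic_int_closed)
  qed
  hence 1: "algebraic_int (c i0 / \<pi>)"
    unfolding eq by (auto intro: algebraic_int_sum)
  have 2: "algebraic_int (of_nat p / \<pi>)"
    using p_div[of 1] N_pos by simp
  have "coprime (coeff g' i0) (int p)"
    using i0 p by (metis coprime_commute prime_imp_coprime prime_nat_int_transfer)
  then obtain u v where uv: "u * coeff g' i0 + v * int p = 1"
    using bezout_int[of "coeff g' i0" "int p"] by auto
  have "1 / \<pi> = of_int u * (c i0 / \<pi>) + of_int v * (of_nat p / \<pi>)"
    using arg_cong[OF uv, of complex_of_int] by (simp add: c_def add_divide_distrib[symmetric])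
  hence inv: "algebraic_int (1 / \<pi>)"
    by (simp only:) (intro algebraic_int_add algebraic_int_mult algebraic_int_of_int 1 2)
  \<comment> \<open>Once \<open>1 / \<pi>\<close> is integral, so is \<open>1 / p\<close>; being
    rational, it would be an ordinary integer.\<close>
  have "1 / of_nat p = (\<Prod>z\<in>R. (1 - \<zeta>) / (1 - z) * (1 / \<pi>))"
    using \<pi>0 by (simp add: p_eq_prod prod_dividef \<pi>_def)
  hence "algebraic_int (1 / of_nat p :: complex)"
    by (simp only:) (intro algebraic_int_prod algebraic_int_mult ratio_algebraic_int \<zeta> inv)
  hence "(1 / of_nat p :: complex) \<in> \<int>"
    by (rule rational_algebraic_int_is_int) auto
  then obtain n :: int where "(1 / of_nat p :: complex) = of_int n" by (auto elim: Ints_cases)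
  hence "complex_of_int 1 = of_int (n * int p)" using p_ge_2 by (simp add: field_simps)
  hence "n * int p = 1" by (metis of_int_eq_iff)
  thus False using p_ge_2 by (auto simp: zmult_eq_1_iff)
qed

text \<open>The first \<open>N\<close> powers of \<open>\<zeta>\<close> are independent over the
  rationals and lie in the span of the products of \<open>B\<close> with the powers of
  \<open>\<zeta>\<close> below \<open>degree m\<close>.\<close>

lemma cyclotomic_degree:
  assumes F: "cfield F" "F \<subseteq> ratvs.span B" "finite B" and \<zeta>: "\<zeta> \<in> R" and m: "is_minpoly F \<zeta> m"
  shows "p ^ A \<le> card B * degree m"
proof -
  interpret cfield F by fact
  have rel: "\<forall>i<N. c i = 0" if c: "(\<Sum>i<N. of_int (c i) * \<zeta> ^ i) = 0" for c :: "nat \<Rightarrow> int"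
  proof -
    define h where "h = (\<Sum>i<N. monom (c i) i)"
    have "poly (map_poly of_int h) \<zeta> = (\<Sum>i<N. of_int (c i) * \<zeta> ^ i)"
      by (simp add: h_def of_int_poly_hom.hom_sum poly_sum poly_monom map_poly_monom)
    moreover have co: "coeff h i = (if i < N then c i else 0)" for i
      by (auto simp: h_def coeff_sum)
    hence "degree h < N"
      using N_pos by (metis degree_0 leading_coeff_0_iff)
    ultimately have "h = 0" using cyclotomic_int_relation[OF \<zeta>] c by simp
    thus ?thesis using co by (metis coeff_0)
  qed
  have inj: "inj_on (\<lambda>i. \<zeta> ^ i) {..<N}"
  proof (rule inj_onI, rule ccontr)
    fix i j assume ij: "i \<in> {..<N}" "j \<in> {..<N}" "\<zeta> ^ i = \<zeta> ^ j" "i \<noteq> j"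
    \<comment> \<open>A coincidence of two powers is itself a nontrivial integer relation.\<close>
    define c :: "nat \<Rightarrow> int" where "c = (\<lambda>l. (if l = i then 1 else 0) - (if l = j then 1 else 0))"
    have "(\<Sum>l<N. of_int (c l) * \<zeta> ^ l) =
        (\<Sum>l<N. (if l = i then \<zeta> ^ l else 0)) - (\<Sum>l<N. (if l = j then \<zeta> ^ l else 0))"
      by (simp only: sum_subtractf[symmetric], intro sum.cong) (auto simp: c_def)
    also have "\<dots> = 0" using ij by simp
    finally have "c i = 0" using rel ij by auto
    thus False using ij by (simp add: c_def)
  qed
  let ?P = "(\<lambda>i. \<zeta> ^ i) ` {..<N}"
  have "ratvs.independent ?P"
  proof (rule ratvs.independent_if_scalars_zero)
    fix f x assume f: "(\<Sum>x\<in>?P. of_rat (f x) * x) = 0" and x: "x \<in> ?P"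
    obtain d where d: "d > 0" "\<forall>i\<in>{..<N}. \<exists>k. of_int d * f (\<zeta> ^ i) = of_int k"
      using common_denominator[of "{..<N}" "\<lambda>i. f (\<zeta> ^ i)"] by auto
    then obtain k where k: "\<And>i. i < N \<Longrightarrow> of_int d * f (\<zeta> ^ i) = of_int (k i)"
      by (metis lessThan_iff)
    have k': "complex_of_int (k i) = of_int d * of_rat (f (\<zeta> ^ i))" if "i < N" for i
      using arg_cong[OF k[OF that], of "of_rat :: rat \<Rightarrow> complex"] by (simp add: of_rat_mult)
    have "0 = of_int d * (\<Sum>i<N. of_rat (f (\<zeta> ^ i)) * \<zeta> ^ i)"
      using f by (simp add: sum.reindex[OF inj])
    also have "\<dots> = (\<Sum>i<N. of_int (k i) * \<zeta> ^ i)"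
      by (simp add: sum_distrib_left k' mult.assoc)
    finally have "\<forall>i<N. k i = 0" using rel by simp
    moreover obtain i where "i < N" "x = \<zeta> ^ i" using x by auto
    ultimately show "f x = 0" using k[of i] d by simp
  qed simp
  moreover have "?P \<subseteq> ratvs.span ((\<lambda>(b, j). b * \<zeta> ^ j) ` (B \<times> {..<degree m}))"
    (is "_ \<subseteq> ratvs.span ?C")
  proof -
    interpret E: cfield "adjoin F {\<zeta>}" by (rule cfield_adjoin)
    have "?P \<subseteq> adjoin F {\<zeta>}" using adjoin_gens[of "{\<zeta>}" F] by auto
    thus ?thesis using adjoin_rat_span[OF F(2) m] by blast
  qed
  moreover have fin: "finite ?C" using F(3) by simp
  ultimately have "card ?P \<le> card ?C" using ratvs.independent_span_bound by blast
  also have "\<dots> \<le> card (B \<times> {..<degree m})" using F(3) by (intro card_image_le) auto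
  finally show ?thesis using inj by (simp add: card_image card_cartesian_product N_def)
qed

end

section \<open>Prime-degree radicals\<close>

text \<open>All \<open>e\<close> conjugates of \<open>y\<close> are \<open>k\<close>-th roots of
  \<open>t\<close>, so their product \<open>c\<close>, up to sign the constant term of
  \<open>m\<close>, lies in \<open>K\<close> with \<open>c ^ k = t ^ e\<close>. Since 0 < e < k and
  \<open>k\<close> is prime, \<open>e\<close> is invertible modulo \<open>k\<close>.\<close>

lemma (in cfield) prime_power_descent:
  assumes k: "Factorial_Ring.prime k" and y: "y ^ k = t" "t \<in> K" "t \<noteq> 0"
    and m: "is_minpoly K y m" "degree m < k"
  obtains z where "z \<in> K" "z ^ k = t"
proof -
  note m' = is_minpolyD[OF m(1)]
  define e where "e = degree m"
  let ?R = "{z. poly m z = 0}"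
  define xk where "xk = monom 1 k - [:t:]"
  have xk: "xk \<in> polys_over K" "poly xk y = 0"
    using y by (auto simp: xk_def poly_monom)
  obtain g where g: "xk = g * m" using minpoly_dvd[OF m(1) xk] by blast
  have root: "b ^ k = t" if "b \<in> ?R" for b
    using that arg_cong[OF g, of "\<lambda>p. poly p b"] by (simp add: xk_def poly_monom)
  define c where "c = (-1) ^ e * poly m 0"
  have "poly m 0 = (\<Prod>b\<in>?R. - b)"
    by (subst minpoly_card_roots(2)[OF m(1)]) (simp add: poly_prod)
  also have "\<dots> = (-1) ^ e * (\<Prod>b\<in>?R. b)"
    by (simp add: prod_uminus minpoly_card_roots(1)[OF m(1)] e_def)
  finally have c: "c = (\<Prod>b\<in>?R. b)"
    by (simp add: c_def mult.assoc[symmetric] power_mult_distrib[symmetric])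
  have cK: "c \<in> K" using m'(1) by (auto simp: c_def intro!: power_closed mult_closed)
  have ck: "c ^ k = t ^ e"
    by (simp add: c prod_power_distrib root minpoly_card_roots(1)[OF m(1)] e_def)
  have e: "0 < e" "e < k" using m' m(2) by (auto simp: e_def)
  hence "\<not> k dvd e" by (auto dest: dvd_imp_le)
  hence "coprime e k" using prime_imp_coprime[OF k] coprime_commute by blast
  then obtain a b where ab: "e * a = k * b + 1"
    using bezout_nat[of e k] e by auto
  \<comment> \<open>The \<open>k\<close>-th power of \<open>c ^ a\<close> is
    \<open>t ^ (e * a) = t ^ (k * b + 1)\<close>, and the denominator removes
    \<open>t ^ (k * b)\<close>.\<close>
  define z where "z = c ^ a / t ^ b"
  have "z ^ k = (c ^ k) ^ a / (t ^ b) ^ k"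
    by (simp add: z_def power_divide mult.commute flip: power_mult)
  also have "\<dots> = t ^ (e * a) / t ^ (k * b)"
    by (simp add: ck mult.commute flip: power_mult)
  also have "\<dots> = t" using y(3) by (simp add: ab)
  finally have "z ^ k = t" .
  moreover have "z \<in> K" using cK y(2) by (auto simp: z_def)
  ultimately show ?thesis using that by blast
qed

context splitting
begin

text \<open>Conjugates over \<open>M\<close> of an element of \<open>M(\<zeta>)\<close>, with \<open>\<zeta>\<close> a \<open>k\<close>-th root of unity, are
  determined by the image of \<open>\<zeta>\<close>, so there are fewer than \<open>k\<close> of them.\<close>

lemma prime_power_descent_cyclotomic:
  assumes k: "Factorial_Ring.prime k" and M: "cfield M" "F \<subseteq> M" "M \<subseteq> L"
    and \<zeta>: "\<zeta> \<in> L" "\<zeta> ^ k = 1" "\<zeta> \<noteq> 1"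
    and y: "y \<in> adjoin M {\<zeta>}" "y ^ k = t" "t \<in> M" "t \<noteq> 0"
  obtains z where "z \<in> M" "z ^ k = t"
proof -
  interpret M: cfield M by fact
  have k0: "k > 0" using k by (rule prime_gt_0_nat)
  have alg: "algebraic_over M u" if "u ^ k \<in> M" for u
    unfolding algebraic_over_def
  proof (intro bexI conjI)
    have "coeff (monom 1 k - [:u ^ k:]) k = 1"
      using k0 by (cases k) auto
    thus "monom 1 k - [:u ^ k:] \<noteq> 0" by force
  qed (use that in \<open>auto simp: poly_monom\<close>)
  obtain n where n: "is_minpoly M \<zeta> n"
    using M.minpoly_exists[OF alg[of \<zeta>]] \<zeta>(2) by auto
  obtain m where m: "is_minpoly M y m"
    using M.minpoly_exists[OF alg[of y]] y(2,3) by auto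
  obtain f where f: "f \<in> polys_over M" "y = poly f \<zeta>"
    using y(1) unfolding M.adjoin_minpoly[OF n] by auto
  have yL: "y \<in> L"
    using y(1) adjoin_least[OF L.cfield_axioms M(3), of "{\<zeta>}"] \<zeta>(1) by auto
  let ?U = "{z. z ^ k = 1} - {1 :: complex}"
  have "{z. poly m z = 0} \<subseteq> poly f ` ?U"
  proof clarify
    fix z assume z: "poly m z = 0"
    obtain \<tau> where t: "\<tau> \<in> Gal L M" "\<tau> y = z" using Gal_transitive[OF M yL m z] .
    note t' = GalD[OF t(1)]
    have "map_poly \<tau> f = f"
      using f(1) t'(5) by (intro L.map_emb_fixed[OF t'(1)]) (auto simp: polys_overD)
    hence "z = poly f (\<tau> \<zeta>)"
      using L.emb_poly[OF t'(1), of f \<zeta>] f t(2) \<zeta>(1) polys_over_mono[OF M(3)] by auto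
    moreover have "\<tau> \<zeta> ^ k = 1"
      using L.emb_power[OF t'(1) \<zeta>(1), of k] \<zeta>(2) L.emb_one[OF t'(1)] by simp
    moreover have "\<tau> \<zeta> \<noteq> 1"
      using L.emb_inj[OF t'(1)] L.emb_one[OF t'(1)] \<zeta>(1,3) by (metis L.one_closed inj_onD)
    ultimately show "z \<in> poly f ` ?U" by blast
  qed
  moreover have "finite {z :: complex. z ^ k = 1}" "card {z :: complex. z ^ k = 1} = k"
    using k0 by (auto simp: finite_roots_unity card_roots_unity_eq)
  moreover from this have "card ?U < k" using k0 by (simp add: card_Diff_singleton)
  ultimately have "card {z. poly m z = 0} < k"
    by (meson card_image_le card_mono finite_Diff finite_imageI le_less_trans order_trans)
  hence "degree m < k" using M.minpoly_card_roots(1)[OF m] by simp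
  with M.prime_power_descent[OF k y(2-4) m] show ?thesis using that by blast
qed

text \<open>If \<open>y\<close> had degree below \<open>k\<close> over M(\<zeta>), \<open>t\<close>
  would become a \<open>k\<close>-th power first in M(\<zeta>) and then in \<open>M\<close>. So
  \<open>y\<close> has at least \<open>k\<close> conjugates.\<close>

lemma radical_stabilizer_le:
  assumes k: "Factorial_Ring.prime k" and M: "cfield M" "F \<subseteq> M" "M \<subseteq> L"
    and \<zeta>: "\<zeta> \<in> L" "\<zeta> ^ k = 1" "\<zeta> \<noteq> 1"
    and y: "y \<in> L" "y ^ k = t" "t \<in> M" "t \<noteq> 0" and nopow: "\<not> (\<exists>z\<in>M. z ^ k = t)"
  shows "k * card {\<tau> \<in> Gal L (adjoin M {\<zeta>}). \<tau> y = y} \<le> card (Gal L (adjoin M {\<zeta>}))"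
proof -
  let ?E = "adjoin M {\<zeta>}"
  interpret E: cfield ?E by (rule cfield_adjoin)
  have E: "F \<subseteq> ?E" "?E \<subseteq> L"
    using M adjoin_base[of M "{\<zeta>}"] adjoin_least[OF L.cfield_axioms M(3), of "{\<zeta>}"] \<zeta>(1) by auto
  have tE: "t \<in> ?E" using y(3) adjoin_base by blast
  have "algebraic_over ?E y"
    unfolding algebraic_over_def
  proof (intro bexI conjI)
    have "coeff (monom 1 k - [:t:]) k = 1"
      using prime_gt_0_nat[OF k] by (cases k) auto
    thus "monom 1 k - [:t:] \<noteq> 0" by force
  qed (use y tE in \<open>auto simp: poly_monom\<close>)
  then obtain m where m: "is_minpoly ?E y m" by (rule E.minpoly_exists)
  have "k \<le> degree m"
  proof (rule ccontr)
    assume "\<not> ?thesis"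
    hence lt: "degree m < k" by simp
    obtain z where z: "z \<in> ?E" "z ^ k = t"
      using E.prime_power_descent[OF k y(2) tE y(4) m lt] .
    thus False using prime_power_descent_cyclotomic[OF k M \<zeta> z y(3,4)] nopow by blast
  qed
  hence "k * card {\<tau> \<in> Gal L ?E. \<tau> y = y} \<le> degree m * card {\<tau> \<in> Gal L ?E. \<tau> y = y}"
    by simp
  also have "\<dots> \<le> card (Gal L ?E)"
    by (rule degree_mult_stabilizer_le[OF E.cfield_axioms E y(1) m])
  finally show ?thesis .
qed

end

section \<open>Prime ideals in rings of integers\<close>

locale rat_finite_field = cfield K for K +
  fixes B :: "complex set"
  assumes finite_B: "finite B" and K_span: "K \<subseteq> ratvs.span B"
begin

definition OK :: "complex set" where
  "OK = {x \<in> K. algebraic_int x}"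

lemma OK_K: "x \<in> OK \<Longrightarrow> x \<in> K"
  by (simp add: OK_def)

lemma OK_zero [simp, intro]: "0 \<in> OK"
  and OK_one [simp, intro]: "1 \<in> OK"
  and OK_of_int [simp, intro]: "of_int n \<in> OK"
  and OK_add [intro]: "x \<in> OK \<Longrightarrow> y \<in> OK \<Longrightarrow> x + y \<in> OK"
  and OK_diff [intro]: "x \<in> OK \<Longrightarrow> y \<in> OK \<Longrightarrow> x - y \<in> OK"
  and OK_uminus [intro]: "x \<in> OK \<Longrightarrow> - x \<in> OK"
  and OK_mult [intro]: "x \<in> OK \<Longrightarrow> y \<in> OK \<Longrightarrow> x * y \<in> OK"
  and OK_power [intro]: "x \<in> OK \<Longrightarrow> x ^ k \<in> OK"
  by (auto simp: OK_def algebraic_int_1 intro: algebraic_int_closed)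

lemma OK_of_nat [simp, intro]: "of_nat n \<in> OK"
  using OK_of_int[of "int n"] by simp

lemma OK_sum [intro]: "(\<And>i. i \<in> I \<Longrightarrow> f i \<in> OK) \<Longrightarrow> sum f I \<in> OK"
  by (induction I rule: infinite_finite_induct) auto

lemma OK_prod [intro]: "(\<And>i. i \<in> I \<Longrightarrow> f i \<in> OK) \<Longrightarrow> prod f I \<in> OK"
  by (induction I rule: infinite_finite_induct) auto

text \<open>Linear independence of the residue classes of \<open>S\<close> in O/pO over the field
  with \<open>p\<close> elements, expressed without forming the quotient.\<close>

definition indep_mod :: "nat \<Rightarrow> complex set \<Rightarrow> bool" where
  "indep_mod p S \<longleftrightarrow> finite S \<and> S \<subseteq> OK \<and>
     (\<forall>c :: complex \<Rightarrow> int. (\<Sum>s\<in>S. of_int (c s) * s) / of_nat p \<in> OK \<longrightarrow> (\<forall>s\<in>S. int p dvd c s))"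

lemma indep_modD:
  assumes "indep_mod p S" "(\<Sum>s\<in>S. of_int (c s) * s) / of_nat p \<in> OK" "s \<in> S"
  shows "int p dvd c s"
  using assms unfolding indep_mod_def by blast

text \<open>A rational relation, scaled to be integral and primitive, stays nontrivial modulo \<open>p\<close>.\<close>

lemma indep_mod_card:
  assumes p: "Factorial_Ring.prime p" and S: "indep_mod p S"
  shows "card S \<le> card B"
proof -
  have fin: "finite S" using S by (simp add: indep_mod_def)
  have "ratvs.independent S"
  proof (rule ratvs.independent_if_scalars_zero[OF fin], rule ccontr)
    fix f x assume f: "(\<Sum>x\<in>S. of_rat (f x) * x) = 0" and x: "x \<in> S" "f x \<noteq> 0"
    obtain d where d: "d > 0" "\<forall>i\<in>S. \<exists>k. of_int d * f i = of_int k"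
      using common_denominator[OF fin, of f] by auto
    then obtain k where k: "\<And>i. i \<in> S \<Longrightarrow> of_int d * f i = of_int (k i)" by metis
    have k': "complex_of_int (k i) = of_int d * of_rat (f i)" if "i \<in> S" for i
      using arg_cong[OF k[OF that], of "of_rat :: rat \<Rightarrow> complex"] by (simp add: of_rat_mult)
    define g where "g = Gcd (k ` S)"
    have "k x \<noteq> 0" using k[OF x(1)] x(2) d(1) by auto
    hence g0: "g \<noteq> 0" using x(1) by (auto simp: g_def Gcd_0_iff)
    have gk: "g * (k i div g) = k i" if "i \<in> S" for i
      using that by (simp add: g_def Gcd_dvd)
    have "of_int g * (\<Sum>i\<in>S. of_int (k i div g) * i) = (\<Sum>i\<in>S. of_int (g * (k i div g)) * i)"
      by (simp add: sum_distrib_left mult.assoc)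
    also have "\<dots> = of_int d * (\<Sum>i\<in>S. of_rat (f i) * i)"
      by (simp add: gk k' sum_distrib_left mult.assoc del: of_int_mult)
    finally have "(\<Sum>i\<in>S. complex_of_int (k i div g) * i) = 0" using f g0 by simp
    hence dv: "\<forall>i\<in>S. int p dvd k i div g"
      using indep_modD[OF S, of "\<lambda>i. k i div g"] by simp
    have "g * int p dvd k i" if "i \<in> S" for i
      using mult_dvd_mono[OF dvd_refl[of g], of "int p" "k i div g"] dv gk[OF that] that by simp
    hence "g * int p dvd Gcd (k ` S)" by (intro Gcd_greatest) auto
    hence "g * int p dvd g * 1" by (simp add: g_def)
    hence "int p dvd 1" using g0 by (simp only: dvd_mult_cancel_left) simp
    thus False using p by (simp add: prime_nat_iff)
  qed
  moreover have "S \<subseteq> ratvs.span B" using S K_span OK_K by (auto simp: indep_mod_def)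
  ultimately show ?thesis using ratvs.independent_span_bound[OF finite_B] by blast
qed

text \<open>Independent sets modulo \<open>p\<close> have at most \<open>card B\<close> elements, so
  there is a largest one. It spans O/pO, and its combinations with coefficients in
  \<open>{0..<int p}\<close> represent every class.\<close>

lemma finite_quotient_prime:
  assumes p: "Factorial_Ring.prime p"
  shows "\<exists>T. finite T \<and> T \<subseteq> OK \<and> (\<forall>x\<in>OK. \<exists>y\<in>T. (x - y) / of_nat p \<in> OK)"
proof -
  have p0: "(of_nat p :: complex) \<noteq> 0" using p by auto
  have "indep_mod p {}" by (simp add: indep_mod_def)
  then obtain S where S: "indep_mod p S" and max: "\<And>T. indep_mod p T \<Longrightarrow> card T \<le> card S"
    using ex_has_greatest_nat[of "indep_mod p" "{}" card "Suc (card B)"] indep_mod_card[OF p]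
    by (metis le_imp_less_Suc)
  have fin: "finite S" and SO: "S \<subseteq> OK" using S by (auto simp: indep_mod_def)
  have rep: "\<exists>c :: complex \<Rightarrow> int. (x - (\<Sum>s\<in>S. of_int (c s) * s)) / of_nat p \<in> OK" if x: "x \<in> OK" for x
  proof (cases "x \<in> S")
    case True
    have "(\<Sum>s\<in>S. of_int (if s = x then 1 else 0) * s) = (\<Sum>s\<in>S. if s = x then s else 0)"
      by (intro sum.cong) auto
    also have "\<dots> = x" using True fin by simp
    finally show ?thesis by (intro exI[of _ "\<lambda>s. if s = x then 1 else 0"]) simp
  next
    case False
    hence "\<not> indep_mod p (insert x S)" using max[of "insert x S"] fin by auto
    then obtain c :: "complex \<Rightarrow> int" where
      c: "(\<Sum>s\<in>insert x S. of_int (c s) * s) / of_nat p \<in> OK" "\<not> (\<forall>s\<in>insert x S. int p dvd c s)"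
      using x SO fin by (auto simp: indep_mod_def)
    define w where "w = (\<Sum>s\<in>S. of_int (c s) * s)"
    define w' where "w' = of_int (c x) * x + w"
    have cx: "w' / of_nat p \<in> OK"
      using c(1) fin False by (simp add: w_def w'_def)
    \<comment> \<open>Otherwise \<open>x\<close> drops out of the relation modulo \<open>p\<close>,
      and independence of \<open>S\<close> makes all coefficients divisible by
      \<open>p\<close>.\<close>
    have "\<not> int p dvd c x"
    proof
      assume dv: "int p dvd c x"
      then obtain l where "c x = int p * l" by blast
      hence "w / of_nat p = w' / of_nat p - of_int l * x"
        using p0 by (simp add: w'_def field_simps)
      hence "w / of_nat p \<in> OK" using cx x by auto
      hence "\<forall>s\<in>S. int p dvd c s" using indep_modD[OF S, of c] by (simp add: w_def)
      thus False using c(2) dv by auto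
    qed
    hence "coprime (c x) (int p)"
      using p by (metis coprime_commute prime_imp_coprime prime_nat_int_transfer)
    \<comment> \<open>\<open>u\<close> inverts the coefficient of \<open>x\<close> modulo
      \<open>p\<close>, so the relation can be solved for \<open>x\<close>.\<close>
    then obtain u v where uv: "u * c x + v * int p = 1"
      using bezout_int[of "c x" "int p"] by auto
    have uv': "complex_of_int u * of_int (c x) + of_int v * of_nat p = 1"
      using arg_cong[OF uv, of complex_of_int] by simp
    have "(\<Sum>s\<in>S. of_int (- u * c s) * s) = - (of_int u * w)"
      by (simp add: w_def sum_distrib_left mult.assoc sum_negf)
    hence "x - (\<Sum>s\<in>S. of_int (- u * c s) * s) = 1 * x + of_int u * w"
      by simp
    also have "\<dots> = of_int u * w' + of_int v * of_nat p * x"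
      unfolding uv'[symmetric] by (simp add: w'_def algebra_simps)
    finally have "(x - (\<Sum>s\<in>S. of_int (- u * c s) * s)) / of_nat p =
        of_int u * (w' / of_nat p) + of_int v * x"
      using p0 by (simp add: add_divide_distrib)
    moreover have "of_int u * (w' / of_nat p) + of_int v * x \<in> OK"
      using cx x by (intro OK_add OK_mult OK_of_int)
    ultimately show ?thesis by (intro exI[of _ "\<lambda>s. - u * c s"]) simp
  qed
  define T where "T = (\<lambda>c. \<Sum>s\<in>S. of_int (c s) * s) ` (\<Pi>\<^sub>E s\<in>S. {0..<int p})"
  have "finite T" unfolding T_def using fin by (intro finite_imageI finite_PiE) auto
  moreover have "T \<subseteq> OK" using SO by (auto simp: T_def intro!: OK_sum OK_mult)
  moreover have "\<exists>y\<in>T. (x - y) / of_nat p \<in> OK" if x: "x \<in> OK" for x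
  proof -
    obtain c :: "complex \<Rightarrow> int" where c: "(x - (\<Sum>s\<in>S. of_int (c s) * s)) / of_nat p \<in> OK"
      using rep[OF x] by blast
    define c' where "c' = restrict (\<lambda>s. c s mod int p) S"
    define y where "y = (\<Sum>s\<in>S. of_int (c' s) * s)"
    have "p > 0" using p by (rule prime_gt_0_nat)
    hence "c' \<in> (\<Pi>\<^sub>E s\<in>S. {0..<int p})" by (auto simp: c'_def)
    hence yT: "y \<in> T" unfolding T_def y_def by (rule imageI)
    have "(\<Sum>s\<in>S. of_int (c s) * s) = (\<Sum>s\<in>S. (of_int (c' s) * s + of_nat p * (of_int (c s div int p) * s)))"
    proof (rule sum.cong)
      fix s assume s: "s \<in> S"
      have "complex_of_int (c s) = of_int (c s mod int p + int p * (c s div int p))"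
        by (simp only: mod_mult_div_eq)
      also have "\<dots> = of_int (c' s) + of_nat p * of_int (c s div int p)"
        using s by (simp only: c'_def restrict_apply' of_int_add of_int_mult of_int_of_nat_eq)
      finally show "of_int (c s) * s = of_int (c' s) * s + of_nat p * (of_int (c s div int p) * s)"
        by (simp add: algebra_simps)
    qed simp
    also have "\<dots> = y + of_nat p * (\<Sum>s\<in>S. of_int (c s div int p) * s)"
      by (simp add: sum.distrib sum_distrib_left y_def)
    finally have "(x - y) / of_nat p = (x - (\<Sum>s\<in>S. of_int (c s) * s)) / of_nat p +
        (\<Sum>s\<in>S. of_int (c s div int p) * s)"
      using p0 by (simp add: field_simps)
    moreover have "(\<Sum>s\<in>S. of_int (c s div int p) * s) \<in> OK" using SO by auto
    ultimately show ?thesis using c yT by (intro bexI[of _ y]) auto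
  qed
  ultimately show ?thesis by blast
qed

text \<open>One prime factor is split off, \<open>m = p * m'\<close>; representatives are y + p y'
  with y taken modulo \<open>p\<close> and y' modulo \<open>m'\<close>.\<close>

lemma finite_quotient:
  assumes "m > 0"
  shows "\<exists>T. finite T \<and> T \<subseteq> OK \<and> (\<forall>x\<in>OK. \<exists>y\<in>T. (x - y) / of_nat m \<in> OK)"
  using assms
proof (induction m rule: less_induct)
  case (less m)
  show ?case
  proof (cases "m = 1")
    case True
    thus ?thesis by (intro exI[of _ "{0}"]) auto
  next
    case False
    then obtain p where p: "Factorial_Ring.prime p" "p dvd m" using prime_factor_nat by blast
    then obtain m' where m': "m = p * m'" by blast
    have "m' > 0" "m' < m" using less.prems m' prime_gt_1_nat[OF p(1)] by auto
    from less.IH[OF this(2,1)] obtain T' where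
      T': "finite T'" "T' \<subseteq> OK" "\<forall>x\<in>OK. \<exists>y\<in>T'. (x - y) / of_nat m' \<in> OK"
      by (elim exE conjE)
    from finite_quotient_prime[OF p(1)] obtain T where
      T: "finite T" "T \<subseteq> OK" "\<forall>x\<in>OK. \<exists>y\<in>T. (x - y) / of_nat p \<in> OK"
      by (elim exE conjE)
    let ?T = "(\<lambda>(y, y'). y + of_nat p * y') ` (T \<times> T')"
    have "\<exists>y\<in>?T. (x - y) / of_nat m \<in> OK" if x: "x \<in> OK" for x
    proof -
      obtain y where y: "y \<in> T" "(x - y) / of_nat p \<in> OK" using T(3) x by blast
      obtain y' where y': "y' \<in> T'" "((x - y) / of_nat p - y') / of_nat m' \<in> OK"
        using T'(3) y(2) by blast
      have "(x - (y + of_nat p * y')) / of_nat m = ((x - y) / of_nat p - y') / of_nat m'"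
        using p(1) \<open>m' > 0\<close> prime_gt_0_nat[OF p(1)] by (simp add: m' field_simps)
      thus ?thesis using y y' by (intro bexI[of _ "y + of_nat p * y'"]) (auto simp: image_iff)
    qed
    moreover have "finite ?T" using T T' by auto
    moreover have "?T \<subseteq> OK" using T(2) T'(2) by (auto intro!: OK_add OK_mult)
    ultimately show ?thesis by blast
  qed
qed

lemma pigeonhole_mod:
  assumes "m > 0" "\<And>i. a i \<in> OK"
  obtains i j :: nat where "i < j" "(a j - a i) / of_nat m \<in> OK"
proof -
  from finite_quotient[OF assms(1)] obtain T where
    T: "finite T" "T \<subseteq> OK" "\<forall>x\<in>OK. \<exists>y\<in>T. (x - y) / of_nat m \<in> OK"
    by (elim exE conjE)
  have "\<exists>y. y \<in> T \<and> (a i - y) / of_nat m \<in> OK" for i using T(3) assms(2)[of i] by blast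
  then obtain f where f: "\<And>i. f i \<in> T \<and> (a i - f i) / of_nat m \<in> OK" by metis
  have "\<not> inj f" using f T(1) by (metis finite_imageD finite_subset image_subsetI infinite_UNIV_nat)
  then obtain i j where ij: "i < j" "f i = f j"
    by (metis injI linorder_neqE_nat)
  have "(a j - a i) / of_nat m = (a j - f j) / of_nat m - (a i - f i) / of_nat m"
    by (simp add: ij(2) diff_divide_distrib)
  thus ?thesis using that[OF ij(1)] f OK_diff by metis
qed

text \<open>Among the integers m x^i two agree modulo \<open>m\<close>, so x^j - x^i is an algebraic
  integer for some i < j, and \<open>x\<close> is a root of a monic polynomial over the algebraic
  integers.\<close>

lemma integral_of_bounded_denominator:
  assumes "x \<in> K" "m > 0" "\<And>i. of_nat m * x ^ i \<in> OK"
  shows "x \<in> OK"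
proof -
  obtain i j :: nat where ij: "i < j" "(of_nat m * x ^ j - of_nat m * x ^ i) / of_nat m \<in> OK"
    using pigeonhole_mod[OF assms(2), of "\<lambda>i. of_nat m * x ^ i"] assms(3) by blast
  have "(of_nat m * x ^ j - of_nat m * x ^ i) / of_nat m = x ^ j - x ^ i"
    using assms(2) by (simp add: field_simps)
  hence z: "algebraic_int (x ^ j - x ^ i)" using ij(2) by (simp add: OK_def)
  define g where "g = (monom 1 j - monom 1 i :: complex poly)"
  have "degree g \<le> j" unfolding g_def using ij(1)
    by (intro degree_diff_le) (auto simp: degree_monom_eq)
  moreover have co: "coeff g j = 1" using ij(1) by (simp add: g_def)
  ultimately have d: "degree g = j" by (metis le_antisym le_degree zero_neq_one)
  have "algebraic_int x"
  proof (rule algebraic_int_root[OF z])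
    show "poly g x = x ^ j - x ^ i" by (simp add: g_def poly_monom)
    show "\<forall>i. coeff g i \<in> \<int>" by (simp add: g_def)
    show "lead_coeff g = 1" "degree g > 0" using co d ij(1) by simp_all
  qed
  thus ?thesis using assms(1) by (simp add: OK_def)
qed

text \<open>An integer relation of least degree for \<open>x\<close> has nonzero constant term, and
  that term is a multiple of \<open>x\<close>.\<close>

lemma OK_dvd_integer:
  assumes x: "x \<in> OK" "x \<noteq> 0"
  obtains m y where "m > 0" "y \<in> OK" "of_nat m = x * y"
proof -
  define P where "P = (\<lambda>f :: int poly. f \<noteq> 0 \<and> poly (map_poly of_int f) x = 0)"
  obtain f0 where "poly (map_poly of_int f0) x = 0" "lead_coeff f0 = 1"
    using x(1) by (auto simp: OK_def algebraic_int_altdef_ipoly)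
  hence "P f0" by (auto simp: P_def)
  then obtain f where f: "P f" and min: "\<And>g. P g \<Longrightarrow> degree f \<le> degree g"
    using ex_has_least_nat[of P f0 degree] by blast
  obtain a g where ag: "f = pCons a g" by (cases f) auto
  have eq: "of_int a + x * poly (map_poly of_int g) x = 0"
    using f by (simp add: P_def ag hom_distribs)
  have "a \<noteq> 0"
  proof
    assume a: "a = 0"
    hence "P g" using eq x(2) f by (auto simp: P_def ag)
    hence "degree f \<le> degree g" by (rule min)
    moreover have "g \<noteq> 0" using f a by (auto simp: P_def ag)
    ultimately show False by (simp add: ag)
  qed
  define y where "y = - of_int (sgn a) * poly (map_poly of_int g) x"
  have "poly (map_poly of_int g) x \<in> OK"
    unfolding poly_altdef using x(1) by (auto simp: coeff_map_poly)
  hence "y \<in> OK" unfolding y_def by (metis OK_mult OK_of_int of_int_minus)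
  moreover have "of_nat (nat \<bar>a\<bar>) = x * y"
  proof -
    have "complex_of_nat (nat \<bar>a\<bar>) = of_int (sgn a * a)"
      using abs_sgn[of a] by (simp add: mult.commute)
    also have "\<dots> = x * y" using eq
      by (simp add: y_def eq_neg_iff_add_eq_0[symmetric] add.commute mult.left_commute)
    finally show ?thesis .
  qed
  ultimately show ?thesis using that[of "nat \<bar>a\<bar>" y] \<open>a \<noteq> 0\<close> by simp
qed

end

section \<open>Invertibility of a nonzero prime ideal, and its valuation\<close>

locale integer_prime = rat_finite_field +
  fixes Q :: "complex set"
  assumes prime_Q: "primeideal Q (ring_of_integers K)" and Q_nonzero: "Q \<noteq> {0}"
begin

abbreviation R :: "complex ring" where
  "R \<equiv> ring_of_integers K"

lemma R_simps [simp]: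
  "carrier R = OK" "x \<otimes>\<^bsub>R\<^esub> y = x * y" "x \<oplus>\<^bsub>R\<^esub> y = x + y" "\<one>\<^bsub>R\<^esub> = 1" "\<zero>\<^bsub>R\<^esub> = 0"
  by (simp_all add: ring_of_integers_def OK_def)

sublocale Q: primeideal Q R
  by (rule prime_Q)

lemma Q_OK: "x \<in> Q \<Longrightarrow> x \<in> OK"
  using Q.Icarr by simp

lemma Q_zero: "0 \<in> Q"
  using additive_subgroup.zero_closed[OF Q.additive_subgroup_axioms] by simp

lemma Q_add: "x \<in> Q \<Longrightarrow> y \<in> Q \<Longrightarrow> x + y \<in> Q"
  using additive_subgroup.a_closed[OF Q.additive_subgroup_axioms] by simp

lemma Q_mult: "x \<in> Q \<Longrightarrow> y \<in> OK \<Longrightarrow> x * y \<in> Q"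
  using Q.I_r_closed by simp

lemma Q_uminus: "x \<in> Q \<Longrightarrow> - x \<in> Q"
  using Q_mult[of x "- 1"] by auto

lemma Q_diff: "x \<in> Q \<Longrightarrow> y \<in> Q \<Longrightarrow> x - y \<in> Q"
  using Q_add[of x "- y"] Q_uminus[of y] by simp

lemma Q_one: "1 \<notin> Q"
  using Q.one_imp_carrier Q.I_notcarr by auto

lemma Q_prime: "x \<in> OK \<Longrightarrow> y \<in> OK \<Longrightarrow> x * y \<in> Q \<Longrightarrow> x \<in> Q \<or> y \<in> Q"
  using Q.I_prime[of x y] by simp

lemma Q_prime_power: "x \<in> OK \<Longrightarrow> x ^ n \<in> Q \<Longrightarrow> x \<in> Q"
  by (induction n) (use Q_one Q_prime in auto)

lemma Q_integer:
  obtains m where "m > 0" "of_nat m \<in> Q"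
proof -
  obtain x where x: "x \<in> Q" "x \<noteq> 0" using Q_nonzero Q_zero by blast
  obtain m y where "m > 0" "y \<in> OK" "of_nat m = x * y"
    using OK_dvd_integer[OF Q_OK[OF x(1)] x(2)] .
  thus ?thesis using that[of m] Q_mult[OF x(1)] by simp
qed

text \<open>Modulo \<open>m\<close>, each \<open>x \<in> Q\<close> satisfies \<open>x ^ e (x ^ d - 1) = 0\<close> by finiteness, hence is nilpotent on the
  multiples of \<open>s\<close>, the product of the factors \<open>x ^ d - 1\<close>, none of which lies in \<open>Q\<close>. Multiplying
  \<open>s\<close> by the last power of each \<open>x\<close> that does not kill it gives an element killed by all of \<open>Q\<close>.\<close>

lemma annihilator:
  assumes m: "m > 0" "of_nat m \<in> Q"
  obtains b where "b \<in> OK" "b / of_nat m \<notin> OK" "\<And>x. x \<in> Q \<Longrightarrow> b * x / of_nat m \<in> OK"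
proof -
  have m0: "(of_nat m :: complex) \<noteq> 0" using m(1) by simp
  from finite_quotient[OF m(1)] obtain T where
    T: "finite T" "T \<subseteq> OK" "\<forall>x\<in>OK. \<exists>y\<in>T. (x - y) / of_nat m \<in> OK"
    by (elim exE conjE)
  have "\<exists>e d. 0 < d \<and> (x ^ (e + d) - x ^ e) / of_nat m \<in> OK" if x: "x \<in> OK" for x
  proof -
    obtain i j :: nat where "i < j" "(x ^ j - x ^ i) / of_nat m \<in> OK"
      using pigeonhole_mod[OF m(1), of "\<lambda>i. x ^ i"] x by blast
    thus ?thesis by (intro exI[of _ i] exI[of _ "j - i"]) auto
  qed
  then obtain e d where ed: "\<And>x. x \<in> OK \<Longrightarrow> 0 < d x \<and> (x ^ (e x + d x) - x ^ e x) / of_nat m \<in> OK"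
    by metis
  define U where "U = T \<inter> Q"
  define s where "s = (\<Prod>x\<in>U. x ^ d x - 1)"
  have U: "finite U" "U \<subseteq> Q" "U \<subseteq> OK" using T by (auto simp: U_def)
  have s_OK: "s \<in> OK" unfolding s_def using U(3) by (auto intro!: OK_prod)
  have "(\<Prod>x\<in>V. x ^ d x - 1) \<notin> Q" if "finite V" "V \<subseteq> U" for V
    using that
  proof (induction V rule: finite_induct)
    case empty
    thus ?case using Q_one by simp
  next
    case (insert x V)
    have x: "x \<in> Q" "x \<in> OK" using insert.prems U by auto
    \<comment> \<open>This uses \<open>d x > 0\<close>; if \<open>x ^ d x - 1\<close> were in
      \<open>Q\<close> too, so would be 1.\<close>
    have "x ^ d x \<in> Q"
      using ed[OF x(2)] Q_mult[OF x(1) OK_power[OF x(2), of "d x - 1"]]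
      by (metis mult.commute power_minus_mult)
    hence "x ^ d x - 1 \<notin> Q"
      using Q_diff[of "x ^ d x" "x ^ d x - 1"] Q_one by auto
    moreover have "(\<Prod>x\<in>V. x ^ d x - 1) \<in> OK" using insert.prems U(3) by (auto intro!: OK_prod)
    ultimately show ?case using insert Q_prime[of "x ^ d x - 1"] x by auto
  qed
  hence sQ: "s \<notin> Q" unfolding s_def using U(1) by blast
  have s_div: "s / of_nat m \<notin> OK"
  proof
    assume "s / of_nat m \<in> OK"
    hence "of_nat m * (s / of_nat m) \<in> Q" using m(2) by (rule Q_mult[rotated])
    thus False using sQ m0 by simp
  qed
  have s_nil: "\<exists>n. s * x ^ n / of_nat m \<in> OK" if x: "x \<in> U" for x
  proof -
    define w where "w = (\<Prod>x\<in>U - {x}. x ^ d x - 1)"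
    have "w \<in> OK" unfolding w_def using U(3) by (auto intro!: OK_prod)
    have s_eq: "s = (x ^ d x - 1) * w" unfolding s_def w_def using U(1) x by (rule prod.remove)
    have "s * x ^ e x / of_nat m = w * ((x ^ (e x + d x) - x ^ e x) / of_nat m)"
      unfolding s_eq by (simp add: algebra_simps power_add)
    also have "\<dots> \<in> OK" using \<open>w \<in> OK\<close> ed[of x] x U(3) by (intro OK_mult) auto
    finally show ?thesis by blast
  qed
  have "\<exists>b\<in>OK. b / of_nat m \<notin> OK \<and> (\<forall>x\<in>V. b * x / of_nat m \<in> OK) \<and>
      (\<forall>x\<in>U. \<exists>n. b * x ^ n / of_nat m \<in> OK)" if "finite V" "V \<subseteq> U" for V
    using that
  proof (induction V rule: finite_induct)
    case empty
    show ?case using s_OK s_div s_nil by (intro bexI[of _ s]) auto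
  next
    case (insert x V)
    then obtain b where b: "b \<in> OK" "b / of_nat m \<notin> OK" "\<forall>x\<in>V. b * x / of_nat m \<in> OK"
      "\<forall>x\<in>U. \<exists>n. b * x ^ n / of_nat m \<in> OK" by auto
    define n where "n = (LEAST n. b * x ^ n / of_nat m \<in> OK)"
    have x: "x \<in> U" "x \<in> OK" using insert.prems U(3) by auto
    have n: "b * x ^ n / of_nat m \<in> OK"
      using LeastI_ex[of "\<lambda>n. b * x ^ n / of_nat m \<in> OK"] b(4) x(1) unfolding n_def by blast
    have n0: "n \<noteq> 0" using n b(2) by (metis mult.right_neutral power_0)
    have less: "b * x ^ (n - 1) / of_nat m \<notin> OK"
      using not_less_Least[of "n - 1" "\<lambda>n. b * x ^ n / of_nat m \<in> OK"] n0 by (simp add: n_def)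
    let ?b = "b * x ^ (n - 1)"
    have scale: "?b * y / of_nat m = x ^ (n - 1) * (b * y / of_nat m)" for y by simp
    have "?b * x = b * x ^ n" using power_minus_mult[of n x] n0 by (simp add: mult.assoc)
    hence "?b * x / of_nat m \<in> OK" using n by (simp only:)
    moreover have "?b * y / of_nat m \<in> OK" if "y \<in> V" for y
      unfolding scale using that b(3) x(2) by (intro OK_mult OK_power) auto
    moreover have "\<exists>n. ?b * y ^ n / of_nat m \<in> OK" if y: "y \<in> U" for y
    proof -
      obtain l where l: "b * y ^ l / of_nat m \<in> OK" using b(4) y by blast
      have "?b * y ^ l / of_nat m \<in> OK" unfolding scale using l x(2) by (intro OK_mult OK_power)
      thus ?thesis by blast
    qed
    ultimately show ?case using less b(1) x(2) by (intro bexI[of _ ?b]) auto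
  qed
  from this[OF U(1)] obtain b where b: "b \<in> OK" "b / of_nat m \<notin> OK" "\<forall>x\<in>U. b * x / of_nat m \<in> OK"
    by auto
  \<comment> \<open>The representative of \<open>x\<close> modulo \<open>m\<close> again lies in
    \<open>Q\<close> because \<open>m\<close> does, so it is one of the finitely many elements of
    \<open>U\<close>.\<close>
  have "b * x / of_nat m \<in> OK" if x: "x \<in> Q" for x
  proof -
    obtain y where y: "y \<in> T" "(x - y) / of_nat m \<in> OK" using T(3) Q_OK[OF x] by blast
    have "x - y = of_nat m * ((x - y) / of_nat m)" using m0 by simp
    hence "x - y \<in> Q" using Q_mult[OF m(2) y(2)] by simp
    hence "y \<in> Q" using Q_diff[OF x, of "x - y"] by simp
    hence by_OK: "b * y / of_nat m \<in> OK" using y b by (simp add: U_def)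
    have eq: "b * x / of_nat m = b * ((x - y) / of_nat m) + b * y / of_nat m"
      by (simp add: algebra_simps add_divide_distrib diff_divide_distrib)
    show ?thesis unfolding eq by (intro OK_add OK_mult b(1) y(2) by_OK)
  qed
  thus ?thesis using that b by blast
qed

text \<open>The fractional ideal generated by \<open>1\<close> and \<open>\<gamma>\<close> is the inverse of \<open>Q\<close>.\<close>

lemma inverse_ideal:
  obtains \<gamma> x1 x2 where "\<gamma> \<in> K" "\<gamma> \<notin> OK" "\<And>x. x \<in> Q \<Longrightarrow> \<gamma> * x \<in> OK"
    "x1 \<in> Q" "x2 \<in> Q" "x1 + \<gamma> * x2 = 1"
proof -
  obtain m where m: "m > 0" "of_nat m \<in> Q" by (rule Q_integer)
  obtain b where b: "b \<in> OK" "b / of_nat m \<notin> OK" "\<And>x. x \<in> Q \<Longrightarrow> b * x / of_nat m \<in> OK"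
    by (rule annihilator[OF m]) blast
  define \<gamma> where "\<gamma> = b / of_nat m"
  have \<gamma>: "\<gamma> \<in> K" "\<gamma> \<notin> OK" "\<And>x. x \<in> Q \<Longrightarrow> \<gamma> * x \<in> OK"
    using b OK_K[OF b(1)] by (auto simp: \<gamma>_def)
  \<comment> \<open>Otherwise all products m \<gamma>^i stay in \<open>Q\<close>, the powers of
    \<open>\<gamma>\<close> have bounded denominator, and \<open>\<gamma>\<close> is
    integral.\<close>
  have "\<exists>x\<in>Q. \<gamma> * x \<notin> Q"
  proof (rule ccontr)
    assume *: "\<not> ?thesis"
    have "\<gamma> ^ i * of_nat m \<in> Q" for i
      by (induction i) (use * m(2) in \<open>auto simp: mult.assoc\<close>)
    hence "of_nat m * \<gamma> ^ i \<in> OK" for i using Q_OK by (simp add: mult.commute)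
    thus False using integral_of_bounded_denominator[OF \<gamma>(1) m(1)] \<gamma>(2) by blast
  qed
  then obtain x where x: "x \<in> Q" "\<gamma> * x \<notin> Q" by blast
  define w where "w = \<gamma> * x"
  have w: "w \<in> OK" "w \<notin> Q" using \<gamma>(3) x by (auto simp: w_def)
  \<comment> \<open>This puts \<open>w ^ i * (w ^ (j - i) - 1)\<close> in \<open>Q\<close>. As
    \<open>w\<close> is outside the prime \<open>Q\<close>, 1 is congruent to
    \<open>w ^ (j - i)\<close> modulo \<open>Q\<close>, and that power is \<open>\<gamma>\<close>
    times an element of \<open>Q\<close>.\<close>
  obtain i j :: nat where ij: "i < j" "(w ^ j - w ^ i) / of_nat m \<in> OK"
    using pigeonhole_mod[OF m(1), of "\<lambda>i. w ^ i"] w(1) by blast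
  have "of_nat m * ((w ^ j - w ^ i) / of_nat m) \<in> Q" using m(2) ij(2) by (rule Q_mult)
  moreover have "of_nat m * ((w ^ j - w ^ i) / of_nat m) = w ^ i * (w ^ (j - i) - 1)"
    using m(1) ij(1) by (simp add: algebra_simps flip: power_add)
  ultimately have "w ^ i \<in> Q \<or> w ^ (j - i) - 1 \<in> Q"
    using w(1) by (intro Q_prime) auto
  hence wQ: "w ^ (j - i) - 1 \<in> Q" using Q_prime_power[OF w(1)] w(2) by blast
  define x2 where "x2 = x * w ^ (j - i - 1)"
  have "\<gamma> * x2 = w ^ (j - i - 1) * w" by (simp add: x2_def w_def)
  also have "\<dots> = w ^ (j - i)" using ij(1) by (intro power_minus_mult) simp
  finally have "\<gamma> * x2 = w ^ (j - i)" .
  moreover have "x2 \<in> Q" unfolding x2_def using x(1) w(1) by (intro Q_mult) auto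
  ultimately show ?thesis
    using that[of \<gamma> "- (w ^ (j - i) - 1)" x2] \<gamma> Q_uminus[OF wQ] by simp
qed

lemma PIdl_eq: "PIdl\<^bsub>R\<^esub> y = {z * y | z. z \<in> OK}"
  by (simp add: cgenideal_def)

lemma PIdl_ideal: "y \<in> OK \<Longrightarrow> ideal (PIdl\<^bsub>R\<^esub> y) R"
  using Q.cgenideal_ideal[of y] by simp

sublocale I: comm_monoid "ideals_set R"
  by (rule Q.ideals_set_is_comm_monoid)

lemma ideals_set_simps [simp]:
  "carrier (ideals_set R) = {I. ideal I R}" "I \<otimes>\<^bsub>ideals_set R\<^esub> J = ideal_prod R I J"
  "\<one>\<^bsub>ideals_set R\<^esub> = OK"
  by (simp_all add: ideals_set_def)

lemma PIdl_mult:
  assumes "y \<in> OK" "z \<in> OK"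
  shows "ideal_prod R (PIdl\<^bsub>R\<^esub> y) (PIdl\<^bsub>R\<^esub> z) = PIdl\<^bsub>R\<^esub> (y * z)"
proof (rule antisym)
  show "ideal_prod R (PIdl\<^bsub>R\<^esub> y) (PIdl\<^bsub>R\<^esub> z) \<subseteq> PIdl\<^bsub>R\<^esub> (y * z)"
  proof
    fix x assume "x \<in> ideal_prod R (PIdl\<^bsub>R\<^esub> y) (PIdl\<^bsub>R\<^esub> z)"
    thus "x \<in> PIdl\<^bsub>R\<^esub> (y * z)"
    proof induction
      case (prod i j)
      then obtain a b where "a \<in> OK" "b \<in> OK" "i = a * y" "j = b * z" by (auto simp: PIdl_eq)
      thus ?case unfolding PIdl_eq by (intro CollectI exI[of _ "a * b"]) auto
    next
      case (sum s1 s2)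
      then obtain a b where "a \<in> OK" "b \<in> OK" "s1 = a * (y * z)" "s2 = b * (y * z)"
        by (auto simp: PIdl_eq)
      thus ?case unfolding PIdl_eq
        by (intro CollectI exI[of _ "a + b"]) (auto simp: algebra_simps)
    qed
  qed
  show "PIdl\<^bsub>R\<^esub> (y * z) \<subseteq> ideal_prod R (PIdl\<^bsub>R\<^esub> y) (PIdl\<^bsub>R\<^esub> z)"
  proof
    fix x assume "x \<in> PIdl\<^bsub>R\<^esub> (y * z)"
    then obtain a where a: "a \<in> OK" "x = a * (y * z)" by (auto simp: PIdl_eq)
    have "a * y \<in> PIdl\<^bsub>R\<^esub> y" "1 * z \<in> PIdl\<^bsub>R\<^esub> z" using a(1) unfolding PIdl_eq by blast+
    from ideal_prod.prod[OF this, of R] show "x \<in> ideal_prod R (PIdl\<^bsub>R\<^esub> y) (PIdl\<^bsub>R\<^esub> z)"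
      using a(2) by (simp add: mult.assoc)
  qed
qed

lemma PIdl_power:
  assumes "y \<in> OK"
  shows "PIdl\<^bsub>R\<^esub> y [^]\<^bsub>ideals_set R\<^esub> (n :: nat) = PIdl\<^bsub>R\<^esub> (y ^ n)"
proof (induction n)
  case 0
  show ?case by (auto simp: PIdl_eq)
next
  case (Suc n)
  thus ?case using assms by (simp add: PIdl_mult OK_power mult.commute)
qed

text \<open>To contain is to divide: the cofactor \<open>J\<close> is \<open>y\<close> times the
  inverse of \<open>Q\<close>, generated by \<open>y\<close> and \<open>\<gamma> * y\<close>. The
  identity \<open>x1 + \<gamma> * x2 = 1\<close> puts \<open>y\<close> into the product of
  \<open>Q\<close> and \<open>J\<close>.\<close>

lemma Q_divides_PIdl:
  assumes y: "y \<in> Q"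
  shows "Q divides\<^bsub>ideals_set R\<^esub> PIdl\<^bsub>R\<^esub> y"
proof -
  obtain \<gamma> x1 x2 where \<gamma>: "\<gamma> \<in> K" "\<gamma> \<notin> OK" "\<And>x. x \<in> Q \<Longrightarrow> \<gamma> * x \<in> OK"
    "x1 \<in> Q" "x2 \<in> Q" "x1 + \<gamma> * x2 = 1" by (rule inverse_ideal) blast
  define g where "g = \<gamma> * y"
  have g: "g \<in> OK" "y \<in> OK" using \<gamma>(3) y Q_OK by (auto simp: g_def)
  define J where "J = {y * c + g * d | c d. c \<in> OK \<and> d \<in> OK}"
  have JI: "y * c + g * d \<in> J" if "c \<in> OK" "d \<in> OK" for c d
    using that by (auto simp: J_def)
  have J: "ideal J R"
  proof (rule idealI)
    show "ring R" by (rule Q.ring_axioms)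
    show "subgroup J (add_monoid R)"
    proof (rule Q.add.subgroupI)
      show "J \<subseteq> carrier R" using g by (auto simp: J_def)
      show "J \<noteq> {}" using JI by blast
      fix a b assume "a \<in> J"
      then obtain c d where cd: "a = y * c + g * d" "c \<in> OK" "d \<in> OK" by (auto simp: J_def)
      have aOK: "a \<in> OK" using cd g by auto
      have "\<ominus>\<^bsub>R\<^esub> a = - a"
        using Q.minus_equality[of "- a" a] aOK by auto
      also have "\<dots> = y * (- c) + g * (- d)" by (simp add: cd)
      finally show "\<ominus>\<^bsub>R\<^esub> a \<in> J" using JI[of "- c" "- d"] cd by auto
      assume "b \<in> J"
      then obtain c' d' where "b = y * c' + g * d'" "c' \<in> OK" "d' \<in> OK" by (auto simp: J_def)
      thus "a \<oplus>\<^bsub>R\<^esub> b \<in> J" using JI[of "c + c'" "d + d'"] cd by (auto simp: algebra_simps)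
    qed
    fix a x assume ax: "a \<in> J" "x \<in> carrier R"
    then obtain c d where cd: "a = y * c + g * d" "c \<in> OK" "d \<in> OK" by (auto simp: J_def)
    show "x \<otimes>\<^bsub>R\<^esub> a \<in> J" "a \<otimes>\<^bsub>R\<^esub> x \<in> J"
      using JI[of "c * x" "d * x"] cd ax(2) by (auto simp: algebra_simps)
  qed
  have "PIdl\<^bsub>R\<^esub> y = ideal_prod R Q J"
  proof (rule antisym)
    show "PIdl\<^bsub>R\<^esub> y \<subseteq> ideal_prod R Q J"
    proof
      fix x assume "x \<in> PIdl\<^bsub>R\<^esub> y"
      then obtain z where z: "z \<in> OK" "x = z * y" by (auto simp: PIdl_eq)
      have "x = z * ((x1 + \<gamma> * x2) * y)" using z \<gamma>(6) by simp
      also have "\<dots> = x1 * (y * z + g * 0) + x2 * (y * 0 + g * z)"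
        by (simp add: g_def algebra_simps)
      finally have x: "x = x1 * (y * z + g * 0) + x2 * (y * 0 + g * z)" .
      have 1: "x1 \<otimes>\<^bsub>R\<^esub> (y * z + g * 0) \<in> ideal_prod R Q J"
        by (rule ideal_prod.prod[OF \<gamma>(4) JI[OF z(1) OK_zero]])
      have 2: "x2 \<otimes>\<^bsub>R\<^esub> (y * 0 + g * z) \<in> ideal_prod R Q J"
        by (rule ideal_prod.prod[OF \<gamma>(5) JI[OF OK_zero z(1)]])
      from ideal_prod.sum[OF 1 2] show "x \<in> ideal_prod R Q J" unfolding x by simp
    qed
    show "ideal_prod R Q J \<subseteq> PIdl\<^bsub>R\<^esub> y"
    proof
      fix x assume "x \<in> ideal_prod R Q J"
      thus "x \<in> PIdl\<^bsub>R\<^esub> y"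
      proof induction
        case (prod i j)
        then obtain c d where cd: "j = y * c + g * d" "c \<in> OK" "d \<in> OK" by (auto simp: J_def)
        have "i \<otimes>\<^bsub>R\<^esub> j = (i * c + \<gamma> * i * d) * y" by (simp add: cd g_def algebra_simps)
        moreover have "i * c + \<gamma> * i * d \<in> OK" using prod(1) cd \<gamma>(3) Q_OK by auto
        ultimately show ?case unfolding PIdl_eq by blast
      next
        case (sum s1 s2)
        then obtain a b where "a \<in> OK" "b \<in> OK" "s1 = a * y" "s2 = b * y"
          by (auto simp: PIdl_eq)
        thus ?case unfolding PIdl_eq
          by (intro CollectI exI[of _ "a + b"]) (auto simp: algebra_simps)
      qed
    qed
  qed
  thus ?thesis using J by (auto simp: factor_def)
qed

text \<open>This makes the \<open>GREATEST\<close> in \<open>ideal_val\<close> meaningful.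
  Multiplication by \<open>\<gamma> ^ i\<close> maps the \<open>e\<close>-th power of
  \<open>Q\<close> into O for i at most \<open>e\<close>, so unbounded exponents would make every
  \<open>\<gamma> ^ i * t\<close> integral and then \<open>\<gamma>\<close> itself.\<close>

lemma Q_power_bounded:
  assumes t: "t \<in> OK" "t \<noteq> 0"
  obtains n where "\<And>e :: nat. (Q [^]\<^bsub>ideals_set R\<^esub> e) divides\<^bsub>ideals_set R\<^esub> (PIdl\<^bsub>R\<^esub> t) \<Longrightarrow> e \<le> n"
proof -
  obtain \<gamma> x1 x2 where \<gamma>: "\<gamma> \<in> K" "\<gamma> \<notin> OK" "\<And>x. x \<in> Q \<Longrightarrow> \<gamma> * x \<in> OK"
    by (rule inverse_ideal) blast
  have pow_ideal: "ideal (Q [^]\<^bsub>ideals_set R\<^esub> e) R" for e :: nat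
    using I.nat_pow_closed[of Q e] Q.ideal_axioms by simp
  have pow: "\<gamma> ^ i * x \<in> OK" if "x \<in> Q [^]\<^bsub>ideals_set R\<^esub> e" "i \<le> e" for x i and e :: nat
    using that
  proof (induction e arbitrary: x i)
    case 0
    thus ?case by simp
  next
    case (Suc e)
    from Suc.prems(1) have "x \<in> ideal_prod R (Q [^]\<^bsub>ideals_set R\<^esub> e) Q" by simp
    thus ?case
    proof induction
      case (prod a b)
      show ?case
      proof (cases "i \<le> e")
        case True
        have "\<gamma> ^ i * (a \<otimes>\<^bsub>R\<^esub> b) = \<gamma> ^ i * a * b" by simp
        thus ?thesis using Suc.IH[OF prod(1) True] Q_OK[OF prod(2)] by (simp only:) blast
      next
        case False
        hence "i = Suc e" using Suc.prems(2) by simp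
        hence "\<gamma> ^ i * (a \<otimes>\<^bsub>R\<^esub> b) = \<gamma> ^ e * a * (\<gamma> * b)" by simp
        thus ?thesis using Suc.IH[OF prod(1) order_refl] \<gamma>(3)[OF prod(2)] by (simp only:) blast
      qed
    next
      case (sum s1 s2)
      thus ?case by (simp add: distrib_left OK_add)
    qed
  qed
  obtain m y where m: "m > 0" "y \<in> OK" "of_nat m = t * y" using OK_dvd_integer[OF t] .
  have "\<exists>i. \<gamma> ^ i * t \<notin> OK"
  proof (rule ccontr)
    assume *: "\<not> ?thesis"
    have "of_nat m * \<gamma> ^ i \<in> OK" for i
    proof -
      have "of_nat m * \<gamma> ^ i = (\<gamma> ^ i * t) * y" by (simp add: m(3))
      moreover have "\<gamma> ^ i * t \<in> OK" using * by blast
      ultimately show ?thesis using m(2) by (simp only:) blast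
    qed
    thus False using integral_of_bounded_denominator[OF \<gamma>(1) m(1)] \<gamma>(2) by blast
  qed
  then obtain n where n: "\<gamma> ^ n * t \<notin> OK" by blast
  show ?thesis
  proof (rule that[of n], rule ccontr)
    fix e :: nat
    assume "(Q [^]\<^bsub>ideals_set R\<^esub> e) divides\<^bsub>ideals_set R\<^esub> (PIdl\<^bsub>R\<^esub> t)" and e: "\<not> e \<le> n"
    then obtain J where J: "ideal J R" "PIdl\<^bsub>R\<^esub> t = ideal_prod R (Q [^]\<^bsub>ideals_set R\<^esub> e) J"
      by (auto simp: factor_def)
    have "1 * t \<in> PIdl\<^bsub>R\<^esub> t" unfolding PIdl_eq by blast
    hence "t \<in> Q [^]\<^bsub>ideals_set R\<^esub> e"
      using Q.ideal_prod_inter[OF pow_ideal J(1)] J(2) by auto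
    thus False using pow[of t e n] e n by simp
  qed
qed

text \<open>A positive valuation puts \<open>y ^ k\<close>, hence \<open>y\<close>, into the prime
  \<open>Q\<close>. Then \<open>Q\<close> divides (y), and its \<open>k\<close>-th power divides
  (y^k).\<close>

lemma ideal_val_power_ge:
  assumes y: "y \<in> OK" "y \<noteq> 0" and val: "ideal_val R Q (y ^ k) \<ge> 1" and k: "k > 0"
  shows "k \<le> ideal_val R Q (y ^ k)"
proof -
  let ?P = "\<lambda>e :: nat. (Q [^]\<^bsub>ideals_set R\<^esub> e) divides\<^bsub>ideals_set R\<^esub> (PIdl\<^bsub>R\<^esub> (y ^ k))"
  have t: "y ^ k \<in> OK" "y ^ k \<noteq> 0" using y by auto
  obtain n where n: "\<And>e. ?P e \<Longrightarrow> e \<le> n" using Q_power_bounded[OF t] by blast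
  have Qc: "Q \<in> carrier (ideals_set R)" using Q.ideal_axioms by simp
  \<comment> \<open>Exponent 0 always divides; together with the bound \<open>n\<close> this shows
    that the greatest exponent is attained.\<close>
  have P0: "?P 0"
    using PIdl_ideal[OF t(1)] I.l_one[of "PIdl\<^bsub>R\<^esub> (y ^ k)"] unfolding factor_def
    by (intro bexI[of _ "PIdl\<^bsub>R\<^esub> (y ^ k)"]) auto
  have P: "?P (ideal_val R Q (y ^ k))"
    unfolding ideal_val_def by (rule GreatestI_nat[where P = ?P, OF P0 n])
  define v where "v = ideal_val R Q (y ^ k)"
  obtain v' where v': "v = Suc v'" using val by (cases v) (auto simp: v_def)
  obtain J where J: "ideal J R" "PIdl\<^bsub>R\<^esub> (y ^ k) = ideal_prod R (Q [^]\<^bsub>ideals_set R\<^esub> v) J"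
    using P by (auto simp: factor_def v_def)
  have pid: "ideal (Q [^]\<^bsub>ideals_set R\<^esub> e) R" for e :: nat
    using I.nat_pow_closed[OF Qc, of e] by simp
  have "1 * y ^ k \<in> PIdl\<^bsub>R\<^esub> (y ^ k)" unfolding PIdl_eq by blast
  hence "y ^ k \<in> Q [^]\<^bsub>ideals_set R\<^esub> v"
    using Q.ideal_prod_inter[OF pid J(1)] J(2) by auto
  hence "y ^ k \<in> Q"
    using Q.ideal_prod_inter[OF pid Q.ideal_axioms, of v'] by (auto simp: v')
  hence "y \<in> Q" by (rule Q_prime_power[OF y(1)])
  then obtain I where I: "ideal I R" "PIdl\<^bsub>R\<^esub> y = ideal_prod R Q I"
    using Q_divides_PIdl by (auto simp: factor_def)
  have "PIdl\<^bsub>R\<^esub> (y ^ k) = (Q \<otimes>\<^bsub>ideals_set R\<^esub> I) [^]\<^bsub>ideals_set R\<^esub> k"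
    by (simp add: PIdl_power[OF y(1), symmetric] I(2))
  also have "\<dots> = (Q [^]\<^bsub>ideals_set R\<^esub> k) \<otimes>\<^bsub>ideals_set R\<^esub> (I [^]\<^bsub>ideals_set R\<^esub> k)"
    using I(1) by (intro I.nat_pow_distrib Qc) simp
  finally have Pk: "?P k"
    unfolding factor_def using I.nat_pow_closed[of I k] I(1) by auto
  show ?thesis unfolding ideal_val_def by (rule Greatest_le_nat[where P = ?P, OF Pk n])
qed

end

section \<open>Automorphisms fixing a radical\<close>

lemma adjoin_rat_finite:
  assumes K: "cfield K" "finite B" "K \<subseteq> ratvs.span B" and S: "finite S" "\<And>x. x \<in> S \<Longrightarrow> algebraic_over K x"
  shows "\<exists>B'. finite B' \<and> adjoin K S \<subseteq> ratvs.span B'"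
  using S
proof (induction S rule: finite_induct)
  case empty
  thus ?case using K by (auto simp: adjoin_empty)
next
  case (insert x S)
  then obtain B' where B': "finite B'" "adjoin K S \<subseteq> ratvs.span B'" by auto
  interpret E: cfield "adjoin K S" by (rule cfield_adjoin)
  have "algebraic_over (adjoin K S) x"
    using insert.prems by (auto intro: algebraic_over_mono[OF adjoin_base])
  then obtain m where m: "is_minpoly (adjoin K S) x m" by (rule E.minpoly_exists)
  let ?C = "(\<lambda>(b, j). b * x ^ j) ` (B' \<times> {..<degree m})"
  have "finite ?C" using B'(1) by simp
  moreover have "adjoin K (insert x S) \<subseteq> ratvs.span ?C"
    using E.adjoin_rat_span[OF B'(2) m] by (simp only: adjoin_insert[of K x S])
  ultimately show ?case by (intro exI[of _ ?C] conjI)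
qed

lemma (in prime_power_cyclotomic) cis_in_R:
  assumes "\<not> p dvd c"
  shows "cis (2 * pi * real c / real q) \<in> R"
proof -
  have "cis (2 * pi * real c / real q) ^ q = cis (2 * pi * real c)"
    using q_pos by (simp add: DeMoivre)
  hence 1: "cis (2 * pi * real c / real q) ^ q = 1" by simp
  have "cis (2 * pi * real c / real q) ^ N = cis (2 * pi * real c / real p)"
    using N_pos by (simp add: DeMoivre q_eq)
  moreover have "cis (2 * pi * real c / real p) \<noteq> 1"
  proof
    assume "cis (2 * pi * real c / real p) = 1"
    hence "cos (2 * pi * real c / real p) = 1"
      by (metis cis.sel(1) one_complex.sel(1))
    then obtain n :: int where "2 * pi * real c / real p = of_int n * 2 * pi"
      by (auto simp: cos_one_2pi_int)
    hence "real c = of_int n * real p" using p_ge_2 by (simp add: field_simps)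
    hence "real_of_int (int c) = of_int (n * int p)" by simp
    hence "int c = n * int p" by (simp only: of_int_eq_iff)
    hence "int p dvd int c" by simp
    thus False using assms by simp
  qed
  ultimately show ?thesis using 1 by (simp add: R_def)
qed

section \<open>The tower F, L_1, L_k for one fixed k; \<open>y j\<close> stands for the chosen
  radical \<open>s k j\<close>\<close>

locale radical_setup = cfield F for F +
  fixes P :: "complex poly" and r k :: nat and t y :: "nat \<Rightarrow> complex"
  assumes P: "P \<in> polys_over F" "lead_coeff P = 1" "poly P 0 \<noteq> 0"
    and t: "t ` {1..r} = {z. poly P z = 0}" and r: "r \<ge> 1"
    and y: "\<And>j. j \<in> {1..r} \<Longrightarrow> y j ^ k = t j" and k: "k \<ge> 1"
begin

abbreviation "L1 \<equiv> splitting_field F P"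
abbreviation "L \<equiv> Lk F P k"

sublocale L1: splitting F P L1
  by standard (use P in auto)

sublocale L: splitting F "pcompose P (monom 1 k)" L
proof
  show "pcompose P (monom 1 k) \<in> polys_over F"
    unfolding polys_over_def using P(1)
    by (intro CollectI allI coeff_pcompose_semiring_closed) (auto simp: polys_overD)
  show "pcompose P (monom 1 k) \<noteq> 0"
    using P(2) k by (subst pcompose_eq_0_iff) (auto simp: degree_monom_eq)
qed (simp add: Lk_def)

lemma t_root: "j \<in> {1..r} \<Longrightarrow> poly P (t j) = 0" and t_nonzero: "j \<in> {1..r} \<Longrightarrow> t j \<noteq> 0"
  using t P(3) by auto

lemma t_L1: "j \<in> {1..r} \<Longrightarrow> t j \<in> L1"
  using L1.roots t_root by auto

lemma radical_in_L: "j \<in> {1..r} \<Longrightarrow> z ^ k = t j \<Longrightarrow> z \<in> L"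
  using L.roots t_root by (auto simp: poly_pcompose poly_monom)

lemma L1_sub_L: "L1 \<subseteq> L"
proof (rule L1.L_least[OF L.L.cfield_axioms L.base])
  show "{z. poly P z = 0} \<subseteq> L"
    unfolding t[symmetric]
  proof clarify
    fix j assume j: "j \<in> {1..r}"
    have "y j ^ k \<in> L" using radical_in_L[OF j y[OF j]] by (rule L.L.power_closed)
    thus "t j \<in> L" by (simp only: y[OF j])
  qed
qed

lemma adjoin_t: "j \<in> {1..r} \<Longrightarrow> F \<subseteq> adjoin F {t j} \<and> adjoin F {t j} \<subseteq> L1"
  using adjoin_base[of F "{t j}"] adjoin_least[OF L1.L.cfield_axioms L1.base, of "{t j}"] t_L1 by auto

definition "\<omega> = cis (2 * pi / real k)"

lemma \<omega>_power: "\<omega> ^ l = cis (2 * pi * real l / real k)"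
  by (simp add: \<omega>_def DeMoivre mult.commute)

lemma \<omega>_root: "\<omega> ^ k = 1"
  using k by (simp add: \<omega>_power)

lemma y_shift:
  assumes "j \<in> {1..r}"
  shows "(\<omega> ^ l * y j) ^ k = t j"
proof -
  have "(\<omega> ^ l) ^ k = (\<omega> ^ k) ^ l" by (simp only: power_mult[symmetric] mult.commute)
  thus ?thesis using y[OF assms] by (simp add: power_mult_distrib \<omega>_root)
qed

lemma y_nonzero: "j \<in> {1..r} \<Longrightarrow> y j \<noteq> 0"
  using y[of j] t_nonzero[of j] k by (auto simp: power_0_left)

text \<open>\<open>\<omega>\<close> is a quotient of two \<open>k\<close>-th roots of
  \<open>t 1\<close>; \<open>r \<ge> 1\<close> guarantees that there is such a root.\<close>

lemma \<omega>_L: "\<omega> \<in> L"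
proof -
  have 1: "1 \<in> {1..r}" using r by simp
  have "\<omega> ^ 1 * y 1 \<in> L" "\<omega> ^ 0 * y 1 \<in> L"
    by (rule radical_in_L[OF 1 y_shift[OF 1]])+
  hence "(\<omega> ^ 1 * y 1) / (\<omega> ^ 0 * y 1) \<in> L" by (rule L.L.divide_closed)
  thus ?thesis using y_nonzero[OF 1] by simp
qed

lemma finite_Gal_union: "finite (\<Union>j\<in>{1..r}. Gal L (adjoin F {t j}))"
  using adjoin_base by (intro finite_UN_I L.Gal_finite) auto

text \<open>F(t_j) lies inside \<open>L1\<close>, so whether an automorphism of \<open>L\<close>
  fixes it is visible on the restriction to \<open>L1\<close>.\<close>

lemma Dk_ge: "d1 F P r t * real (card (Gal L F)) \<le> real (Dk F P r t k)"
proof -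
  let ?U = "\<Union>j\<in>{1..r}. Gal L1 (adjoin F {t j})"
  have U: "?U \<subseteq> Gal L1 F" using Gal_antimono[OF adjoin_base] by blast
  have "{\<sigma> \<in> Gal L F. restrict \<sigma> L1 \<in> ?U} \<subseteq> (\<Union>j\<in>{1..r}. Gal L (adjoin F {t j}))"
  proof clarify
    fix \<sigma> j assume s: "\<sigma> \<in> Gal L F" and j: "j \<in> {1..r}" "restrict \<sigma> L1 \<in> Gal L1 (adjoin F {t j})"
    have "\<sigma> x = x" if x: "x \<in> adjoin F {t j}" for x
      using GalD(5)[OF j(2) x] adjoin_t[OF j(1)] x by (auto split: if_splits)
    hence "\<sigma> \<in> Gal L (adjoin F {t j})" using s by (auto simp: Gal_iff)
    thus "\<sigma> \<in> (\<Union>j\<in>{1..r}. Gal L (adjoin F {t j}))" using j(1) by blast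
  qed
  hence "card {\<sigma> \<in> Gal L F. restrict \<sigma> L1 \<in> ?U} \<le> Dk F P r t k"
    unfolding Dk_def by (rule card_mono[OF finite_Gal_union])
  hence "card ?U * card (Gal L F) \<le> Dk F P r t k * card (Gal L1 F)"
    using restriction_ratio_le[OF L.splitting_axioms L1.splitting_axioms L1_sub_L U]
    by (meson mult_le_mono1 order_trans)
  hence "real (card ?U) * real (card (Gal L F)) \<le> real (Dk F P r t k) * real (card (Gal L1 F))"
    by (metis of_nat_le_iff of_nat_mult)
  moreover have "card (Gal L1 F) > 0"
    using L1.id_in_Gal[of F] L1.base L1.Gal_finite[of F] by (auto simp: card_gt_0_iff)
  ultimately show ?thesis by (simp add: d1_def field_simps)
qed

lemma d1_pos: "d1 F P r t > 0"
proof -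
  let ?U = "\<Union>j\<in>{1..r}. Gal L1 (adjoin F {t j})"
  have 1: "1 \<in> {1..r}" using r by simp
  have "restrict (\<lambda>x. x) L1 \<in> ?U"
    using L1.id_in_Gal[of "adjoin F {t 1}"] adjoin_t[OF 1] 1 by blast
  moreover have "finite ?U"
    using adjoin_base by (intro finite_UN_I L1.Gal_finite) auto
  moreover have "restrict (\<lambda>x. x) L1 \<in> Gal L1 F" "finite (Gal L1 F)"
    using L1.id_in_Gal[of F] L1.base L1.Gal_finite[of F] by auto
  ultimately show ?thesis unfolding d1_def by (intro divide_pos_pos) (auto simp: card_gt_0_iff)
qed

lemma Gal_pos: "card (Gal L F) > 0"
  using L.id_in_Gal[of F] L.base L.Gal_finite[of F] by (auto simp: card_gt_0_iff)

text \<open>One set serves all \<open>l\<close> at once: each of the \<open>k\<close> radicals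
  generates over \<open>F\<close> a field containing the same primitive p^(A+1)-th root of unity,
  and \<open>S\<close> is the stabilizer of that root.\<close>

lemma root_of_unity_stabilizer:
  assumes B: "finite B" "F \<subseteq> ratvs.span B" and j: "j \<in> {1..r}"
    and m: "coprime m n" "n > 0" "y j = cis (2 * pi * real m / (real k * real n))"
    and p: "p \<in> prime_factors n" "p ^ A dvd k"
  obtains S where "(\<Union>l\<in>{0..<k}. Gal L (adjoin F {\<omega> ^ l * y j})) \<subseteq> S" "finite S"
    "p ^ A * card S \<le> card B * card (Gal L F)"
proof -
  have pr: "Factorial_Ring.prime p" "p dvd n" using p(1) by (auto simp: in_prime_factors_iff)
  interpret C: prime_power_cyclotomic p A by standard (rule pr(1))
  define \<zeta> where "\<zeta> = cis (2 * pi / real C.q)"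
  obtain k' where k': "k = p ^ A * k'" using p(2) by blast
  obtain n' where n': "n = p * n'" using pr(2) by blast
  have pos: "k' > 0" "n' > 0" using k k' m(2) n' by (auto intro: gr0I)
  have \<zeta>_mem: "\<zeta> \<in> adjoin F {\<omega> ^ l * y j}" for l
  proof -
    interpret E: cfield "adjoin F {\<omega> ^ l * y j}" by (rule cfield_adjoin)
    \<comment> \<open>The radical with index \<open>l\<close> has argument 2 \<pi> c / (k n). As
      \<open>p\<close> divides \<open>n\<close> but not \<open>m\<close>, it does not divide
      \<open>c\<close>.\<close>
    define c where "c = l * n + m"
    have "\<not> p dvd c"
    proof
      assume "p dvd c"
      hence "p dvd m" using pr(2) by (simp add: c_def dvd_add_right_iff)
      thus False using m(1) pr prime_gt_1_nat[OF pr(1)] by (metis coprime_common_divisor_nat less_irrefl)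
    qed
    hence R: "cis (2 * pi * real c / real C.q) \<in> C.R" by (rule C.cis_in_R)
    have "2 * pi * real l / real k + 2 * pi * real m / (real k * real n) =
        2 * pi * real c / (real k * real n)"
      using k m(2) by (simp add: c_def field_simps)
    hence eq: "\<omega> ^ l * y j = cis (2 * pi * real c / (real k * real n))"
      by (simp only: \<omega>_power m(3) cis_mult)
    \<comment> \<open>Here k n = q k' n': \<open>p ^ A\<close> comes from \<open>k\<close> and one
      more factor \<open>p\<close> from \<open>n\<close>, which explains the exponent A + 1.\<close>
    have "real (k' * n') * (2 * pi * real c / (real k * real n)) = 2 * pi * real c / real C.q"
      using pos prime_gt_0_nat[OF pr(1)] by (simp add: k' n' C.q_def field_simps)
    hence "(\<omega> ^ l * y j) ^ (k' * n') = cis (2 * pi * real c / real C.q)"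
      unfolding eq DeMoivre by simp
    hence "cis (2 * pi * real c / real C.q) \<in> adjoin F {\<omega> ^ l * y j}"
      using adjoin_gens[of "{\<omega> ^ l * y j}" F] E.power_closed by (metis insertI1 subsetD)
    moreover have "\<zeta> ^ C.q = 1" using C.q_pos by (simp add: \<zeta>_def DeMoivre)
    then obtain i where "\<zeta> = cis (2 * pi * real c / real C.q) ^ i"
      using C.R_power_generates[OF R] by blast
    ultimately show ?thesis using E.power_closed by simp
  qed
  have \<zeta>R: "\<zeta> \<in> C.R"
    using C.cis_in_R[of 1] C.p_ge_2 by (simp add: \<zeta>_def)
  have "\<omega> ^ 0 * y j \<in> L" by (rule radical_in_L[OF j y_shift[OF j]])
  hence \<zeta>L: "\<zeta> \<in> L"
    using \<zeta>_mem[of 0] adjoin_least[OF L.L.cfield_axioms L.base, of "{\<omega> ^ 0 * y j}"] by auto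
  have "algebraic_over F \<zeta>"
    unfolding algebraic_over_def
  proof (intro bexI conjI)
    show "monom 1 C.q - 1 \<noteq> (0 :: complex poly)"
      using C.degree_X_minus_1[OF C.q_pos] C.q_pos by auto
    show "poly (monom 1 C.q - 1) \<zeta> = 0" using \<zeta>R by (simp add: poly_monom C.R_def)
  qed auto
  then obtain f where f: "is_minpoly F \<zeta> f" by (rule minpoly_exists)
  define S where "S = {\<tau> \<in> Gal L F. \<tau> \<zeta> = \<zeta>}"
  have "p ^ A * card S \<le> card B * degree f * card S"
    using C.cyclotomic_degree[OF cfield_axioms B(2,1) \<zeta>R f] by simp
  also have "\<dots> \<le> card B * card (Gal L F)"
    using L.degree_mult_stabilizer_le[OF cfield_axioms order_refl L.base \<zeta>L f]
    by (simp add: S_def)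
  finally have "p ^ A * card S \<le> card B * card (Gal L F)" .
  moreover have "finite S" using L.Gal_finite[of F] by (simp add: S_def)
  moreover have "(\<Union>l\<in>{0..<k}. Gal L (adjoin F {\<omega> ^ l * y j})) \<subseteq> S"
  proof clarify
    fix l \<sigma> assume s: "\<sigma> \<in> Gal L (adjoin F {\<omega> ^ l * y j})"
    thus "\<sigma> \<in> S" using Gal_antimono[OF adjoin_base] GalD(5)[OF s \<zeta>_mem] by (auto simp: S_def)
  qed
  ultimately show ?thesis using that by blast
qed

text \<open>Some \<open>\<tau>\<close> over L_1(\<omega>) moves every \<open>y j\<close> with
  \<open>j\<close> in \<open>J\<close>. It fixes all \<open>t j\<close>, so it is counted by
  \<open>Dk\<close>; it fixes \<open>\<omega>\<close>, so it fixes no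
  \<open>\<omega> ^ l * y j\<close>. The containment of the two unions is therefore strict.\<close>

lemma radical_union_less:
  assumes kp: "Factorial_Ring.prime k" and J: "J \<subseteq> {1..r}" "J \<noteq> {}" "card J < k"
    and nopow: "\<And>j z. j \<in> J \<Longrightarrow> z \<in> L1 \<Longrightarrow> z ^ k \<noteq> t j"
  shows "card (\<Union>j\<in>J. \<Union>l\<in>{0..<k}. Gal L (adjoin F {\<omega> ^ l * y j})) < Dk F P r t k"
proof -
  let ?E = "adjoin L1 {\<omega>}"
  let ?G = "Gal L ?E"
  have \<omega>1: "\<omega> \<noteq> 1"
  proof
    assume "\<omega> = 1"
    hence "cos (2 * pi / real k) = 1" by (metis \<omega>_def cis.sel(1) one_complex.sel(1))
    then obtain n :: int where "2 * pi / real k = of_int n * 2 * pi"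
      by (auto simp: cos_one_2pi_int)
    hence "1 = of_int n * real k" using k by (simp add: field_simps)
    hence "real_of_int 1 = of_int (n * int k)" by simp
    hence "n * int k = 1" by (metis of_int_eq_iff)
    thus False using prime_gt_1_nat[OF kp] by (auto simp: zmult_eq_1_iff)
  qed
  have E: "F \<subseteq> ?E" "?E \<subseteq> L" "L1 \<subseteq> ?E" "\<omega> \<in> ?E"
    using L1.base adjoin_base[of L1 "{\<omega>}"] adjoin_gens[of "{\<omega>}" L1] L1_sub_L \<omega>_L
      adjoin_least[OF L.L.cfield_axioms L1_sub_L, of "{\<omega>}"] by auto
  interpret E: cfield ?E by (rule cfield_adjoin)
  have finG: "finite ?G" by (rule L.Gal_finite[OF E(1)])
  have G0: "card ?G > 0" using L.id_in_Gal[OF E(1,2)] finG by (auto simp: card_gt_0_iff)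
  have finJ: "finite J" using J(1) finite_subset by auto
  have st: "k * card {\<tau> \<in> ?G. \<tau> (y j) = y j} \<le> card ?G" if j: "j \<in> J" for j
  proof -
    have jr: "j \<in> {1..r}" using j J(1) by auto
    show ?thesis
      using L.radical_stabilizer_le[OF kp L1.L.cfield_axioms L1.base L1_sub_L \<omega>_L \<omega>_root \<omega>1
          radical_in_L[OF jr y[OF jr]] y[OF jr] t_L1[OF jr] t_nonzero[OF jr]] nopow[OF j] by blast
  qed
  \<comment> \<open>Fewer than \<open>k\<close> sets, each with at most a \<open>k\<close>-th part
    of \<open>?G\<close>, cannot cover \<open>?G\<close>.\<close>
  have "k * card (\<Union>j\<in>J. {\<tau> \<in> ?G. \<tau> (y j) = y j}) \<le> k * (\<Sum>j\<in>J. card {\<tau> \<in> ?G. \<tau> (y j) = y j})"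
    using card_UN_le[OF finJ] by (intro mult_le_mono2)
  also have "\<dots> = (\<Sum>j\<in>J. k * card {\<tau> \<in> ?G. \<tau> (y j) = y j})" by (simp add: sum_distrib_left)
  also have "\<dots> \<le> card J * card ?G" using sum_bounded_above[of J _ "card ?G"] st by simp
  also have "\<dots> < k * card ?G" using J(3) G0 by simp
  finally have less: "card (\<Union>j\<in>J. {\<tau> \<in> ?G. \<tau> (y j) = y j}) < card ?G" by simp
  have "\<not> ?G \<subseteq> (\<Union>j\<in>J. {\<tau> \<in> ?G. \<tau> (y j) = y j})"
    using card_mono[of "\<Union>j\<in>J. {\<tau> \<in> ?G. \<tau> (y j) = y j}" ?G] finG finJ less by auto
  then obtain \<tau> where \<tau>: "\<tau> \<in> ?G" "\<And>j. j \<in> J \<Longrightarrow> \<tau> (y j) \<noteq> y j" by blast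
  note \<tau>' = GalD[OF \<tau>(1)]
  obtain j0 where j0: "j0 \<in> J" "j0 \<in> {1..r}" using J by blast
  have "\<tau> \<in> Gal L (adjoin F {t j0})"
    using Gal_antimono[of "adjoin F {t j0}" ?E L] adjoin_t[OF j0(2)] E(3) \<tau>(1) by blast
  hence in_big: "\<tau> \<in> (\<Union>j\<in>{1..r}. Gal L (adjoin F {t j}))" using j0 by blast
  have not_small: "\<tau> \<notin> (\<Union>j\<in>J. \<Union>l\<in>{0..<k}. Gal L (adjoin F {\<omega> ^ l * y j}))"
  proof clarify
    fix j l assume j: "j \<in> J" and t: "\<tau> \<in> Gal L (adjoin F {\<omega> ^ l * y j})"
    have jr: "j \<in> {1..r}" using j J(1) by auto
    have "\<omega> ^ l * y j \<in> adjoin F {\<omega> ^ l * y j}" using adjoin_gens by blast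
    hence "\<tau> (\<omega> ^ l * y j) = \<omega> ^ l * y j" by (rule GalD(5)[OF t])
    moreover have "\<tau> (\<omega> ^ l * y j) = \<tau> (\<omega> ^ l) * \<tau> (y j)"
      using \<omega>_L radical_in_L[OF jr y[OF jr]] by (intro L.L.emb_mult[OF \<tau>'(1)]) auto
    moreover have "\<tau> (\<omega> ^ l) = \<omega> ^ l" using \<tau>'(5) E(4) by auto
    moreover have "\<omega> \<noteq> 0" by (simp add: \<omega>_def)
    ultimately show False using \<tau>(2)[OF j] by simp
  qed
  have "(\<Union>j\<in>J. \<Union>l\<in>{0..<k}. Gal L (adjoin F {\<omega> ^ l * y j})) \<subseteq> (\<Union>j\<in>{1..r}. Gal L (adjoin F {t j}))"
  proof -
    have "Gal L (adjoin F {\<omega> ^ l * y j}) \<subseteq> Gal L (adjoin F {t j})" if j: "j \<in> J" for j l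
    proof (rule Gal_antimono)
      interpret E': cfield "adjoin F {\<omega> ^ l * y j}" by (rule cfield_adjoin)
      have "(\<omega> ^ l * y j) ^ k \<in> adjoin F {\<omega> ^ l * y j}"
        using adjoin_gens by blast
      moreover have "j \<in> {1..r}" using j J(1) by auto
      ultimately have "t j \<in> adjoin F {\<omega> ^ l * y j}" using y_shift[of j l] by simp
      thus "adjoin F {t j} \<subseteq> adjoin F {\<omega> ^ l * y j}"
        by (intro adjoin_least E'.cfield_axioms adjoin_base) simp
    qed
    thus ?thesis using J(1) by blast
  qed
  hence "(\<Union>j\<in>J. \<Union>l\<in>{0..<k}. Gal L (adjoin F {\<omega> ^ l * y j})) \<subset> (\<Union>j\<in>{1..r}. Gal L (adjoin F {t j}))"
    using in_big not_small by blast
  thus ?thesis unfolding Dk_def by (rule psubset_card_mono[OF finite_Gal_union])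
qed

end

text \<open>The root \<open>z\<close> is again a unit of the ring of integers. Raising its own
  expansion to the power \<open>k\<close> gives a second expansion of \<open>x\<close>, and
  uniqueness identifies the exponents.\<close>

lemma fundamental_units_power:
  assumes L: "cfield L" and fu: "fundamental_units L v u"
    and x: "x \<in> Units (ring_of_integers L)" "root_of_unity \<zeta>" "x = \<zeta> * (\<Prod>l\<in>{1..v}. u l powi (a l))"
    and z: "z \<in> L" "z ^ k = x" "k > 0" and l: "l \<in> {1..v}"
  shows "int k dvd a l"
proof -
  interpret cfield L by fact
  let ?O = "ring_of_integers L"
  have carr: "carrier ?O = {x \<in> L. algebraic_int x}" by (simp add: ring_of_integers_def)
  have mul: "x \<otimes>\<^bsub>?O\<^esub> y = x * y" for x y by (simp add: ring_of_integers_def)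
  have one: "\<one>\<^bsub>?O\<^esub> = 1" by (simp add: ring_of_integers_def)
  have U: "w \<in> Units ?O \<longleftrightarrow> w \<in> L \<and> algebraic_int w \<and> w \<noteq> 0 \<and> algebraic_int (inverse w)" for w
  proof
    assume "w \<in> Units ?O"
    then obtain w' where w': "w \<in> L" "algebraic_int w" "algebraic_int w'" "w * w' = 1"
      by (auto simp: Units_def carr mul one)
    hence "w' = inverse w" by (metis inverse_unique)
    thus "w \<in> L \<and> algebraic_int w \<and> w \<noteq> 0 \<and> algebraic_int (inverse w)" using w' by auto
  next
    assume "w \<in> L \<and> algebraic_int w \<and> w \<noteq> 0 \<and> algebraic_int (inverse w)"
    thus "w \<in> Units ?O" by (auto simp: Units_def carr mul one intro!: bexI[of _ "inverse w"])
  qed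
  define R where "R = (\<lambda>x \<zeta> e. \<zeta> \<in> L \<and> root_of_unity \<zeta> \<and> e \<in> extensional {1..v} \<and>
     x = \<zeta> * (\<Prod>l\<in>{1..v}. u l powi (e l :: int)))"
  have ex1: "\<exists>!(\<zeta>, e). R x \<zeta> e" if "x \<in> Units ?O" for x
    using fu that unfolding fundamental_units_def R_def by blast
  have uL: "u l \<in> L" "u l \<noteq> 0" if "l \<in> {1..v}" for l
    using fu that U by (auto simp: fundamental_units_def)
  have x0: "x \<noteq> 0" "x \<in> L" "algebraic_int x" "algebraic_int (inverse x)" using x(1) U by auto
  have "z \<in> Units ?O"
    unfolding U using z x0 algebraic_int_nth_root[of z k] algebraic_int_nth_root[of "inverse z" k]
    by (auto simp: power_inverse)
  then obtain \<xi> e where e: "R z \<xi> e" using ex1[of z] by blast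
  have prod_nz: "(\<Prod>l\<in>{1..v}. u l powi (a l)) \<noteq> 0" "(\<Prod>l\<in>{1..v}. u l powi (a l)) \<in> L"
    using uL by (auto intro!: prod_closed powi_closed)
  \<comment> \<open>Uniqueness is stated for extensional exponents, hence the restriction;
    \<open>\<zeta> \<in> L\<close> is recovered by division.\<close>
  have 1: "R x \<zeta> (restrict a {1..v})"
  proof -
    have "\<zeta> = x / (\<Prod>l\<in>{1..v}. u l powi (a l))" using x(3) prod_nz(1) by simp
    hence "\<zeta> \<in> L" using x0(2) prod_nz(2) by auto
    thus ?thesis using x by (simp add: R_def)
  qed
  have 2: "R x (\<xi> ^ k) (restrict (\<lambda>l. int k * e l) {1..v})"
  proof -
    have "x = (\<xi> * (\<Prod>l\<in>{1..v}. u l powi (e l))) ^ k" using e z(2) by (simp add: R_def)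
    also have "\<dots> = \<xi> ^ k * (\<Prod>l\<in>{1..v}. u l powi (int k * e l))"
      by (simp add: power_mult_distrib prod_power_distrib power_int_power' mult.commute)
    finally have "x = \<xi> ^ k * (\<Prod>l\<in>{1..v}. u l powi (int k * e l))" .
    moreover have "root_of_unity (\<xi> ^ k)"
    proof -
      obtain N where "N > 0" "\<xi> ^ N = 1" using e by (auto simp: R_def root_of_unity_def)
      hence "(\<xi> ^ k) ^ N = 1" by (metis mult.commute power_mult power_one)
      thus ?thesis using \<open>N > 0\<close> by (auto simp: root_of_unity_def)
    qed
    ultimately show ?thesis using e by (auto simp: R_def)
  qed
  have "(\<zeta>, restrict a {1..v}) = (\<xi> ^ k, restrict (\<lambda>l. int k * e l) {1..v})"
    using ex1[OF x(1)] 1 2 by blast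
  hence "restrict a {1..v} l = restrict (\<lambda>l. int k * e l) {1..v} l" by simp
  hence "a l = int k * e l" using l by simp
  thus ?thesis by simp
qed

theorem theorem4:
  fixes F :: "complex set" and P :: "complex poly"
    and r1 r2 r3 r k :: nat
    and t :: "nat \<Rightarrow> complex" and m n :: "nat \<Rightarrow> nat"
    and s :: "nat \<Rightarrow> nat \<Rightarrow> complex"
    and L1 :: "complex set"
  assumes "number_field F"
    and "\<forall>i. coeff P i \<in> carrier (ring_of_integers F)"
    and "lead_coeff P = 1" and "rsquarefree P"
    and "poly P 0 \<noteq> 0" and "poly P 1 \<noteq> 0"
    and L1: "L1 = splitting_field F P"
    and r: "r = r1 + r2 + r3"
    and "inj_on t {1..r}" and "t ` {1..r} = {z. poly P z = 0}"
    and "\<forall>j\<in>{1..r1}. root_of_unity (t j)"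
    and "\<forall>j\<in>{r1+1..r1+r2}. t j \<in> Units (ring_of_integers L1) \<and> \<not> root_of_unity (t j)"
    and "\<forall>j\<in>{r1+r2+1..r}. t j \<notin> Units (ring_of_integers L1)"
    and "\<forall>j\<in>{1..r1}. coprime (m j) (n j) \<and> 1 \<le> m j \<and> m j < n j \<and>
           t j = cis (2 * pi * real (m j) / real (n j))"
    and "\<forall>k'\<ge>1. \<forall>j\<in>{1..r}. s k' j ^ k' = t j"
    and "\<forall>k'\<ge>1. \<forall>j\<in>{1..r1}. s k' j = cis (2 * pi * real (m j) / (real k' * real (n j)))"
    and "k \<ge> 1"
  shows "(r1 > 0 \<longrightarrow>
           (\<forall>(p :: nat \<Rightarrow> nat) (\<epsilon> :: real) (A :: nat).
              (\<forall>j\<in>{1..r1}. p j \<in> prime_factors (n j)) \<longrightarrow> \<epsilon> > 0 \<longrightarrow> A > 0 \<longrightarrow>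
              real A > (ln (real (abs_degree F)) + ln (real r1) - ln (d1 F P r t) - ln \<epsilon>)
                         / ln (real (p_min r1 n)) \<longrightarrow>
              (LCM j\<in>{1..r1}. p j ^ A) dvd k \<longrightarrow>
              f1 F P r1 r t s k < \<epsilon>)) \<and>
         (r2 + r3 > 0 \<longrightarrow>
           (\<forall>(k0 :: nat) (v :: nat) (u :: nat \<Rightarrow> complex) (\<zeta> :: nat \<Rightarrow> complex)
              (a :: nat \<Rightarrow> nat \<Rightarrow> int) (Q :: nat \<Rightarrow> complex set).
              k0 \<ge> 1 \<longrightarrow>
              (\<forall>q. Factorial_Ring.prime q \<longrightarrow> q \<ge> k0 \<longrightarrow>
                 linearly_disjoint (adjoin \<rat> {cis (2 * pi / real q)}) L1) \<longrightarrow>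
              (r2 > 0 \<longrightarrow> fundamental_units L1 v u \<and>
                 (\<forall>j\<in>{r1+1..r1+r2}. root_of_unity (\<zeta> j) \<and>
                    t j = \<zeta> j * (\<Prod>l\<in>{1..v}. u l powi a j l))) \<longrightarrow>
              (\<forall>j\<in>{r1+r2+1..r}. primeideal (Q j) (ring_of_integers L1) \<and> Q j \<noteq> {0} \<and>
                 ideal_val (ring_of_integers L1) (Q j) (t j) \<ge> 1) \<longrightarrow>
              Factorial_Ring.prime k \<longrightarrow>
              k \<ge> c_const r2 r3 k0 (a_zero r1 r2 v a) (v_zero (ring_of_integers L1) r1 r2 r3 Q t) \<longrightarrow>
              f2 F P r1 r t s k < 1))"
proof -
  have F: "cfield F" using assms(1) by (simp add: number_field_def subfield_CC_iff)
  have P: "P \<in> polys_over F"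
    using assms(2) by (auto simp: polys_over_def ring_of_integers_def)
  have setting: "radical_setup F P r k t (s k)" if "r \<ge> 1"
    using F P assms(3,5,10,15,17) that by (simp add: radical_setup_def radical_setup_axioms_def)
  obtain B where B: "finite B" "card B \<le> abs_degree F" "F \<subseteq> ratvs.span B"
    using number_field_rat_span[OF assms(1)] .
  show ?thesis
  proof (rule conjI; intro impI allI)
    fix p :: "nat \<Rightarrow> nat" and \<epsilon> :: real and A :: nat
    assume r1: "r1 > 0" and p: "\<forall>j\<in>{1..r1}. p j \<in> prime_factors (n j)" and \<epsilon>: "\<epsilon> > 0"
      and A: "A > 0"
        "real A > (ln (real (abs_degree F)) + ln (real r1) - ln (d1 F P r t) - ln \<epsilon>)
           / ln (real (p_min r1 n))"
      and dvd: "(LCM j\<in>{1..r1}. p j ^ A) dvd k"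
    interpret radical_setup F P r k t "s k" using setting r1 r by simp
    define q where "q = p_min r1 n"
    define D where "D = abs_degree F"
    define g where "g = card (Gal L F)"
    let ?U = "\<lambda>j. \<Union>l\<in>{0..<k}. Gal L (adjoin F {\<omega> ^ l * s k j})"
    have primes: "finite (\<Union>j\<in>{1..r1}. prime_factors (n j))" "p 1 \<in> (\<Union>j\<in>{1..r1}. prime_factors (n j))"
      using p r1 by (auto intro!: bexI[of _ "Suc 0"])
    have "q \<in> (\<Union>j\<in>{1..r1}. prime_factors (n j))"
      unfolding q_def p_min_def using Min_in[OF primes(1)] primes(2) by blast
    hence q2: "q \<ge> 2" by (auto simp: in_prime_factors_iff dest: prime_ge_2_nat)
    have q_le: "q \<le> p j" if "j \<in> {1..r1}" for j
      unfolding q_def p_min_def using p that by (intro Min_le primes(1)) blast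
    \<comment> \<open>Needed for the logarithm of [F : Q]: an empty set cannot span a field that
      contains 1.\<close>
    have D0: "D > 0"
    proof -
      have "card B \<noteq> 0"
      proof
        assume "card B = 0"
        hence "B = {}" using B(1) by simp
        hence "F \<subseteq> {0}" using B(3) by simp
        thus False using one_closed by auto
      qed
      thus ?thesis using B(2) by (simp add: D_def)
    qed
    have bound: "q ^ A * card (?U j) \<le> D * g" if j: "j \<in> {1..r1}" for j
    proof -
      have jr: "j \<in> {1..r}" using j assms(8) by auto
      have "p j ^ A dvd (LCM j\<in>{1..r1}. p j ^ A)" using j by (intro dvd_Lcm) auto
      hence dv: "p j ^ A dvd k" using dvd by (rule dvd_trans)
      have mn: "coprime (m j) (n j)" "n j > 0" using bspec[OF assms(14) j] by auto
      have sj: "s k j = cis (2 * pi * real (m j) / (real k * real (n j)))"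
        using assms(16,17) j by blast
      have pj: "p j \<in> prime_factors (n j)" using p j by blast
      obtain S where S: "?U j \<subseteq> S" "finite S" "p j ^ A * card S \<le> card B * card (Gal L F)"
        using root_of_unity_stabilizer[OF B(1,3) jr mn sj pj dv] .
      \<comment> \<open>Replacing \<open>p j\<close> by the least prime makes the bounds uniform in
        \<open>j\<close>, ready for summation.\<close>
      have "q ^ A * card (?U j) \<le> p j ^ A * card S"
        using q_le[OF j] card_mono[OF S(2,1)] by (intro mult_le_mono power_mono) auto
      also have "\<dots> \<le> card B * card (Gal L F)" by (rule S(3))
      also have "\<dots> \<le> D * g" using B(2) by (simp add: D_def g_def)
      finally show ?thesis .
    qed
    have "q ^ A * card (\<Union>j\<in>{1..r1}. ?U j) \<le> q ^ A * (\<Sum>j\<in>{1..r1}. card (?U j))"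
      by (intro mult_le_mono2 card_UN_le) simp
    also have "\<dots> = (\<Sum>j\<in>{1..r1}. q ^ A * card (?U j))" by (simp add: sum_distrib_left)
    also have "\<dots> \<le> r1 * (D * g)"
      using sum_bounded_above[of "{1..r1}" "\<lambda>j. q ^ A * card (?U j)" "D * g"] bound by simp
    finally have "real (q ^ A * card (\<Union>j\<in>{1..r1}. ?U j)) \<le> real (r1 * (D * g))"
      by (simp only: of_nat_le_iff)
    hence up: "real q ^ A * real (card (\<Union>j\<in>{1..r1}. ?U j)) \<le> real D * real r1 * real g"
      by (simp add: mult_ac)
    define d where "d = d1 F P r t"
    have d0: "d > 0" unfolding d_def by (rule d1_pos)
    have g0: "real g > 0" using Gal_pos by (simp add: g_def)
    have Dk: "d * real g \<le> real (Dk F P r t k)" unfolding d_def g_def by (rule Dk_ge)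
    have lnq: "ln (real q) > 0" using q2 by simp
    \<comment> \<open>The numerator in the hypothesis on \<open>A\<close> is one logarithm, so that
      hypothesis can be exponentiated.\<close>
    have "ln (real D * real r1 / (d * \<epsilon>)) = ln (real D) + ln (real r1) - ln d - ln \<epsilon>"
      using D0 r1 d0 \<epsilon> by (simp add: ln_div ln_mult)
    also have "\<dots> < real A * ln (real q)"
      using A(2) lnq by (simp add: q_def D_def d_def pos_divide_less_eq)
    also have "\<dots> = ln (real q ^ A)" using q2 by (simp add: ln_realpow)
    finally have "real D * real r1 / (d * \<epsilon>) < real q ^ A"
      using D0 r1 d0 \<epsilon> q2 by (subst (asm) ln_less_cancel_iff) auto
    hence key: "real D * real r1 < real q ^ A * (d * \<epsilon>)"
      using d0 \<epsilon> by (simp add: pos_divide_less_eq)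
    have "real q ^ A * real (card (\<Union>j\<in>{1..r1}. ?U j)) < real q ^ A * (d * \<epsilon>) * real g"
      using up mult_strict_right_mono[OF key g0] by linarith
    hence "real (card (\<Union>j\<in>{1..r1}. ?U j)) < (d * \<epsilon>) * real g"
      using q2 by (simp add: mult.assoc)
    also have "\<dots> \<le> \<epsilon> * real (Dk F P r t k)"
      using Dk \<epsilon> by (simp add: mult.commute mult.left_commute)
    finally have "real (card (\<Union>j\<in>{1..r1}. ?U j)) < \<epsilon> * real (Dk F P r t k)" .
    moreover have "real (Dk F P r t k) > 0"
      using Dk mult_pos_pos[OF d0 g0] by linarith
    ultimately have "real (card (\<Union>j\<in>{1..r1}. ?U j)) / real (Dk F P r t k) < \<epsilon>"
      by (simp add: pos_divide_less_eq)
    thus "f1 F P r1 r t s k < \<epsilon>"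
      using r1 by (simp add: f1_def \<omega>_power)
  next
    fix k0 v :: nat and u \<zeta> :: "nat \<Rightarrow> complex" and a :: "nat \<Rightarrow> nat \<Rightarrow> int" and Q :: "nat \<Rightarrow> complex set"
    let ?O = "ring_of_integers L1"
    define a0 where "a0 = a_zero r1 r2 v a"
    define v0 where "v0 = v_zero ?O r1 r2 r3 Q t"
    assume r23: "r2 + r3 > 0"
      and fu: "r2 > 0 \<longrightarrow> fundamental_units L1 v u \<and>
         (\<forall>j\<in>{r1+1..r1+r2}. root_of_unity (\<zeta> j) \<and> t j = \<zeta> j * (\<Prod>l\<in>{1..v}. u l powi a j l))"
      and Q: "\<forall>j\<in>{r1+r2+1..r}. primeideal (Q j) ?O \<and> Q j \<noteq> {0} \<and> ideal_val ?O (Q j) (t j) \<ge> 1"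
      and kp: "Factorial_Ring.prime k"
      and kc: "k \<ge> c_const r2 r3 k0 (a_zero r1 r2 v a) (v_zero ?O r1 r2 r3 Q t)"
    interpret S: radical_setup F P r k t "s k" using setting r23 r by simp
    have cL1: "cfield L1" unfolding assms(7) by (rule S.L1.L.cfield_axioms)
    \<comment> \<open>All valuations are at least 1, and the lcm over an empty index set is
      1.\<close>
    have v_pos: "v0 \<noteq> 0"
      unfolding v0_def v_zero_def using Q r by (auto simp: Lcm_0_iff)
    have v_le: "ideal_val ?O (Q j) (t j) \<le> v0" if "j \<in> {r1+r2+1..r}" for j
    proof (rule dvd_imp_le)
      show "ideal_val ?O (Q j) (t j) dvd v0"
        unfolding v0_def v_zero_def using that r by (intro dvd_Lcm) auto
    qed (use v_pos in simp)
    define b where "b = (\<lambda>j. GCD l\<in>{1..v}. nat \<bar>a j l\<bar>)"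
    \<comment> \<open>If all exponents vanished, \<open>t j\<close> would be the root of unity
      \<open>\<zeta> j\<close>.\<close>
    have b_nz: "b j \<noteq> 0" if j: "j \<in> {r1+1..r1+r2}" for j
    proof
      assume "b j = 0"
      hence z: "\<forall>l\<in>{1..v}. a j l = 0" by (auto simp: b_def Gcd_0_iff)
      have "t j = \<zeta> j * (\<Prod>l\<in>{1..v}. u l powi a j l)" "root_of_unity (\<zeta> j)" using bspec[OF conjunct2[OF mp[OF fu]] j] j by auto
      moreover have "(\<Prod>l\<in>{1..v}. u l powi a j l) = 1" using z by (intro prod.neutral) auto
      ultimately show False using bspec[OF assms(12) j] by simp
    qed
    have a_pos: "a0 \<noteq> 0"
      unfolding a0_def a_zero_def using b_nz by (auto simp: Lcm_0_iff b_def)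
    have b_le: "b j \<le> a0" if "j \<in> {r1+1..r1+r2}" for j
    proof (rule dvd_imp_le)
      show "b j dvd a0"
        unfolding a0_def a_zero_def b_def using that by (intro dvd_Lcm) auto
    qed (use a_pos in simp)
    have kr: "k > r2 + r3"
      using kc by (auto simp: c_const_def split: if_splits)
    \<comment> \<open>When both kinds of roots occur, \<open>c_const\<close> contains
      \<open>lcm a0 v0\<close>, which dominates each entry only because neither is zero.\<close>
    have ka: "k > a0" if "r2 > 0"
    proof (cases "r3 = 0")
      case True
      thus ?thesis using kc that by (auto simp: c_const_def a0_def)
    next
      case False
      have "a0 \<le> lcm a0 v0" using a_pos v_pos by (intro dvd_imp_le) (auto simp: lcm_pos_nat)
      thus ?thesis using kc that False by (auto simp: c_const_def a0_def v0_def)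
    qed
    have kv: "k > v0" if "r3 > 0"
    proof (cases "r2 = 0")
      case True
      thus ?thesis using kc that by (auto simp: c_const_def v0_def)
    next
      case False
      have "v0 \<le> lcm a0 v0" using a_pos v_pos by (intro dvd_imp_le) (auto simp: lcm_pos_nat)
      thus ?thesis using kc that False by (auto simp: c_const_def a0_def v0_def)
    qed
    \<comment> \<open>A finite rational spanning set of \<open>L1\<close> is what the theory of its
      prime ideals starts from.\<close>
    obtain B1 where B1: "finite B1" "L1 \<subseteq> ratvs.span B1"
    proof -
      have "algebraic_over F z" if "z \<in> {z. poly P z = 0}" for z
        using that P S.L1.p(2) by (auto simp: algebraic_over_def)
      thus ?thesis
        using adjoin_rat_finite[OF F B(1,3) S.L1.finite_roots] that
        unfolding assms(7) splitting_field_def by blast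
    qed
    have nopow: "z ^ k \<noteq> t j" if j: "j \<in> {r1+1..r}" and z: "z \<in> L1" for j z
    proof
      assume zk: "z ^ k = t j"
      have jr: "j \<in> {1..r}" using j by auto
      show False
      proof (cases "j \<le> r1 + r2")
        case True
        hence ju: "j \<in> {r1+1..r1+r2}" "r2 > 0" using j by auto
        have tj: "fundamental_units L1 v u" "t j \<in> Units ?O" "root_of_unity (\<zeta> j)"
          "t j = \<zeta> j * (\<Prod>l\<in>{1..v}. u l powi a j l)"
          using mp[OF fu ju(2)] ju(1) assms(12) by blast+
        have k0: "k > 0" using S.k by simp
        have "int k dvd a j l" if l: "l \<in> {1..v}" for l
          by (rule fundamental_units_power[OF cL1 tj z zk k0 l])
        hence "k dvd nat \<bar>a j l\<bar>" if "l \<in> {1..v}" for l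
          using that by simp
        hence "k dvd b j" unfolding b_def by (auto intro: Gcd_greatest)
        hence "k \<le> b j" using b_nz[OF ju(1)] by (intro dvd_imp_le) auto
        thus False using b_le[OF ju(1)] ka[OF ju(2)] by simp
      next
        case False
        hence jn: "j \<in> {r1+r2+1..r}" "r3 > 0" using j r by auto
        interpret I: integer_prime L1 B1 "Q j"
          using cL1 B1 Q jn
          by (simp add: integer_prime_def integer_prime_axioms_def rat_finite_field_def rat_finite_field_axioms_def)
        have "algebraic_int (t j)"
          using assms(2) by (intro algebraic_int_monic_root[OF assms(3) _ S.t_root[OF jr]])
            (auto simp: ring_of_integers_def)
        hence "algebraic_int z" using algebraic_int_nth_root[of z k] zk S.k by simp
        hence "z \<in> I.OK" using z by (simp add: I.OK_def)
        moreover have "z \<noteq> 0" using zk S.t_nonzero[OF jr] S.k by (auto simp: power_0_left)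
        ultimately have "k \<le> ideal_val ?O (Q j) (z ^ k)"
          using I.ideal_val_power_ge[of z k] Q jn(1) zk S.k by simp
        thus False using v_le[OF jn(1)] kv[OF jn(2)] zk by simp
      qed
    qed
    \<comment> \<open>The index set has r_2 + r_3 elements, which is less than \<open>k\<close> by
      the first entry of the maximum in \<open>c_const\<close>.\<close>
    have "card (\<Union>j\<in>{r1+1..r}. \<Union>l\<in>{0..<k}. Gal S.L (adjoin F {S.\<omega> ^ l * s k j})) < Dk F P r t k"
      using nopow assms(7) r r23 kr by (intro S.radical_union_less kp) auto
    thus "f2 F P r1 r t s k < 1"
      using r r23 by (simp add: f2_def S.\<omega>_power)
  qed
qed

end
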